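(* Let $\ell>2$ be an odd prime, let $c\in\mathbb F_\ell^*$ be a quadratic nonresidue, and let $t_c$ be the Frobenius trace of the smooth projective model over $\mathbb F_\ell$ of $Y^2=(X^2-1)(X^2-c)$. Then $$\operatorname{Var}_{A\in\mathbb F_\ell^*}(K(A,cA))=t_c^2\le4\ell.$$ Consequently, for every real $\mu>0$, $$\frac{1}{\ell-1}\#\{A\in\mathbb F_\ell^*:|K(A,cA)+1|\ge\mu\sqrt\ell\}\le\frac{4}{\mu^2}.$$ Moreover, if $\gamma$ is a primitive root modulo $\ell$, then for every real $\mu>0$, $$\frac{1}{\ell-1}\#\left\{N\in\mathbb F_\ell^*:\left||U_{\gamma,\gamma^2}(N;\ell)|-\frac{3\ell}{4}\right|\ge\frac{\mu\sqrt\ell+3}{4}\right\}\le\frac{4}{\mu^2}.$$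
   Context: $\chi$ denotes the Legendre symbol modulo $\ell$ on $\mathbb F_\ell$, with $\chi(0)=0$, and $K(A,B)=\sum_{z\in\mathbb F_\ell}\chi\bigl((z^2-A)(z^2-B)\bigr)$. $\operatorname{Var}_{A\in\mathbb F_\ell^*}$ is the variance with $A$ uniformly distributed on $\mathbb F_\ell^*$. A primitive root modulo $\ell$ is a generator of $\mathbb F_\ell^*$. For $a,b,N\in\mathbb F_\ell^*$, $H_a(N;\ell)=\{ax+Nx^{-1}:x\in\mathbb F_\ell^*\}\subseteq\mathbb F_\ell$ and $U_{a,b}(N;\ell)=H_a(N;\ell)\cup H_b(N;\ell)$. The smooth projective model of an affine curve over $\mathbb F_\ell$ is the nonsingular projective curve over $\mathbb F_\ell$ birational to it. The Frobenius trace of a smooth projective genus-one curve $E/\mathbb F_\ell$ is $t_E=\ell+1-\#E(\mathbb F_\ell)$. *)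

theory Defs
  imports
    "HOL-Probability.Probability"
    "HOL-Number_Theory.Number_Theory"
    "HOL-Algebra.Algebraic_Closure_Type"
    "HOL-Library.Poly_Mapping"
    "HOL-Library.Function_Algebras"
    "Berlekamp_Zassenhaus.Finite_Field"
begin

section \<open>Multivariate polynomials\<close>

text \<open>
  A polynomial in \<open>X\<^sub>0, X\<^sub>1, \<dots>\<close> maps exponent vectors to coefficients; both maps are
  finitely supported.
\<close>

type_synonym 'a mpoly = "(nat \<Rightarrow>\<^sub>0 nat) \<Rightarrow>\<^sub>0 'a"

definition mpoly_eval :: "'a::comm_ring_1 mpoly \<Rightarrow> (nat \<Rightarrow> 'a) \<Rightarrow> 'a" where
  "mpoly_eval p x =
     (\<Sum>m\<in>Poly_Mapping.keys p. Poly_Mapping.lookup p m *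
        (\<Prod>i\<in>Poly_Mapping.keys m. x i ^ Poly_Mapping.lookup m i))"

definition mpoly_deriv :: "nat \<Rightarrow> 'a::comm_ring_1 mpoly \<Rightarrow> 'a mpoly" where
  "mpoly_deriv i p =
     (\<Sum>m\<in>Poly_Mapping.keys p.
        Poly_Mapping.single (m - Poly_Mapping.single i 1)
          (of_nat (Poly_Mapping.lookup m i) * Poly_Mapping.lookup p m))"

text \<open>Homogeneous of degree \<open>d\<close> in \<open>X\<^sub>0, \<dots>, X\<^sub>n\<close>; the zero polynomial qualifies for every \<open>d\<close>.\<close>

definition hom_poly :: "nat \<Rightarrow> nat \<Rightarrow> 'a::comm_ring_1 mpoly \<Rightarrow> bool" where
  "hom_poly n d p \<longleftrightarrow>
     (\<forall>m\<in>Poly_Mapping.keys p. Poly_Mapping.keys m \<subseteq> {..n} \<and>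
        (\<Sum>i\<le>n. Poly_Mapping.lookup m i) = d)"

definition form :: "nat \<Rightarrow> 'a::comm_ring_1 mpoly \<Rightarrow> bool" where
  "form n p \<longleftrightarrow> (\<exists>d. hom_poly n d p)"


section \<open>Projective space and the Zariski topology\<close>

text \<open>
  A point of \<open>\<P>\<^sup>n\<close> is the set of all its homogeneous coordinate vectors
  \<open>(x\<^sub>0, \<dots>, x\<^sub>n)\<close>, padded by zeros to functions on all of \<open>nat\<close>.
\<close>

type_synonym 'a ppoint = "(nat \<Rightarrow> 'a) set"

definition proj_pt :: "(nat \<Rightarrow> 'a::field) \<Rightarrow> 'a ppoint" where
  "proj_pt x = {y. \<exists>a. a \<noteq> 0 \<and> y = (\<lambda>i. a * x i)}"

definition proj_space :: "nat \<Rightarrow> 'a::field ppoint set" where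
  "proj_space n = proj_pt ` {x. (\<forall>i>n. x i = 0) \<and> (\<exists>i\<le>n. x i \<noteq> 0)}"

definition vanishes_at :: "'a::field mpoly \<Rightarrow> 'a ppoint \<Rightarrow> bool" where
  "vanishes_at f P \<longleftrightarrow> (\<forall>x\<in>P. mpoly_eval f x = 0)"

definition proj_zeros :: "nat \<Rightarrow> 'a::field mpoly set \<Rightarrow> 'a ppoint set" where
  "proj_zeros n S = {P \<in> proj_space n. \<forall>f\<in>S. vanishes_at f P}"

definition zariski_closed :: "nat \<Rightarrow> 'a::field ppoint set \<Rightarrow> bool" where
  "zariski_closed n Z \<longleftrightarrow> (\<exists>S. (\<forall>f\<in>S. form n f) \<and> Z = proj_zeros n S)"

definition irreducible_closed :: "nat \<Rightarrow> 'a::field ppoint set \<Rightarrow> bool" where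
  "irreducible_closed n Z \<longleftrightarrow>
     zariski_closed n Z \<and> Z \<noteq> {} \<and>
     (\<forall>Z1 Z2. zariski_closed n Z1 \<longrightarrow> zariski_closed n Z2 \<longrightarrow> Z = Z1 \<union> Z2 \<longrightarrow> Z = Z1 \<or> Z = Z2)"

definition closed_chain :: "nat \<Rightarrow> 'a::field ppoint set \<Rightarrow> nat \<Rightarrow> bool" where
  "closed_chain n Z d \<longleftrightarrow>
     (\<exists>W. (\<forall>i\<le>d. irreducible_closed n (W i) \<and> W i \<subseteq> Z) \<and> (\<forall>i<d. W i \<subset> W (Suc i)))"

text \<open>Krull dimension; chains can be shortened, so it suffices to exclude length \<open>d + 1\<close>.\<close>

definition has_zariski_dim :: "nat \<Rightarrow> 'a::field ppoint set \<Rightarrow> nat \<Rightarrow> bool" where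
  "has_zariski_dim n Z d \<longleftrightarrow> closed_chain n Z d \<and> \<not> closed_chain n Z (Suc d)"

text \<open>
  The rank at \<open>x\<close> of the Jacobian matrix of the homogeneous ideal of \<open>E\<close>: the dimension of the
  span of the gradients at \<open>x\<close> of all forms vanishing on \<open>E\<close>.
\<close>

definition gradient :: "nat \<Rightarrow> 'a::field mpoly \<Rightarrow> (nat \<Rightarrow> 'a) \<Rightarrow> nat \<Rightarrow> 'a" where
  "gradient n f x = (\<lambda>i. if i \<le> n then mpoly_eval (mpoly_deriv i f) x else 0)"

definition jacobian_rank :: "nat \<Rightarrow> 'a::field ppoint set \<Rightarrow> (nat \<Rightarrow> 'a) \<Rightarrow> nat" where
  "jacobian_rank n E x =
     vector_space.dim (\<lambda>(a::'a) v (i::nat). a * v i)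
       {gradient n f x | f. form n f \<and> (\<forall>P\<in>E. vanishes_at f P)}"

text \<open>Jacobian criterion for a curve in \<open>\<P>\<^sup>n\<close> in homogeneous coordinates: rank \<open>n - 1\<close> everywhere.\<close>

definition nonsingular_curve :: "nat \<Rightarrow> 'a::field ppoint set \<Rightarrow> bool" where
  "nonsingular_curve n E \<longleftrightarrow> (\<forall>P\<in>E. \<forall>x\<in>P. jacobian_rank n E x = n - 1)"


section \<open>Curves over a perfect field \<open>k\<close>\<close>

text \<open>
  Varieties over \<open>k\<close> are given by their sets of points over the algebraic closure.  \<open>k\<close> is
  assumed perfect (it is finite in the application): then being cut out by polynomials over
  \<open>k\<close> is the same as having an ideal generated by such polynomials, and the Jacobian criterion
  characterises nonsingularity.
\<close>

definition base_field :: "'k::field alg_closure set" where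
  "base_field = range to_ac"

definition over_base :: "'k::field alg_closure mpoly \<Rightarrow> bool" where
  "over_base f \<longleftrightarrow> range (Poly_Mapping.lookup f) \<subseteq> base_field"

definition projective_curve :: "nat \<Rightarrow> 'k::field alg_closure ppoint set \<Rightarrow> bool" where
  "projective_curve n E \<longleftrightarrow>
     (\<exists>S. (\<forall>f\<in>S. form n f \<and> over_base f) \<and> E = proj_zeros n S) \<and>
     irreducible_closed n E \<and> has_zariski_dim n E 1"

definition rational_points :: "'k::field alg_closure ppoint set \<Rightarrow> 'k alg_closure ppoint set" where
  "rational_points E = {P \<in> E. \<exists>x\<in>P. range x \<subseteq> base_field}"

text \<open>
  A tuple \<open>F = (F\<^sub>0, \<dots>, F\<^sub>n)\<close> of forms of equal degree defines a rational map to \<open>\<P>\<^sup>n\<close> at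
  the points where not all \<open>F\<^sub>i\<close> vanish.
\<close>

definition tuple_eval :: "nat \<Rightarrow> (nat \<Rightarrow> 'a::field mpoly) \<Rightarrow> (nat \<Rightarrow> 'a) \<Rightarrow> nat \<Rightarrow> 'a" where
  "tuple_eval n F x = (\<lambda>i. if i \<le> n then mpoly_eval (F i) x else 0)"

definition defined_at :: "nat \<Rightarrow> (nat \<Rightarrow> 'a::field mpoly) \<Rightarrow> 'a ppoint \<Rightarrow> bool" where
  "defined_at n F P \<longleftrightarrow> (\<exists>i\<le>n. \<not> vanishes_at (F i) P)"

definition map_pt :: "nat \<Rightarrow> (nat \<Rightarrow> 'a::field mpoly) \<Rightarrow> 'a ppoint \<Rightarrow> 'a ppoint" where
  "map_pt n F P = (\<Union>x\<in>P. proj_pt (tuple_eval n F x))"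

text \<open>
  \<open>V\<close> and \<open>W\<close> are quasi-projective.  Requiring all values to lie in \<open>W\<close> is no restriction on
  the class of rational maps \<open>V \<dashrightarrow> W\<close>: multiplying \<open>F\<close> by a form over \<open>k\<close> that vanishes
  where the image leaves \<open>W\<close> represents the same map.
\<close>

definition rational_map ::
  "nat \<Rightarrow> nat \<Rightarrow> 'k::field alg_closure ppoint set \<Rightarrow> 'k alg_closure ppoint set \<Rightarrow>
   (nat \<Rightarrow> 'k alg_closure mpoly) \<Rightarrow> bool" where
  "rational_map m n V W F \<longleftrightarrow>
     (\<exists>d. \<forall>i\<le>n. hom_poly m d (F i) \<and> over_base (F i)) \<and>
     (\<exists>P\<in>V. defined_at n F P) \<and>
     (\<forall>P\<in>V. defined_at n F P \<longrightarrow> map_pt n F P \<in> W)"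

text \<open>\<open>G \<circ> F\<close> is defined somewhere on \<open>V\<close>, and is the identity wherever it is defined.\<close>

definition left_inverse_on ::
  "nat \<Rightarrow> nat \<Rightarrow> 'a::field ppoint set \<Rightarrow> (nat \<Rightarrow> 'a mpoly) \<Rightarrow> (nat \<Rightarrow> 'a mpoly) \<Rightarrow> bool" where
  "left_inverse_on m n V F G \<longleftrightarrow>
     (\<exists>P\<in>V. defined_at n F P \<and> defined_at m G (map_pt n F P)) \<and>
     (\<forall>P\<in>V. defined_at n F P \<longrightarrow> defined_at m G (map_pt n F P) \<longrightarrow>
        map_pt m G (map_pt n F P) = P)"

definition birational ::
  "nat \<Rightarrow> nat \<Rightarrow> 'k::field alg_closure ppoint set \<Rightarrow> 'k alg_closure ppoint set \<Rightarrow> bool" where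
  "birational m n V W \<longleftrightarrow>
     (\<exists>F G. rational_map m n V W F \<and> rational_map n m W V G \<and>
        left_inverse_on m n V F G \<and> left_inverse_on n m W G F)"

text \<open>
  Affine plane curves are subsets of the affine plane \<open>{[1 : x : y]}\<close> inside \<open>\<P>\<^sup>2\<close>.
\<close>

definition affine_pt :: "'a::field \<Rightarrow> 'a \<Rightarrow> 'a ppoint" where
  "affine_pt x y = proj_pt (\<lambda>i. if i = 0 then 1 else if i = 1 then x else if i = 2 then y else 0)"

definition smooth_projective_model ::
  "'k::field alg_closure ppoint set \<Rightarrow> nat \<Rightarrow> 'k alg_closure ppoint set \<Rightarrow> bool" where
  "smooth_projective_model C n E \<longleftrightarrow>
     projective_curve n E \<and> nonsingular_curve n E \<and> birational 2 n C E"

definition frobenius_trace :: "'k::{field,finite} alg_closure ppoint set \<Rightarrow> int" where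
  "frobenius_trace E = int CARD('k) + 1 - int (card (rational_points E))"

definition quartic_curve :: "'k::field \<Rightarrow> 'k alg_closure ppoint set" where
  "quartic_curve c = {affine_pt x y | x y. y ^ 2 = (x ^ 2 - 1) * (x ^ 2 - to_ac c)}"


section \<open>Character sums and value sets over \<open>\<F>\<^sub>\<ell>\<close>\<close>

text \<open>\<open>\<F>\<^sub>\<ell>\<close> is the type \<open>'l mod_ring\<close> with \<open>\<ell> = CARD('l)\<close> prime.\<close>

definition chi :: "'l::prime_card mod_ring \<Rightarrow> int" where
  "chi a = Legendre (to_int_mod_ring a) (int CARD('l))"

definition K :: "'l::prime_card mod_ring \<Rightarrow> 'l mod_ring \<Rightarrow> int" where
  "K A B = (\<Sum>z\<in>UNIV. chi ((z ^ 2 - A) * (z ^ 2 - B)))"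

definition quadratic_nonresidue :: "'l::prime_card mod_ring \<Rightarrow> bool" where
  "quadratic_nonresidue c \<longleftrightarrow> c \<noteq> 0 \<and> \<not> QuadRes (int CARD('l)) (to_int_mod_ring c)"

definition primitive_root :: "'l::prime_card mod_ring \<Rightarrow> bool" where
  "primitive_root g \<longleftrightarrow> range (\<lambda>i::nat. g ^ i) = UNIV - {0}"

definition uniform_variance :: "('l::prime_card mod_ring \<Rightarrow> real) \<Rightarrow> real" where
  "uniform_variance f = measure_pmf.variance (pmf_of_set (UNIV - {0})) f"

definition H :: "'l::prime_card mod_ring \<Rightarrow> 'l mod_ring \<Rightarrow> 'l mod_ring set" where
  "H a N = {a * x + N * inverse x | x. x \<noteq> 0}"

definition U :: "'l::prime_card mod_ring \<Rightarrow> 'l mod_ring \<Rightarrow> 'l mod_ring \<Rightarrow> 'l mod_ring set" where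
  "U a b N = H a N \<union> H b N"

end

theory Submission
  imports Defs
begin

text \<open>
  Everything follows from the identity \<open>K(A, c A) + 1 = \<chi>(A) (K(1, c) + 1)\<close> (\<open>K_nonresidue\<close>).  For
  square \<open>A\<close> it is a substitution \<open>z \<mapsto> d z\<close>.  For a nonresidue \<open>A\<close> the quotient \<open>A/c\<close> is a square, the
  pair \<open>(A, c A)\<close> is equivalent to \<open>(c, c\<^sup>2)\<close>, and \<open>z \<mapsto> 1/z\<close> leads back to \<open>(1, c)\<close> with the factor
  \<open>\<chi>(c\<^sup>3) = -1\<close>; the added \<open>1\<close> is the contribution of infinity, which inversion exchanges with \<open>0\<close>.
  So \<open>K(A, c A) + 1\<close> is a constant times a sign that is equidistributed in \<open>A\<close>; its mean is \<open>0\<close> and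
  the variance is \<open>(K(1, c) + 1)\<^sup>2\<close>.  It remains to show that \<open>\<bar>K(1, c) + 1\<bar> \<le> 2 \<surd>l\<close> and that \<open>K(1, c) + 1\<close>
  is, up to sign, the Frobenius trace.  The tail bounds are then immediate, as the event is
  impossible for \<open>\<mu> > 2\<close> while the bound is at least \<open>1\<close> for \<open>\<mu> \<le> 2\<close>; for the sets \<open>U\<close> one uses in
  addition that \<open>v\<close> belongs to \<open>H\<^sub>a(N)\<close> iff \<open>v\<^sup>2 - 4 a N\<close> is not a nonresidue, so that counting the
  complement of \<open>U\<close> yields \<open>K(4 a N, 4 b N)\<close> (\<open>card_U\<close>).

  The bound (\<open>hasse_cubic\<close>).  Counting by squares turns \<open>K(1, c) + 1\<close> into the character sum of a
  cubic \<open>F\<close>.  Manin's argument considers, over \<open>\<F>\<^sub>l(t)\<close>, the points \<open>(t, 1)\<close> and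
  \<open>(t\<^sup>l, F(t)\<^sup>(\<^sup>l\<^sup>-\<^sup>1\<^sup>)\<^sup>/\<^sup>2)\<close> of the twisted curve \<open>F(t) Y\<^sup>2 = F(X)\<close>, and the progression that starts at the
  second and has the first as difference.  The degrees of the \<open>X\<close>-coordinates satisfy the
  parallelogram law, so they are \<open>n\<^sup>2 - s n + l\<close>, where \<open>s\<close> is the character sum up to sign.  As degrees
  are nonnegative, evaluation near \<open>n = s/2\<close> gives \<open>s\<^sup>2 \<le> 4 l\<close> (\<open>quadratic_nonneg_at_integers\<close>).  The argument is carried out on
  \<open>X\<close>-coordinates: those of the two neighbours of a point are the roots of one quadratic equation
  (\<open>kummer_rel\<close>), so that a step of the progression is a Vieta jump.

  The trace (\<open>frobenius_trace_quartic\<close>).  The functions \<open>1, x, y, x\<^sup>2\<close> map the quartic curve onto a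
  smooth intersection of two quadrics in \<open>\<P>\<^sup>3\<close>, which has \<open>l + K(1, c)\<close> rational affine points
  and two more at infinity.  Any other smooth model has the same number of rational points
  (\<open>card_rational_points_eq\<close>): both models have generic points in one big field, with the same
  function field.  The Jacobian criterion makes the local ring at a point of a smooth model a
  valuation ring (\<open>nonsingular_imp_valuation\<close>), and valuation rings are maximal for domination, so that
  each point of one model has the same local ring as a unique point of the other
  (\<open>places_correspond\<close>).  Coordinates are residues of functions, and those of functions defined over
  \<open>\<F>\<^sub>l\<close> at a rational point are fixed by Frobenius; hence rational points correspond to rational points.
\<close>

hide_const (open) Polynomials.lead_coeff Polynomials.degree Coset.order Divisibility.prime
  up_ring.coeff up_ring.monom Module.smult

section \<open>Heights on the Kummer line\<close>

text \<open>
  For a point with \<open>X\<close>-coordinate \<open>P/Q\<close> and the point \<open>(t, 1)\<close> of the quadratic twist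
  \<open>F(t) Y\<^sup>2 = X\<^sup>3 + a X\<^sup>2 + b X\<close> by \<open>F(t) = t\<^sup>3 + a t\<^sup>2 + b t\<close>, the \<open>X\<close>-coordinates of the sum
  and of the difference are the two roots of \<open>S X\<^sup>2 - T X + R\<close>.  Here \<open>t\<close> is the polynomial variable.
\<close>

definition kummer_S :: "'a::comm_ring_1 poly \<Rightarrow> 'a poly \<Rightarrow> 'a poly" where
  "kummer_S P Q = (P - [:0, 1:] * Q) ^ 2"

definition kummer_R :: "'a::comm_ring_1 \<Rightarrow> 'a poly \<Rightarrow> 'a poly \<Rightarrow> 'a poly" where
  "kummer_R b P Q = ([:0, 1:] * P - [:b:] * Q) ^ 2"

definition kummer_T :: "'a::comm_ring_1 \<Rightarrow> 'a \<Rightarrow> 'a poly \<Rightarrow> 'a poly \<Rightarrow> 'a poly" where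
  "kummer_T a b P Q = 2 * ((P + [:0, 1:] * Q) * ([:0, 1:] * P + [:b:] * Q) + 2 * [:a:] * [:0, 1:] * P * Q)"

text \<open>
  \<open>P'/Q'\<close> is the \<open>X\<close>-coordinate of a neighbour of \<open>P/Q\<close>: one of the two points obtained by
  adding or subtracting \<open>(t, 1)\<close>.
\<close>

definition kummer_rel ::
  "'a::comm_ring_1 \<Rightarrow> 'a \<Rightarrow> 'a poly \<Rightarrow> 'a poly \<Rightarrow> 'a poly \<Rightarrow> 'a poly \<Rightarrow> bool" where
  "kummer_rel a b P Q P' Q' \<longleftrightarrow>
     kummer_S P Q * P' ^ 2 - kummer_T a b P Q * P' * Q' + kummer_R b P Q * Q' ^ 2 = 0"

lemma kummer_rel_sym: "kummer_rel a b P Q P' Q' \<Longrightarrow> kummer_rel a b P' Q' P Q"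
proof -
  define t :: "'a poly" where "t = [:0, 1:]"
  have "(P - t * Q) ^ 2 * P' ^ 2 - 2 * ((P + t * Q) * (t * P + B * Q) + 2 * A * t * P * Q) * P' * Q'
          + (t * P - B * Q) ^ 2 * Q' ^ 2 =
        (P' - t * Q') ^ 2 * P ^ 2 - 2 * ((P' + t * Q') * (t * P' + B * Q') + 2 * A * t * P' * Q') * P * Q
          + (t * P' - B * Q') ^ 2 * Q ^ 2" for A B :: "'a poly"
    by (simp add: algebra_simps power2_eq_square)
  then show "kummer_rel a b P Q P' Q' \<Longrightarrow> kummer_rel a b P' Q' P Q"
    unfolding kummer_rel_def kummer_S_def kummer_T_def kummer_R_def t_def by metis
qed

text \<open>
  A common prime divisor \<open>p\<close> of the three coefficients divides \<open>P - t Q\<close> and \<open>t P - b Q\<close>, hence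
  \<open>t\<^sup>2 - b\<close>; the middle coefficient then forces \<open>p\<close> to divide \<open>2 t + a\<close>.  But \<open>t\<^sup>2 - b\<close> and
  \<open>2 t + a\<close> generate the constant \<open>a\<^sup>2 - 4 b\<close>, which the discriminant condition makes a unit.
\<close>

lemma kummer_primitive:
  fixes P Q :: "'a::field_gcd poly"
  assumes cop: "coprime P Q" and b: "b \<noteq> 0" and disc: "a ^ 2 - 4 * b \<noteq> 0" and two: "(2::'a) \<noteq> 0"
    and p: "prime_elem p"
    and S: "p dvd kummer_S P Q" and T: "p dvd kummer_T a b P Q" and R: "p dvd kummer_R b P Q"
  shows False
proof -
  define t A B where "t = [:0, 1::'a:]" and "A = [:a:]" and "B = [:b:]"
  have const: "\<not> p dvd [:k:]" if "k \<noteq> 0" for k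
  proof
    assume "p dvd [:k:]"
    moreover have "is_unit [:k:]" using that by (simp add: is_unit_triv)
    ultimately have "is_unit p" using dvd_trans by blast
    then show False using p prime_elem_not_unit by blast
  qed
  have 1: "p dvd P - t * Q"
    using S p unfolding kummer_S_def t_def by (metis prime_elem_dvd_power)
  have 2: "p dvd t * P - B * Q"
    using R p unfolding kummer_R_def t_def B_def by (metis prime_elem_dvd_power)
  have Q: "\<not> p dvd Q"
  proof
    assume "p dvd Q"
    moreover from this have "p dvd P" using 1 by (metis dvd_add_left_iff dvd_mult diff_add_cancel)
    ultimately have "is_unit p" using cop by (meson coprime_def)
    then show False using p prime_elem_not_unit by blast
  qed
  have "(t ^ 2 - B) * Q = (t * P - B * Q) - t * (P - t * Q)"
    by (simp add: algebra_simps power2_eq_square)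
  then have "p dvd (t ^ 2 - B) * Q" using 1 2 by (metis dvd_diff dvd_mult)
  then have 3: "p dvd t ^ 2 - B" using Q p prime_elem_dvd_mult_iff by blast
  have t: "\<not> p dvd t"
  proof
    assume "p dvd t"
    then have "p dvd t ^ 2 - (t ^ 2 - B)" using 3
      by (metis dvd_diff dvd_mult power2_eq_square)
    then show False using const[OF b] by (simp add: B_def)
  qed
  have "4 * (Q ^ 2 * t ^ 2 * (2 * t + A)) = 2 * ((P + t * Q) * (t * P + B * Q) + 2 * A * t * P * Q)
     - (P - t * Q) * (2 * (t * (P + t * Q) + B * Q + t ^ 2 * Q + 2 * A * t * Q))
     + (t ^ 2 - B) * (4 * Q ^ 2 * t)"
    by (simp add: algebra_simps power2_eq_square)
  then have "p dvd 4 * (Q ^ 2 * t ^ 2 * (2 * t + A))"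
    using T 1 3 unfolding kummer_T_def t_def A_def B_def
    by (metis dvd_add dvd_diff dvd_mult2)
  moreover have four: "(4::'a poly) = [:4:]" by (simp add: numeral_poly)
  moreover have "(4::'a) \<noteq> 0" using two by (metis mult_2_right mult_eq_0_iff numeral_Bit0 mult_numeral_1)
  ultimately have "p dvd 2 * t + A"
    using const[of 4] Q t p by (metis prime_elem_dvd_mult_iff prime_elem_dvd_power)
  then have "p dvd 4 * (t ^ 2 - B) - (2 * t + A) * (2 * t - A)"
    using 3 by (metis dvd_diff dvd_mult dvd_mult2)
  also have "4 * (t ^ 2 - B) - (2 * t + A) * (2 * t - A) = A ^ 2 - 4 * B"
    by (simp add: algebra_simps power2_eq_square)
  also have "\<dots> = [:a ^ 2 - 4 * b:]" by (simp add: A_def B_def four power2_eq_square)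
  finally show False using const[OF disc] by blast
qed

text \<open>
  Since \<open>P'/Q'\<close> is a root of \<open>S X\<^sup>2 - T X + R\<close> in lowest terms, its denominator divides \<open>S\<close>
  and its numerator divides \<open>R\<close>; the cofactors give the other root \<open>P''/Q''\<close>.
\<close>

lemma vieta_jump:
  fixes S T R P' Q' :: "'p::factorial_ring_gcd"
  assumes cop: "coprime P' Q'" and root: "S * P' ^ 2 - T * P' * Q' + R * Q' ^ 2 = 0"
  shows "\<exists>P'' Q''. S = Q' * Q'' \<and> R = P' * P'' \<and> T = P' * Q'' + P'' * Q'"
proof (cases "P' = 0 \<or> Q' = 0")
  case False
  have "S * P' ^ 2 = Q' * (T * P' - R * Q')" "R * Q' ^ 2 = P' * (T * Q' - S * P')"
    using root by (simp_all add: algebra_simps power2_eq_square)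
  then have "Q' dvd S * P' ^ 2" "P' dvd R * Q' ^ 2" by (metis dvd_triv_left)+
  then have "Q' dvd S" "P' dvd R"
    using cop by (metis coprime_commute coprime_dvd_mult_left_iff coprime_power_right_iff)+
  then obtain Q'' P'' where *: "S = Q' * Q''" "R = P' * P''" by (auto elim!: dvdE)
  have "P' * Q' * T = P' * Q' * (P' * Q'' + P'' * Q')"
    using root unfolding * by (simp add: algebra_simps power2_eq_square)
  then have "T = P' * Q'' + P'' * Q'" using False by simp
  then show ?thesis using * by blast
next
  case True
  then show ?thesis
  proof
    assume P': "P' = 0"
    then obtain v where v: "1 = Q' * v" using cop by (auto elim: dvdE)
    have "R = 0" using root P' v by auto
    moreover have "S = Q' * (S * v)" "T = (T * v) * Q'" using v by (metis mult.left_commute mult.right_neutral, metis mult.assoc mult.commute mult.right_neutral)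
    ultimately show ?thesis using P' by (intro exI[of _ "T * v"] exI[of _ "S * v"]) simp
  next
    assume Q': "Q' = 0"
    then obtain v where v: "1 = P' * v" using cop by (auto elim: dvdE)
    have "S = 0" using root Q' v by auto
    moreover have "R = P' * (R * v)" "T = P' * (T * v)" using v by (metis mult.left_commute mult.right_neutral)+
    ultimately show ?thesis using Q' by (intro exI[of _ "R * v"] exI[of _ "T * v"]) simp
  qed
qed

text \<open>
  For coprime \<open>P\<close> and \<open>Q\<close> this is the degree of the rational function \<open>P/Q\<close>.
\<close>

definition height :: "'a::zero poly \<Rightarrow> 'a poly \<Rightarrow> nat" where
  "height P Q = max (degree P) (degree Q)"

lemma height_coeff:
  assumes "P \<noteq> 0 \<or> Q \<noteq> 0"
  shows "coeff P (height P Q) \<noteq> 0 \<or> coeff Q (height P Q) \<noteq> 0"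
  using assms unfolding height_def
  by (metis coeff_0 degree_0 leading_coeff_0_iff le_zero_eq max.absorb1 max.absorb2 nat_le_linear)

lemma coeff_mult_top:
  fixes p q :: "'a::idom poly"
  assumes "degree p \<le> m" "degree q \<le> n"
  shows "coeff (p * q) (m + n) = coeff p m * coeff q n"
proof (cases "degree p = m \<and> degree q = n")
  case True
  then show ?thesis using coeff_mult_degree_sum by blast
next
  case False
  then have "degree p < m \<or> degree q < n" using assms by auto
  then have "coeff p m * coeff q n = 0" by (auto simp: coeff_eq_0)
  moreover have "degree (p * q) < m + n"
    using degree_mult_le[of p q] assms False by linarith
  ultimately show ?thesis by (simp add: coeff_eq_0)
qed

text \<open>
  \<open>h(x + y) + h(x - y) = 2 h(x) + 2 h(y)\<close>, where \<open>y = (t, 1)\<close> has height one.  Both sides are the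
  largest degree among \<open>S\<close>, \<open>T\<close> and \<open>R\<close>: at the degree on the left the products on the right of the
  three hypotheses have leading coefficients that cannot all vanish, and at degree \<open>2 h + 2\<close> the
  coefficients of \<open>S\<close> and \<open>R\<close> are the squares of the top coefficients of \<open>Q\<close> and \<open>P\<close>.
\<close>

lemma height_parallelogram:
  fixes P Q :: "'a::idom poly"
  assumes nz: "P \<noteq> 0 \<or> Q \<noteq> 0" "P1 \<noteq> 0 \<or> Q1 \<noteq> 0" "P2 \<noteq> 0 \<or> Q2 \<noteq> 0"
    and S: "kummer_S P Q = Q1 * Q2" and R: "kummer_R b P Q = P1 * P2"
    and T: "kummer_T a b P Q = P1 * Q2 + P2 * Q1"
  shows "height P1 Q1 + height P2 Q2 = 2 * height P Q + 2"
proof -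
  let ?h = "height P Q" and ?h1 = "height P1 Q1" and ?h2 = "height P2 Q2"
  define t where "t = [:0, 1::'a:]"
  have d: "degree P \<le> ?h" "degree Q \<le> ?h" "degree P1 \<le> ?h1" "degree Q1 \<le> ?h1"
    "degree P2 \<le> ?h2" "degree Q2 \<le> ?h2" by (auto simp: height_def)
  have t: "degree t = 1" "coeff t 1 = 1" by (auto simp: t_def)
  note c = coeff_mult_top
  let ?u = "P - t * Q" and ?v = "t * P - [:b:] * Q"
  have dm: "degree (p * q) \<le> m + n" if "degree p \<le> m" "degree q \<le> n" for p q :: "'a poly" and m n
    using degree_mult_le[of p q] that by linarith
  have du: "degree ?u \<le> Suc ?h"
    using dm[of t 1 Q ?h] d t by (intro degree_diff_le) auto
  have db: "degree ([:b:] * Q) \<le> ?h" using dm[of "[:b:]" 0 Q ?h] d by simp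
  have dv: "degree ?v \<le> Suc ?h"
    using dm[of t 1 P ?h] db d t by (intro degree_diff_le) auto
  have "degree (2 * (t * P + [:b:] * Q)) \<le> Suc ?h"
  proof -
    have "degree (t * P + [:b:] * Q) \<le> Suc ?h"
      using dm[of t 1 P ?h] db d t by (intro degree_add_le) auto
    then show ?thesis using dm[of "2" 0 "t * P + [:b:] * Q" "Suc ?h"] by simp
  qed
  moreover have "degree (P + t * Q) \<le> Suc ?h"
    using dm[of t 1 Q ?h] d t by (intro degree_add_le) auto
  ultimately have "degree ((P + t * Q) * (2 * (t * P + [:b:] * Q))) \<le> 2 * ?h + 2"
    using dm by fastforce
  moreover have "degree ((4 * [:a:] * t) * (P * Q)) \<le> 2 * ?h + 2"
  proof -
    have "degree (4 * [:a:] * t) \<le> 1" using dm[of "4 * [:a:]" 0 t 1] dm[of 4 0 "[:a:]" 0] t by simp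
    moreover have "degree (P * Q) \<le> ?h + ?h" using dm d by blast
    ultimately show ?thesis using dm by fastforce
  qed
  moreover have "kummer_T a b P Q = (P + t * Q) * (2 * (t * P + [:b:] * Q)) + (4 * [:a:] * t) * (P * Q)"
    by (simp add: kummer_T_def t_def algebra_simps smult_add_right)
  ultimately have dT: "degree (kummer_T a b P Q) \<le> 2 * ?h + 2"
    using degree_add_le by metis
  have dS: "degree (kummer_S P Q) \<le> 2 * ?h + 2"
    using dm[OF du du] by (simp add: kummer_S_def t_def power2_eq_square)
  have dR: "degree (kummer_R b P Q) \<le> 2 * ?h + 2"
    using dm[OF dv dv] by (simp add: kummer_R_def t_def power2_eq_square)
  have cXQ: "coeff (t * p) (Suc m) = coeff p m" for p m by (simp add: t_def)
  have cS: "coeff (kummer_S P Q) (2 * ?h + 2) = coeff Q ?h ^ 2"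
  proof -
    have "coeff ?u (Suc ?h) = - coeff Q ?h" using cXQ d by (simp add: coeff_eq_0)
    then show ?thesis using c[OF du du] by (simp add: kummer_S_def t_def power2_eq_square mult_2)
  qed
  have cR: "coeff (kummer_R b P Q) (2 * ?h + 2) = coeff P ?h ^ 2"
  proof -
    have "degree ([:b:] * Q) < Suc ?h" using db by linarith
    then have "coeff ([:b:] * Q) (Suc ?h) = 0" by (rule coeff_eq_0)
    then have "coeff ?v (Suc ?h) = coeff P ?h" using cXQ by simp
    then show ?thesis using c[OF dv dv] by (simp add: kummer_R_def t_def[symmetric] power2_eq_square mult_2)
  qed
  have "?h1 + ?h2 \<le> 2 * ?h + 2"
  proof -
    let ?p1 = "coeff P1 ?h1" and ?q1 = "coeff Q1 ?h1" and ?p2 = "coeff P2 ?h2" and ?q2 = "coeff Q2 ?h2"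
    have "?q1 * ?q2 \<noteq> 0 \<or> ?p1 * ?p2 \<noteq> 0 \<or> ?p1 * ?q2 + ?p2 * ?q1 \<noteq> 0"
      using height_coeff[OF nz(2)] height_coeff[OF nz(3)] by auto
    moreover have "coeff (P2 * Q1) (?h1 + ?h2) = ?p2 * ?q1"
      using c[OF d(5,4)] by (simp add: add.commute)
    ultimately have "coeff (kummer_S P Q) (?h1 + ?h2) \<noteq> 0 \<or> coeff (kummer_R b P Q) (?h1 + ?h2) \<noteq> 0 \<or>
       coeff (kummer_T a b P Q) (?h1 + ?h2) \<noteq> 0"
      using c[OF d(4,6)] c[OF d(3,5)] c[OF d(3,6)] unfolding S R T coeff_add by metis
    then show ?thesis using dS dR dT by (meson le_degree le_trans)
  qed
  moreover have "2 * ?h + 2 \<le> ?h1 + ?h2"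
  proof -
    have "coeff (kummer_S P Q) (2 * ?h + 2) \<noteq> 0 \<or> coeff (kummer_R b P Q) (2 * ?h + 2) \<noteq> 0"
      using cS cR height_coeff[OF nz(1)] by auto
    moreover have "degree (kummer_S P Q) \<le> ?h1 + ?h2" "degree (kummer_R b P Q) \<le> ?h1 + ?h2"
      unfolding S R using dm d by blast+
    ultimately show ?thesis by (meson le_degree le_trans)
  qed
  ultimately show ?thesis by simp
qed

lemma coprime_not_both_zero:
  assumes "coprime (P :: 'a::field_gcd poly) Q" shows "P \<noteq> 0 \<or> Q \<noteq> 0"
  using assms by auto

lemma coprime_of_no_prime:
  fixes P Q :: "'a::field_gcd poly"
  assumes "P \<noteq> 0 \<or> Q \<noteq> 0" and "\<And>p. prime_elem p \<Longrightarrow> p dvd P \<Longrightarrow> p dvd Q \<Longrightarrow> False"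
  shows "coprime P Q"
proof (rule ccontr)
  assume "\<not> coprime P Q"
  then have "\<not> is_unit (gcd P Q)" using is_unit_gcd by blast
  moreover have "gcd P Q \<noteq> 0" using assms(1) by simp
  ultimately obtain p where "p dvd gcd P Q" "prime p"
    using prime_divisor_exists by blast
  then show False using assms(2)[of p] by (auto simp: prime_def)
qed

text \<open>
  Walking along the progression: the other root of the quadratic equation is the next point.
  Primitivity of the coefficients keeps its representation in lowest terms, so that its height is
  determined by the parallelogram law.
\<close>

lemma kummer_step:
  fixes P Q P1 Q1 :: "'a::field_gcd poly"
  assumes b: "b \<noteq> 0" and disc: "a ^ 2 - 4 * b \<noteq> 0" and two: "(2::'a) \<noteq> 0"
    and cop: "coprime P Q" "coprime P1 Q1" and rel: "kummer_rel a b P Q P1 Q1"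
  obtains P2 Q2 where "coprime P2 Q2" "kummer_rel a b P2 Q2 P Q"
    "height P1 Q1 + height P2 Q2 = 2 * height P Q + 2"
proof -
  obtain P2 Q2 where *: "kummer_S P Q = Q1 * Q2" "kummer_R b P Q = P1 * P2"
    "kummer_T a b P Q = P1 * Q2 + P2 * Q1"
    using vieta_jump[OF cop(2)] rel unfolding kummer_rel_def by blast
  have prim: False if "prime_elem p" "p dvd P2" "p dvd Q2" for p
    using kummer_primitive[OF cop(1) b disc two that(1)] that unfolding * by simp
  have "P2 \<noteq> 0 \<or> Q2 \<noteq> 0"
  proof (rule ccontr)
    assume "\<not> (P2 \<noteq> 0 \<or> Q2 \<noteq> 0)"
    then have "prime_elem p \<Longrightarrow> False" for p :: "'a poly" using prim by simp
    moreover have "prime_elem [:0, 1::'a:]" using prime_elem_linear_field_poly[of 1 0] by simp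
    ultimately show False by blast
  qed
  then have cop2: "coprime P2 Q2" using coprime_of_no_prime prim by blast
  have "kummer_rel a b P Q P2 Q2"
    unfolding kummer_rel_def * by (simp add: algebra_simps power2_eq_square)
  then show ?thesis
    using that[OF cop2 kummer_rel_sym] height_parallelogram[OF _ _ _ *] cop cop2 coprime_not_both_zero
    by blast
qed

text \<open>
  The heights along the progression have second difference two, so they are the values of a
  quadratic polynomial in \<open>n\<close>, and heights are nonnegative.
\<close>

lemma kummer_heights_nonneg:
  fixes P0 Q0 P1 Q1 :: "'a::field_gcd poly" and s :: int
  assumes b: "b \<noteq> 0" and disc: "a ^ 2 - 4 * b \<noteq> 0" and two: "(2::'a) \<noteq> 0"
    and cop: "coprime P0 Q0" "coprime P1 Q1" and rel: "kummer_rel a b P1 Q1 P0 Q0"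
    and h: "int (height P0 Q0) = q" "int (height P1 Q1) = q + 1 - s"
  shows "0 \<le> int n ^ 2 - s * int n + q"
proof -
  have "\<exists>P Q P' Q'. coprime P Q \<and> coprime P' Q' \<and> kummer_rel a b P' Q' P Q \<and>
     int (height P Q) = int n ^ 2 - s * int n + q \<and>
     int (height P' Q') = (int n + 1) ^ 2 - s * (int n + 1) + q"
  proof (induction n)
    case 0
    then show ?case using cop rel h by (intro exI[of _ P0] exI[of _ Q0] exI[of _ P1] exI[of _ Q1]) simp
  next
    case (Suc n)
    then obtain P Q P' Q' where *: "coprime P Q" "coprime P' Q'" "kummer_rel a b P' Q' P Q"
      "int (height P Q) = int n ^ 2 - s * int n + q"
      "int (height P' Q') = (int n + 1) ^ 2 - s * (int n + 1) + q" by blast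
    obtain P2 Q2 where 2: "coprime P2 Q2" "kummer_rel a b P2 Q2 P' Q'"
      "height P Q + height P2 Q2 = 2 * height P' Q' + 2"
      using kummer_step[OF b disc two *(2,1,3)] by blast
    have "int (height P2 Q2) = 2 * int (height P' Q') + 2 - int (height P Q)" using 2(3) by linarith
    also have "\<dots> = (int (Suc n) + 1) ^ 2 - s * (int (Suc n) + 1) + q"
      unfolding * by (simp add: algebra_simps power2_eq_square)
    finally show ?case using 2 * by (intro exI[of _ P'] exI[of _ Q'] exI[of _ P2] exI[of _ Q2]) (auto simp: add.commute)
  qed
  then show ?thesis by (metis of_nat_0_le_iff)
qed

section \<open>Hasse's bound for cubics through the origin\<close>

lemma prod_linear_powers_dvd:
  fixes G :: "'a::field_gcd poly"
  assumes "finite A" and "\<And>x. x \<in> A \<Longrightarrow> [:-x, 1:] ^ e x dvd G"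
  shows "(\<Prod>x\<in>A. [:-x, 1:] ^ e x) dvd G"
  using assms
proof (induction A rule: finite_induct)
  case (insert x A)
  have "coprime ([:-x, 1:] ^ e x) (\<Prod>y\<in>A. [:-y, 1:] ^ e y)"
  proof (intro prod_coprime_right)
    fix y assume "y \<in> A"
    then have "x \<noteq> y" using insert by auto
    have "coprime [:-x, 1:] [:-y, 1:]"
    proof (rule coprimeI)
      fix d assume "d dvd [:-x, 1:]" "d dvd [:-y, 1:]"
      then have "d dvd [:-x, 1:] - [:-y, 1:]" by (rule dvd_diff)
      also have "[:-x, 1:] - [:-y, 1:] = [:y - x:]" by simp
      finally have "d dvd [:y - x:]" .
      moreover have "is_unit [:y - x:]" using \<open>x \<noteq> y\<close> by (simp add: is_unit_triv)
      ultimately show "is_unit d" using dvd_trans by blast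
    qed
    then show "coprime ([:-x, 1:] ^ e x) ([:-y, 1:] ^ e y)" by simp
  qed
  then show ?case using insert by (simp add: divides_mult)
qed simp

lemma finite_field_poly_prod:
  "monom 1 CARD('a) - [:0, 1:] = (\<Prod>x\<in>(UNIV::'a::{finite_field,field_gcd} set). [:-x, 1:])"
  (is "?L = ?R")
proof -
  have c1: "CARD('a) > 1" using card_mono[of UNIV "{0, 1::'a}"] by simp
  have dL: "degree ?L = CARD('a)" and lL: "lead_coeff ?L = 1"
  proof -
    show 1: "degree ?L = CARD('a)"
    proof -
      have "?L = monom 1 CARD('a) + [:0, -1:]" by simp
      then show ?thesis
        using degree_add_eq_left[of "[:0, -1:]" "monom (1::'a) CARD('a)"] c1
        by (simp only: degree_monom_eq) (simp add: degree_monom_eq)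
    qed
    show "lead_coeff ?L = 1" unfolding 1 using c1 by (simp add: coeff_eq_0)
  qed
  have dR: "degree ?R = CARD('a)" by (subst degree_prod_eq_sum_degree) auto
  have lR: "lead_coeff ?R = 1" by (simp add: lead_coeff_prod)
  have "(\<Prod>x\<in>(UNIV::'a set). [:-x, 1:] ^ 1) dvd ?L"
    by (rule prod_linear_powers_dvd)
       (auto simp: poly_eq_0_iff_dvd[symmetric] poly_monom finite_field_power_card_eq_same)
  then obtain k where k: "?L = ?R * k" by (auto elim: dvdE)
  have "k \<noteq> 0" "?R \<noteq> 0" using k dL c1 by auto
  then have "degree k = 0" using k dL dR by (metis add_cancel_right_right degree_mult_eq)
  then obtain z where z: "k = [:z:]" by (rule degree_eq_zeroE)
  have "lead_coeff ?L = lead_coeff ?R * lead_coeff k" unfolding k by (rule lead_coeff_mult)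
  then have "z = 1" using lL lR z by simp
  then show ?thesis using k z by (simp add: one_pCons)
qed

text \<open>
  Frobenius fixes the coefficients, so that it acts on polynomials by substitution.
\<close>

lemma poly_frobenius:
  fixes p :: "'l::prime_card mod_ring poly"
  shows "p ^ CARD('l) = pcompose p (monom 1 CARD('l))"
proof (induction p)
  case (pCons a p)
  have "pCons a p ^ CARD('l) = ([:a:] + [:0, 1:] * p) ^ CARD('l)" by simp
  also have "\<dots> = [:a:] ^ CARD('l) + ([:0, 1:] * p) ^ CARD('l)"
    by (rule freshmans_dream) (simp_all add: prime_card)
  also have "[:a:] ^ CARD('l) = [:a ^ CARD('l):]" by (simp add: poly_const_pow)
  also have "a ^ CARD('l) = a" using finite_field_power_card_eq_same[of a] by simp
  also have "([:0, 1:] * p) ^ CARD('l) = monom 1 CARD('l) * pcompose p (monom 1 CARD('l))"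
    unfolding power_mult_distrib pCons.IH by (simp add: monom_altdef)
  finally show ?case by (simp add: pcompose_pCons)
qed (simp add: zero_power)

text \<open>
  The points \<open>(t\<^sup>l, Y)\<close> and \<open>(t, 1)\<close> of the twisted curve have a sum with \<open>X\<close>-coordinate
  \<open>F (Y - 1)\<^sup>2 / (t\<^sup>l - t)\<^sup>2 - (a + t + t\<^sup>l)\<close>, and the change of sign \<open>Y + 1\<close> gives the difference.
  Cancellation in these fractions is local at the \<open>l\<close> roots of \<open>t\<^sup>l - t\<close> and is governed by the
  value \<open>\<epsilon> x\<close> of \<open>Y\<close> there: the factor \<open>t - x\<close> cancels twice, once or not at all according to
  whether \<open>\<epsilon> x\<close> is \<open>1\<close>, \<open>0\<close> or \<open>-1\<close> in the sum.  Adding up, the height drops by exactly \<open>s\<close>.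
\<close>

lemma kummer_start:
  fixes a b :: "'l::prime_card mod_ring" and \<epsilon> :: "'l mod_ring \<Rightarrow> int" and s :: int
  defines "W \<equiv> monom 1 CARD('l)" and "F \<equiv> [:0, b, a, 1:]"
  assumes l: "CARD('l) > 2" and b: "b \<noteq> 0" and disc: "a ^ 2 - 4 * b \<noteq> 0"
    and Y: "F * Y ^ 2 = pcompose F W" and dY: "degree (F * Y) < 2 * CARD('l) + 1"
    and \<epsilon>: "\<And>x. \<epsilon> x \<in> {-1, 0, 1}" and Y\<epsilon>: "\<And>x. poly Y x = of_int (\<epsilon> x)"
    and F\<epsilon>: "\<And>x. \<epsilon> x = 0 \<Longrightarrow> poly F x = 0" and s: "s = (\<Sum>x\<in>UNIV. \<epsilon> x)"
  obtains P Q where "coprime P Q" "kummer_rel a b P Q W 1" "int (height P Q) = int CARD('l) + 1 - s"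
proof -
  define t A B where "t = [:0, 1::'l mod_ring:]" and "A = [:a:]" and "B = [:b:]"
  define D where "D = (W - t) ^ 2"
  \<comment> \<open>what remains of the common denominator \<open>D\<close> in the sum and in the difference\<close>
  define Qp where "Qp = (\<Prod>x\<in>UNIV. [:-x, 1:] ^ nat (1 - \<epsilon> x))"
  define Qm where "Qm = (\<Prod>x\<in>UNIV. [:-x, 1:] ^ nat (1 + \<epsilon> x))"
  define E where "E = F + F * Y ^ 2 - (A + t + W) * D"
  \<comment> \<open>numerators of sum and difference over the denominator \<open>D\<close>\<close>
  define Np Nm where "Np = E - 2 * (F * Y)" and "Nm = E + 2 * (F * Y)"
  let ?q = "CARD('l)"
  have F: "F = t * (t ^ 2 + A * t + B)" by (simp add: F_def t_def A_def B_def power2_eq_square)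
  have FW: "F * Y ^ 2 = W * (W ^ 2 + A * W + B)"
  proof -
    have "pcompose F W = W * (W ^ 2 + A * W + B)"
      unfolding F_def by (simp add: pcompose_pCons A_def B_def algebra_simps power2_eq_square)
    then show ?thesis using Y by simp
  qed
  have prodW: "W - t = (\<Prod>x\<in>UNIV. [:-x, 1:])"
    unfolding W_def t_def using finite_field_poly_prod[where 'a = "'l mod_ring"] by simp
  have D: "Qp * Qm = D"
    unfolding D_def prodW Qp_def Qm_def prod.distrib[symmetric] prod_power_distrib
  proof (intro prod.cong refl)
    fix x
    have "nat (1 - \<epsilon> x) + nat (1 + \<epsilon> x) = 2" using \<epsilon>[of x] by auto
    then show "[:- x, 1:] ^ nat (1 - \<epsilon> x) * [:- x, 1:] ^ nat (1 + \<epsilon> x) = [:- x, 1:] ^ 2"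
      by (metis power_add)
  qed
  have Np: "Np = F * (Y - 1) ^ 2 - (A + t + W) * D" and Nm: "Nm = F * (Y + 1) ^ 2 - (A + t + W) * D"
    by (simp_all add: Np_def Nm_def E_def algebra_simps power2_eq_square)
  have "Qm dvd F * (Y - 1) ^ 2"
    unfolding Qm_def
  proof (rule prod_linear_powers_dvd)
    fix x
    consider "\<epsilon> x = -1" | "\<epsilon> x = 0" | "\<epsilon> x = 1" using \<epsilon>[of x] by auto
    then show "[:-x, 1:] ^ nat (1 + \<epsilon> x) dvd F * (Y - 1) ^ 2"
    proof cases
      case 2
      then show ?thesis using F\<epsilon>[of x] by (simp add: poly_eq_0_iff_dvd)
    next
      case 3
      then have "[:-x, 1:] dvd Y - 1" using Y\<epsilon>[of x] by (simp add: poly_eq_0_iff_dvd[symmetric])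
      then have "[:-x, 1:] ^ 2 dvd (Y - 1) ^ 2" by (rule dvd_power_same)
      then show ?thesis using 3 by (simp add: numeral_2_eq_2)
    qed simp
  qed simp
  then have "Qm dvd Np" unfolding Np D[symmetric] by (auto intro!: dvd_diff)
  then obtain Pp where Pp: "Np = Qm * Pp" by (elim dvdE)
  have "Qp dvd F * (Y + 1) ^ 2"
    unfolding Qp_def
  proof (rule prod_linear_powers_dvd)
    fix x
    consider "\<epsilon> x = -1" | "\<epsilon> x = 0" | "\<epsilon> x = 1" using \<epsilon>[of x] by auto
    then show "[:-x, 1:] ^ nat (1 - \<epsilon> x) dvd F * (Y + 1) ^ 2"
    proof cases
      case 2
      then show ?thesis using F\<epsilon>[of x] by (simp add: poly_eq_0_iff_dvd)
    next
      case 1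
      then have "[:-x, 1:] dvd Y + 1" using Y\<epsilon>[of x] by (simp add: poly_eq_0_iff_dvd[symmetric])
      then have "[:-x, 1:] ^ 2 dvd (Y + 1) ^ 2" by (rule dvd_power_same)
      then show ?thesis using 1 by (simp add: numeral_2_eq_2)
    qed simp
  qed simp
  then have "Qp dvd Nm" unfolding Nm D[symmetric] by (auto intro!: dvd_diff)
  then obtain Pm where Pm: "Nm = Qp * Pm" by (elim dvdE)
  have D0: "Qp \<noteq> 0" "Qm \<noteq> 0" unfolding Qp_def Qm_def by auto
  have S: "kummer_S W 1 = Qm * Qp" using D by (simp add: kummer_S_def t_def D_def mult.commute)
  have "Np + Nm = 2 * ((W + t) * (t * W + B) + 2 * A * t * W)"
    unfolding Np_def Nm_def E_def FW unfolding D_def F by (simp add: algebra_simps power2_eq_square)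
  then have T: "kummer_T a b W 1 = Pm * Qp + Pp * Qm"
    using Pp Pm by (simp add: kummer_T_def t_def A_def B_def algebra_simps)
  have "Np * Nm = E ^ 2 - 4 * F * (F * Y ^ 2)"
    unfolding Np_def Nm_def by (simp add: algebra_simps power2_eq_square)
  also have "\<dots> = D * (t * W - B) ^ 2"
    unfolding E_def FW unfolding D_def F by (simp add: algebra_simps power2_eq_square)
  finally have "(Qp * Qm) * (Pm * Pp) = (Qp * Qm) * (t * W - B) ^ 2"
    unfolding Pp Pm D[symmetric] by (simp add: algebra_simps)
  then have R: "kummer_R b W 1 = Pm * Pp" using D0 by (simp add: kummer_R_def t_def B_def)
  have two: "(2 :: 'l mod_ring) \<noteq> 0"
  proof
    assume "(2 :: 'l mod_ring) = 0"
    then have "(of_nat 2 :: 'l mod_ring) = 0" by simp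
    then have "CARD('l) dvd 2" using of_nat_0_mod_ring_dvd by blast
    then show False using l by (auto dest: dvd_imp_le)
  qed
  have "Qp \<noteq> 0" by (rule D0)
  moreover have "False" if "prime_elem p" "p dvd Pp" "p dvd Qp" for p
    using kummer_primitive[OF _ b disc two that(1), of W 1] that unfolding S R T by simp
  ultimately have cop: "coprime Pp Qp" using coprime_of_no_prime by blast
  have "kummer_rel a b W 1 Pp Qp"
    unfolding kummer_rel_def S R T by (simp add: algebra_simps power2_eq_square)
  then have rel: "kummer_rel a b Pp Qp W 1" by (rule kummer_rel_sym)
  have dQ: "int (degree Qp) = int ?q - s" "int (degree Qm) = int ?q + s"
  proof -
    have "degree Qp = (\<Sum>x\<in>UNIV. nat (1 - \<epsilon> x))"
      unfolding Qp_def by (subst degree_prod_eq_sum_degree) (auto simp: degree_linear_power)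
    also have "int \<dots> = (\<Sum>x\<in>UNIV. 1 - \<epsilon> x)"
      unfolding of_nat_sum using \<epsilon> by (intro sum.cong refl) (smt (verit) insert_iff empty_iff nat_0_le)
    finally show "int (degree Qp) = int ?q - s" by (simp add: s sum_subtractf)
    have "degree Qm = (\<Sum>x\<in>UNIV. nat (1 + \<epsilon> x))"
      unfolding Qm_def by (subst degree_prod_eq_sum_degree) (auto simp: degree_linear_power)
    also have "int \<dots> = (\<Sum>x\<in>UNIV. 1 + \<epsilon> x)"
      unfolding of_nat_sum using \<epsilon> by (intro sum.cong refl) (smt (verit) insert_iff empty_iff nat_0_le)
    finally show "int (degree Qm) = int ?q + s" by (simp add: s sum.distrib)
  qed
  \<comment> \<open>\<open>t W\<^sup>2\<close> dominates all the other terms\<close>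
  have dN: "degree Np = 2 * ?q + 1"
  proof -
    have NpW: "Np = t * W ^ 2 + ((B + 2 * A * t + t ^ 2) * W + (B * t) - 2 * (F * Y))"
      unfolding Np_def E_def FW unfolding D_def F by (simp add: algebra_simps power2_eq_square)
    have "B + 2 * A * t + t ^ 2 = [:b, 2 * a, 1:]"
      by (simp add: A_def B_def t_def power2_eq_square numeral_poly)
    then have "degree ((B + 2 * A * t + t ^ 2) * W) \<le> 2 + ?q"
      using degree_mult_le[of "B + 2 * A * t + t ^ 2" W] by (simp add: W_def degree_monom_eq)
    moreover have "degree (B * t) \<le> 1" by (simp add: B_def t_def)
    moreover have "degree (2 * (F * Y)) < 2 * ?q + 1"
      using dY degree_mult_le[of 2 "F * Y"] by simp
    ultimately have "degree ((B + 2 * A * t + t ^ 2) * W + (B * t) - 2 * (F * Y)) < 2 * ?q + 1"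
      using l by (intro degree_diff_less degree_add_less) auto
    moreover have "t * W ^ 2 = monom 1 (2 * ?q + 1)"
    proof -
      have "t = monom 1 1" by (simp add: t_def monom_altdef)
      then show ?thesis by (simp add: W_def monom_power mult_monom mult.commute)
    qed
    ultimately show ?thesis unfolding NpW
      by (subst degree_add_eq_left) (simp_all add: degree_monom_eq)
  qed
  then have "Np \<noteq> 0" by auto
  then have "Pp \<noteq> 0" using Pp by auto
  then have "degree Np = degree Qm + degree Pp" unfolding Pp using D0 by (simp add: degree_mult_eq)
  then have dP: "int (degree Pp) = int ?q + 1 - s" using dN dQ by linarith
  then have "int (height Pp Qp) = int ?q + 1 - s" using dQ unfolding height_def by linarith
  then show ?thesis using that cop rel by blast
qed

text \<open>
  The polynomial is evaluated at an integer nearest to its vertex \<open>s/2\<close>.  For odd \<open>s\<close> this only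
  gives \<open>s\<^sup>2 \<le> 4 q + 1\<close>, but equality would make \<open>q\<close> a product of two consecutive integers.
\<close>

lemma quadratic_nonneg_at_integers:
  fixes s q :: int
  assumes "\<And>n::nat. 0 \<le> int n ^ 2 - s * int n + q" "s \<ge> 0" "odd q"
  shows "s ^ 2 \<le> 4 * q"
proof (cases "even s")
  case True
  then obtain n where n: "s = 2 * n" by (auto elim: evenE)
  then have "n = int (nat n)" using assms(2) by simp
  then show ?thesis using assms(1)[of "nat n"] n by (simp add: power2_eq_square algebra_simps)
next
  case False
  then obtain n where n: "s = 2 * n + 1" by (auto elim: oddE)
  then have "n = int (nat n)" using assms(2) by simp
  then have "n ^ 2 + n \<le> q" using assms(1)[of "nat n"] n by (simp add: power2_eq_square algebra_simps)
  then have le: "s ^ 2 \<le> 4 * q + 1" using n by (simp add: power2_eq_square algebra_simps)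
  show ?thesis
  proof (rule ccontr)
    assume "\<not> s ^ 2 \<le> 4 * q"
    then have "4 * (n ^ 2 + n) = 4 * q" using le n by (simp add: power2_eq_square algebra_simps)
    then have "q = n * (n + 1)" by (simp add: power2_eq_square algebra_simps)
    then show False using \<open>odd q\<close> by simp
  qed
qed

lemma chi_range: "chi a \<in> {-1, 0, 1}"
  by (auto simp: chi_def Legendre_def)

lemma of_int_to_int_mod_ring: "of_int (to_int_mod_ring a) = (a :: 'l::prime_card mod_ring)"
  by (simp add: of_int_of_int_mod_ring)

lemma of_int_mod_ring_eq_iff:
  "(of_int x :: 'l::prime_card mod_ring) = of_int y \<longleftrightarrow> [x = y] (mod int CARD('l))"
  using of_int_eq_iff_cong_CHAR[of x y, where 'a = "'l mod_ring"] by simp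

lemma of_int_chi:
  fixes a :: "'l::prime_card mod_ring"
  assumes "CARD('l) > 2"
  shows "of_int (chi a) = a ^ ((CARD('l) - 1) div 2)"
proof -
  have "[chi a = to_int_mod_ring a ^ ((CARD('l) - 1) div 2)] (mod int CARD('l))"
    unfolding chi_def by (rule euler_criterion) (use assms prime_card in auto)
  then have "(of_int (chi a) :: 'l mod_ring) = of_int (to_int_mod_ring a ^ ((CARD('l) - 1) div 2))"
    by (simp only: of_int_mod_ring_eq_iff)
  also have "\<dots> = a ^ ((CARD('l) - 1) div 2)"
    by (simp only: of_int_power of_int_to_int_mod_ring)
  finally show ?thesis .
qed

lemma two_neq_0_mod_ring:
  assumes "CARD('l::prime_card) > 2" shows "(2 :: 'l mod_ring) \<noteq> 0"
proof
  assume "(2 :: 'l mod_ring) = 0"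
  then have "(of_nat 2 :: 'l mod_ring) = 0" by simp
  then have "CARD('l) dvd 2" using of_nat_0_mod_ring_dvd by blast
  then show False using assms by (auto dest: dvd_imp_le)
qed

lemma of_int_sign_inj:
  assumes "CARD('l::prime_card) > 2" "x \<in> {-1, 0, 1}" "y \<in> {-1, 0, 1}"
    and "(of_int x :: 'l mod_ring) = of_int y"
  shows "x = y"
proof -
  have "(1 :: 'l mod_ring) \<noteq> -1" using two_neq_0_mod_ring[OF assms(1)] by (simp add: eq_neg_iff_add_eq_0)
  then show ?thesis using assms(2-4) by auto
qed

lemma chi_eq_0_iff: "chi (a :: 'l::prime_card mod_ring) = 0 \<longleftrightarrow> a = 0"
proof -
  have "[to_int_mod_ring a = 0] (mod int CARD('l)) \<longleftrightarrow> a = 0"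
    unfolding of_int_mod_ring_eq_iff[symmetric] of_int_to_int_mod_ring by simp
  then show ?thesis by (auto simp: chi_def Legendre_def)
qed

lemma QuadRes_mod_ring:
  "QuadRes (int CARD('l)) (to_int_mod_ring a) \<longleftrightarrow> (\<exists>y. y ^ 2 = (a :: 'l::prime_card mod_ring))"
proof -
  have *: "[y ^ 2 = to_int_mod_ring a] (mod int CARD('l)) \<longleftrightarrow> (of_int y :: 'l mod_ring) ^ 2 = a" for y
    unfolding of_int_mod_ring_eq_iff[symmetric] of_int_to_int_mod_ring by simp
  have "(y :: 'l mod_ring) = of_int (to_int_mod_ring y)" for y by (simp only: of_int_to_int_mod_ring)
  then show ?thesis unfolding QuadRes_def * by metis
qed

lemma chi_eq_1_iff: "chi a = 1 \<longleftrightarrow> a \<noteq> 0 \<and> (\<exists>y. y ^ 2 = a)"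
  using chi_eq_0_iff[of a] by (auto simp: chi_def Legendre_def QuadRes_mod_ring split: if_splits)

lemma quadratic_nonresidue_iff_chi: "quadratic_nonresidue c \<longleftrightarrow> chi c = -1"
  using chi_eq_0_iff[of c] chi_eq_1_iff[of c] chi_range[of c]
  by (auto simp: quadratic_nonresidue_def QuadRes_mod_ring)

lemma chi_mult:
  fixes a b :: "'l::prime_card mod_ring"
  assumes "CARD('l) > 2"
  shows "chi (a * b) = chi a * chi b"
proof (rule of_int_sign_inj[OF assms])
  show "chi a * chi b \<in> {-1, 0, 1}" using chi_range[of a] chi_range[of b] by auto
  show "(of_int (chi (a * b)) :: 'l mod_ring) = of_int (chi a * chi b)"
    using of_int_chi[OF assms] by (simp add: power_mult_distrib)
qed (rule chi_range)

text \<open>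
  Manin's proof.  With \<open>Y = F\<^sup>(\<^sup>l\<^sup>-\<^sup>1\<^sup>)\<^sup>/\<^sup>2\<close> the point \<open>(t\<^sup>l, Y)\<close> lies on the twisted curve, by Frobenius,
  and \<open>Y\<close> takes the values \<open>\<chi>(F(x))\<close>, by Euler's criterion.
\<close>

theorem hasse_cubic:
  fixes a b :: "'l::prime_card mod_ring"
  assumes l: "CARD('l) > 2" and b: "b \<noteq> 0" and disc: "a ^ 2 - 4 * b \<noteq> 0"
  shows "(\<Sum>x\<in>UNIV. chi (x ^ 3 + a * x ^ 2 + b * x)) ^ 2 \<le> 4 * int CARD('l)"
proof -
  define F where "F = [:0, b, a, 1:]"
  define m where "m = (CARD('l) - 1) div 2"
  define \<epsilon> where "\<epsilon> x = chi (poly F x)" for x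
  define s where "s = (\<Sum>x\<in>UNIV. \<epsilon> x)"
  have odd: "odd CARD('l)" using l prime_odd_nat[OF prime_card] by blast
  then have m: "CARD('l) = 2 * m + 1" unfolding m_def by (auto elim!: oddE)
  have F: "poly F x = x ^ 3 + a * x ^ 2 + b * x" for x
    by (simp add: F_def algebra_simps power2_eq_square power3_eq_cube)
  \<comment> \<open>the progression is followed in one direction only, so the sign of \<open>Y\<close> is chosen to make its slope nonnegative\<close>
  have key: "(\<sigma> * s) ^ 2 \<le> 4 * int CARD('l)" if \<sigma>: "\<sigma> \<in> {1, -1}" and pos: "\<sigma> * s \<ge> 0" for \<sigma> :: int
  proof -
    define Y where "Y = of_int \<sigma> * F ^ m"
    have sq: "(of_int \<sigma> :: 'l mod_ring poly) ^ 2 = 1" using \<sigma> by auto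
    have 1: "F * Y ^ 2 = pcompose F (monom 1 CARD('l))"
    proof -
      have "Y ^ 2 = F ^ (2 * m)"
        unfolding Y_def power_mult_distrib sq by (simp add: power_mult[symmetric] mult.commute)
      then have "F * Y ^ 2 = F ^ CARD('l)" by (simp add: m)
      then show ?thesis using poly_frobenius[of F] by simp
    qed
    have "degree Y \<le> m * 3"
    proof -
      have "degree (F ^ m) = m * 3" by (simp add: F_def degree_power_eq)
      moreover have "Y = F ^ m \<or> Y = - (F ^ m)" using \<sigma> by (auto simp: Y_def)
      ultimately show ?thesis by auto
    qed
    moreover have "degree F = 3" by (simp add: F_def)
    ultimately have 2: "degree (F * Y) < 2 * CARD('l) + 1"
      using degree_mult_le[of F Y] m l by linarith
    obtain P Q where PQ: "coprime P Q" "kummer_rel a b P Q (monom 1 CARD('l)) 1"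
      "int (height P Q) = int CARD('l) + 1 - \<sigma> * s"
    proof (rule kummer_start[OF l b disc, where Y = Y and \<epsilon> = "\<lambda>x. \<sigma> * \<epsilon> x" and s = "\<sigma> * s"])
      show "[:0, b, a, 1:] * Y\<^sup>2 = [:0, b, a, 1:] \<circ>\<^sub>p monom 1 CARD('l)" using 1 by (simp add: F_def)
      show "degree ([:0, b, a, 1:] * Y) < 2 * CARD('l) + 1" using 2 by (simp add: F_def)
      show "\<sigma> * \<epsilon> x \<in> {-1, 0, 1}" for x using \<sigma> chi_range[of "poly F x"] by (auto simp: \<epsilon>_def)
      show "poly Y x = of_int (\<sigma> * \<epsilon> x)" for x
        using of_int_chi[OF l, of "poly F x"] by (simp add: Y_def \<epsilon>_def m_def poly_power)
      show "poly [:0, b, a, 1:] x = 0" if "\<sigma> * \<epsilon> x = 0" for x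
        using that \<sigma> chi_eq_0_iff[of "poly F x"] by (auto simp: \<epsilon>_def F_def)
      show "\<sigma> * s = (\<Sum>x\<in>UNIV. \<sigma> * \<epsilon> x)" by (simp add: s_def sum_distrib_left)
    qed
    have "0 \<le> int n ^ 2 - (\<sigma> * s) * int n + int CARD('l)" for n
    proof (rule kummer_heights_nonneg[OF b disc two_neq_0_mod_ring[OF l] _ PQ(1,2) _ PQ(3)])
      show "int (height (monom (1 :: 'l mod_ring) CARD('l)) 1) = int CARD('l)" by (simp add: height_def degree_monom_eq)
    qed simp
    then show ?thesis using quadratic_nonneg_at_integers pos odd by simp
  qed
  have "s ^ 2 \<le> 4 * int CARD('l)" using key[of 1] key[of "-1"] by (cases "s \<ge> 0") auto
  then show ?thesis by (simp add: s_def \<epsilon>_def F)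
qed

section \<open>Quartic character sums\<close>

lemma four_neq_0_mod_ring:
  assumes "CARD('l::prime_card) > 2" shows "(4 :: 'l mod_ring) \<noteq> 0"
  using no_zero_divisors[OF two_neq_0_mod_ring[OF assms] two_neq_0_mod_ring[OF assms]] by simp

lemma card_square_roots:
  fixes w :: "'l::prime_card mod_ring"
  assumes l: "CARD('l) > 2"
  shows "int (card {z. z ^ 2 = w}) = 1 + chi w"
proof -
  consider "w = 0" | "chi w = 1" | "chi w = -1" using chi_range[of w] chi_eq_0_iff[of w] by auto
  then show ?thesis
  proof cases
    case 1
    then show ?thesis by (simp add: chi_eq_0_iff)
  next
    case 2
    then obtain y where y: "y ^ 2 = w" "w \<noteq> 0" using chi_eq_1_iff by blast
    then have "y \<noteq> 0" by auto
    then have "y \<noteq> - y" using two_neq_0_mod_ring[OF l] by (metis add_eq_0_iff mult_2 mult_eq_0_iff)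
    moreover have "{z. z ^ 2 = w} = {y, - y}" using y by (auto simp: power2_eq_iff)
    ultimately show ?thesis using 2 by simp
  next
    case 3
    then have "{z. z ^ 2 = w} = {}" using chi_eq_1_iff[of w] chi_eq_0_iff[of w] by auto
    then show ?thesis using 3 by simp
  qed
qed

text \<open>
  The fibre of squaring over \<open>w\<close> has \<open>1 + \<chi>(w)\<close> elements.
\<close>

lemma sum_over_squares:
  fixes f :: "'l::prime_card mod_ring \<Rightarrow> int"
  assumes l: "CARD('l) > 2"
  shows "(\<Sum>z\<in>UNIV. f (z ^ 2)) = (\<Sum>w\<in>UNIV. (1 + chi w) * f w)"
proof -
  have "(\<Sum>z\<in>UNIV. f (z ^ 2)) = (\<Sum>w\<in>UNIV. \<Sum>z | z \<in> UNIV \<and> z ^ 2 = w. f (z ^ 2))"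
    by (rule sum.group[symmetric]) auto
  also have "\<dots> = (\<Sum>w\<in>UNIV. int (card {z. z ^ 2 = w}) * f w)"
    by (intro sum.cong refl) simp
  finally show ?thesis by (simp add: card_square_roots[OF l])
qed

lemma sum_reindex_affine:
  fixes f :: "'a::{finite,field} \<Rightarrow> int"
  assumes "d \<noteq> 0"
  shows "(\<Sum>x\<in>UNIV. f (d * x + e)) = (\<Sum>x\<in>UNIV. f x)"
  by (rule sum.reindex_bij_witness[of _ "\<lambda>y. (y - e) / d" "\<lambda>x. d * x + e"]) (use assms in auto)

text \<open>
  Multiplication by the nonresidue \<open>c\<close> permutes the summands and changes their sign.
\<close>

lemma sum_chi_eq_0:
  fixes c :: "'l::prime_card mod_ring"
  assumes l: "CARD('l) > 2" and c: "chi c = -1"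
  shows "(\<Sum>x\<in>(UNIV::'l mod_ring set). chi x) = 0"
proof -
  have "c \<noteq> 0" using c chi_eq_0_iff[of c] by auto
  then have "(\<Sum>x\<in>(UNIV::'l mod_ring set). chi x) = (\<Sum>x\<in>UNIV. chi (c * x))"
    using sum_reindex_affine[of c chi 0] by simp
  also have "\<dots> = - (\<Sum>x\<in>(UNIV::'l mod_ring set). chi x)"
    by (simp add: chi_mult[OF l] c sum_negf)
  finally show ?thesis by simp
qed

lemma chi_one: "chi (1 :: 'l::prime_card mod_ring) = 1"
  unfolding chi_eq_1_iff by (auto intro: exI[of _ 1])

lemma chi_power2: "x \<noteq> 0 \<Longrightarrow> chi (x ^ 2) = 1"
  by (auto simp: chi_eq_1_iff)

lemma chi_inverse:
  fixes x :: "'l::prime_card mod_ring"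
  assumes "CARD('l) > 2" shows "chi (inverse x) = chi x"
proof (cases "x = 0")
  case False
  have "chi (inverse x) = chi (x ^ 2) * chi (inverse x)" using False by (simp add: chi_power2)
  also have "\<dots> = chi (x ^ 2 * inverse x)" by (simp only: chi_mult[OF assms])
  also have "x ^ 2 * inverse x = x" using False by (simp add: power2_eq_square)
  finally show ?thesis .
qed simp

text \<open>
  After moving one root to \<open>0\<close>, the product is \<open>x\<^sup>2\<close> times \<open>1 - e/x\<close>, which takes every value but
  \<open>1\<close> when \<open>x\<close> runs through the units.
\<close>

lemma sum_chi_two_roots:
  fixes c p r :: "'l::prime_card mod_ring"
  assumes l: "CARD('l) > 2" and c: "chi c = -1" and "p \<noteq> r"
  shows "(\<Sum>x\<in>UNIV. chi ((x - p) * (x - r))) = -1"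
proof -
  define e where "e = r - p"
  have e: "e \<noteq> 0" using assms by (simp add: e_def)
  have "(\<Sum>x\<in>UNIV. chi ((x - p) * (x - r))) = (\<Sum>x\<in>UNIV. chi (x * (x - e)))"
    using sum_reindex_affine[of 1 "\<lambda>x. chi ((x - p) * (x - r))" p] by (simp add: e_def algebra_simps)
  also have "\<dots> = (\<Sum>x\<in>UNIV - {0}. chi (x * (x - e)))"
    by (simp add: sum.remove[of UNIV 0] chi_eq_0_iff)
  also have "\<dots> = (\<Sum>x\<in>UNIV - {0}. chi (1 - e * inverse x))"
  proof (intro sum.cong refl)
    fix x :: "'l mod_ring" assume "x \<in> UNIV - {0}"
    then have x: "x \<noteq> 0" by simp
    then have "x * (x - e) = x ^ 2 * (1 - e * inverse x)" by (simp add: power2_eq_square algebra_simps)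
    then show "chi (x * (x - e)) = chi (1 - e * inverse x)" using x by (simp add: chi_mult[OF l] chi_power2)
  qed
  also have "\<dots> = (\<Sum>u\<in>UNIV - {1::'l mod_ring}. chi u)"
  proof -
    have inv: "e * inverse (e * inverse x) = x" for x using e by (simp add: mult.assoc[symmetric])
    have inv2: "e * (inverse e * x) = x" for x using e by (simp add: mult.assoc[symmetric])
    show ?thesis
    by (rule sum.reindex_bij_witness[of _ "\<lambda>u. e * inverse (1 - u)" "\<lambda>x. 1 - e * inverse x"])
       (simp_all add: inv inv2 e)
  qed
  also have "\<dots> = -1"
    using sum_chi_eq_0[OF l c] sum.remove[of UNIV "1::'l mod_ring" chi] by (simp add: chi_one)
  finally show ?thesis .
qed

lemma sum_chi_quadratic:
  fixes c d :: "'l::prime_card mod_ring"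
  assumes l: "CARD('l) > 2" and c: "chi c = -1" and "d \<noteq> 0"
  shows "(\<Sum>x\<in>UNIV. chi (x ^ 2 - d)) = -1"
proof -
  have "(\<Sum>x\<in>UNIV. chi (x ^ 2 - d)) = (\<Sum>w\<in>UNIV. chi (w - d)) + (\<Sum>w\<in>UNIV. chi w * chi (w - d))"
    using sum_over_squares[OF l, of "\<lambda>w. chi (w - d)"] by (simp add: algebra_simps sum.distrib)
  also have "(\<Sum>w\<in>UNIV. chi (w - d)) = 0"
    using sum_reindex_affine[of 1 chi "- d"] sum_chi_eq_0[OF l c] by simp
  also have "(\<Sum>w\<in>UNIV. chi w * chi (w - d)) = -1"
    using sum_chi_two_roots[OF l c, of 0 d] assms by (simp add: chi_mult[OF l])
  finally show ?thesis by simp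
qed

lemma K_sym: "K A B = K B A"
  unfolding K_def by (simp add: mult.commute)

lemma K_scale:
  fixes A B d :: "'l::prime_card mod_ring"
  assumes l: "CARD('l) > 2" and d: "d \<noteq> 0"
  shows "K (d ^ 2 * A) (d ^ 2 * B) = K A B"
proof -
  have d4: "chi ((d ^ 2) ^ 2) = 1" using d by (intro chi_power2) simp
  have "K (d ^ 2 * A) (d ^ 2 * B) = (\<Sum>z\<in>UNIV. chi (((d * z) ^ 2 - d ^ 2 * A) * ((d * z) ^ 2 - d ^ 2 * B)))"
    using sum_reindex_affine[OF d, of "\<lambda>z. chi ((z ^ 2 - d ^ 2 * A) * (z ^ 2 - d ^ 2 * B))" 0]
    by (simp add: K_def)
  also have "\<dots> = (\<Sum>z\<in>UNIV. chi ((d ^ 2) ^ 2 * ((z ^ 2 - A) * (z ^ 2 - B))))"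
    by (simp add: algebra_simps power2_eq_square)
  also have "\<dots> = K A B" unfolding K_def chi_mult[OF l, of "(d ^ 2) ^ 2"] d4 by simp
  finally show ?thesis .
qed

text \<open>
  Inverting \<open>z\<close> is a symmetry of the projective line, on which \<open>K + 1\<close> is the complete character
  sum: the point at infinity contributes \<open>1\<close> because the quartic is monic, and it is exchanged with
  \<open>z = 0\<close>, which contributes \<open>\<chi>(A B)\<close>.
\<close>

lemma K_inversion:
  fixes A B :: "'l::prime_card mod_ring"
  assumes l: "CARD('l) > 2" and A: "A \<noteq> 0" and B: "B \<noteq> 0"
  shows "K A B + 1 = chi (A * B) * (K (inverse A) (inverse B) + 1)"
proof -
  have split: "K A' B' = chi (A' * B') + (\<Sum>z\<in>UNIV - {0}. chi ((z ^ 2 - A') * (z ^ 2 - B')))" for A' B' :: "'l mod_ring"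
    unfolding K_def by (subst sum.remove[of UNIV 0]) auto
  have "(\<Sum>z\<in>UNIV - {0}. chi ((z ^ 2 - A) * (z ^ 2 - B))) =
      (\<Sum>z\<in>UNIV - {0}. chi ((inverse z ^ 2 - A) * (inverse z ^ 2 - B)))"
    by (rule sum.reindex_bij_witness[of _ inverse inverse]) auto
  also have "\<dots> = (\<Sum>z\<in>UNIV - {0}. chi (A * B) * chi ((z ^ 2 - inverse A) * (z ^ 2 - inverse B)))"
  proof (intro sum.cong refl)
    fix z :: "'l mod_ring" assume "z \<in> UNIV - {0}"
    then have z: "z \<noteq> 0" by simp
    then have "(inverse z ^ 2 - A) * (inverse z ^ 2 - B) =
      (inverse z ^ 2) ^ 2 * (A * B * ((z ^ 2 - inverse A) * (z ^ 2 - inverse B)))"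
      using A B by (simp add: field_simps power2_eq_square)
    moreover have "chi ((inverse z ^ 2) ^ 2) = 1" using z by (intro chi_power2) simp
    ultimately show "chi ((inverse z ^ 2 - A) * (inverse z ^ 2 - B)) =
      chi (A * B) * chi ((z ^ 2 - inverse A) * (z ^ 2 - inverse B))"
      by (metis chi_mult[OF l] mult_1)
  qed
  also have "\<dots> = chi (A * B) * (K (inverse A) (inverse B) - chi (inverse A * inverse B))"
    using split[of "inverse A" "inverse B"] by (simp add: sum_distrib_left)
  finally have "K A B = chi (A * B) + chi (A * B) * (K (inverse A) (inverse B) - chi (inverse A * inverse B))"
    using split[of A B] by simp
  moreover have "chi (A * B) * chi (inverse A * inverse B) = 1"
  proof -
    have "A * B * (inverse A * inverse B) = 1" using A B by (simp add: field_simps)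
    then show ?thesis using chi_mult[OF l, of "A * B" "inverse A * inverse B"] by (simp add: chi_one)
  qed
  ultimately show ?thesis by (simp add: right_diff_distrib distrib_left)
qed

text \<open>
  For \<open>A = d\<^sup>2\<close> the pair \<open>(A, c A)\<close> is a rescaling of \<open>(1, c)\<close>.  For a nonresidue \<open>A = d\<^sup>2 c\<close> it is a
  rescaling of \<open>(c, c\<^sup>2)\<close>, which inversion followed by rescaling turns into \<open>(c, 1)\<close> at the cost of
  the factor \<open>\<chi>(c\<^sup>3) = -1\<close>.
\<close>

lemma K_nonresidue:
  fixes A c :: "'l::prime_card mod_ring"
  assumes l: "CARD('l) > 2" and c: "chi c = -1" and A: "A \<noteq> 0"
  shows "K A (c * A) + 1 = chi A * (K 1 c + 1)"
proof -
  have c0: "c \<noteq> 0" using c chi_eq_0_iff[of c] by auto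
  consider "chi A = 1" | "chi A = -1" using chi_range[of A] chi_eq_0_iff[of A] A by auto
  then show ?thesis
  proof cases
    case 1
    then obtain d where d: "d ^ 2 = A" using chi_eq_1_iff by blast
    then have "d \<noteq> 0" using A by auto
    then show ?thesis using K_scale[OF l, of d 1 c] d 1 by (simp add: mult.commute)
  next
    case 2
    then have "chi (A * inverse c) = 1" using c by (simp add: chi_mult[OF l] chi_inverse[OF l])
    then obtain d where d: "d ^ 2 = A * inverse c" using chi_eq_1_iff by blast
    then have d': "d ^ 2 * c = A" "d \<noteq> 0" using A c0 by auto
    have "K A (c * A) = K c (c ^ 2)"
      using K_scale[OF l d'(2), of c "c ^ 2"] d' by (simp add: power2_eq_square mult_ac)
    also have "\<dots> + 1 = chi (c ^ 2 * c) * (K (inverse c) (inverse (c ^ 2)) + 1)"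
      using K_inversion[OF l, of c "c ^ 2"] c0 by (simp add: mult.commute)
    also have "chi (c ^ 2 * c) = -1" using c chi_power2[OF c0] chi_mult[OF l, of "c ^ 2" c] by simp
    also have "K (inverse c) (inverse (c ^ 2)) = K c 1"
    proof -
      have "inverse c ^ 2 * c = inverse c" using c0 by (simp add: power2_eq_square)
      then show ?thesis using K_scale[OF l, of "inverse c" c 1] c0 by (simp add: power_inverse)
    qed
    also have "K c 1 = K 1 c" by (rule K_sym)
    finally show ?thesis using 2 by simp
  qed
qed

text \<open>
  Substituting \<open>w = z\<^sup>2\<close> splits the quartic sum into a quadratic one, equal to \<open>-1\<close>, and the sum for
  the cubic \<open>w (w - 1) (w - c)\<close>.
\<close>

lemma K_hasse:
  fixes c :: "'l::prime_card mod_ring"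
  assumes l: "CARD('l) > 2" and c: "chi c = -1"
  shows "(K 1 c + 1) ^ 2 \<le> 4 * int CARD('l)"
proof -
  have c1: "c \<noteq> 0" "c \<noteq> 1" using c chi_eq_0_iff[of c] chi_one[where 'l = 'l] by auto
  have "K 1 c = (\<Sum>w\<in>UNIV. chi ((w - 1) * (w - c))) + (\<Sum>w\<in>UNIV. chi w * chi ((w - 1) * (w - c)))"
    unfolding K_def using sum_over_squares[OF l, of "\<lambda>w. chi ((w - 1) * (w - c))"]
    by (simp add: distrib_right sum.distrib)
  also have "(\<Sum>w\<in>UNIV. chi ((w - 1) * (w - c))) = -1"
    by (rule sum_chi_two_roots[OF l c]) (use c1 in auto)
  also have "(\<Sum>w\<in>UNIV. chi w * chi ((w - 1) * (w - c))) = (\<Sum>w\<in>UNIV. chi (w ^ 3 + (- (1 + c)) * w ^ 2 + c * w))"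
    by (intro sum.cong refl, subst chi_mult[OF l, symmetric])
       (simp add: algebra_simps power2_eq_square power3_eq_cube)
  finally have *: "K 1 c + 1 = (\<Sum>w\<in>UNIV. chi (w ^ 3 + (- (1 + c)) * w ^ 2 + c * w))" by simp
  have "(- (1 + c)) ^ 2 - 4 * c = (1 - c) ^ 2" by (simp add: algebra_simps power2_eq_square)
  then have "(- (1 + c)) ^ 2 - 4 * c \<noteq> 0" using c1 by simp
  then show ?thesis unfolding * by (rule hasse_cubic[OF l c1(1)])
qed

section \<open>Variance and tail bounds\<close>

text \<open>
  The values are \<open>-1 + \<chi>(A) (K 1 c + 1)\<close>, where \<open>\<chi>(A)\<close> is a fair sign.
\<close>

lemma variance_K:
  fixes c :: "'l::prime_card mod_ring"
  assumes l: "CARD('l) > 2" and c: "chi c = -1"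
  shows "uniform_variance (\<lambda>A. real_of_int (K A (c * A))) = real_of_int ((K 1 c + 1) ^ 2)"
proof -
  let ?S = "UNIV - {0 :: 'l mod_ring}"
  have "1 \<in> ?S" by simp
  then have S: "?S \<noteq> {}" "finite ?S" by (metis empty_iff, simp)
  then have card: "real (card ?S) \<noteq> 0" by (metis card_0_eq of_nat_eq_0_iff)
  have KA: "K A (c * A) = chi A * (K 1 c + 1) - 1" if "A \<in> ?S" for A
    using K_nonresidue[OF l c, of A] that by simp
  have "(\<Sum>A\<in>?S. chi A) = 0"
    using sum_chi_eq_0[OF l c] sum.remove[of UNIV "0::'l mod_ring" chi]
      chi_eq_0_iff[of "0::'l mod_ring"] by simp
  then have "(\<Sum>A\<in>?S. K A (c * A)) = - int (card ?S)"
    by (simp add: KA sum_subtractf sum_distrib_right[symmetric])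
  then have "real_of_int (\<Sum>A\<in>?S. K A (c * A)) = real_of_int (- int (card ?S))" by (simp only:)
  then have sum: "(\<Sum>A\<in>?S. real_of_int (K A (c * A))) = - real (card ?S)"
    by (simp only: of_int_sum of_int_minus of_int_of_nat_eq)
  have E: "measure_pmf.expectation (pmf_of_set ?S) (\<lambda>A. real_of_int (K A (c * A))) = -1"
    unfolding integral_pmf_of_set[OF S] sum using card by (metis divide_self minus_divide_left)
  have "(real_of_int (K A (c * A)) - (-1)) ^ 2 = real_of_int ((K 1 c + 1) ^ 2)" if "A \<in> ?S" for A
  proof -
    have "chi A ^ 2 = 1" using that chi_range[of A] chi_eq_0_iff[of A] by auto
    moreover have "K A (c * A) - (-1) = chi A * (K 1 c + 1)" using K_nonresidue[OF l c, of A] that by simp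
    ultimately have "(K A (c * A) - (-1)) ^ 2 = (K 1 c + 1) ^ 2" by (simp add: power_mult_distrib)
    then show ?thesis by (metis of_int_diff of_int_minus of_int_1 of_int_power)
  qed
  then have "(\<Sum>A\<in>?S. (real_of_int (K A (c * A)) - (-1)) ^ 2) = real (card ?S) * real_of_int ((K 1 c + 1) ^ 2)"
    by (simp only: sum.cong[OF refl] sum_constant)
  then show ?thesis
    unfolding uniform_variance_def E integral_pmf_of_set[OF S] using card by (metis nonzero_mult_div_cancel_left)
qed

text \<open>
  Chebyshev's inequality for a variable that never exceeds two standard units: the event is
  impossible for \<open>\<mu> > 2\<close>, and the bound is at least \<open>1\<close> otherwise.
\<close>

lemma tail_bound:
  fixes g :: "'l::prime_card mod_ring \<Rightarrow> bool" and \<mu> :: real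
  assumes "\<mu> > 0" and "\<And>A. A \<noteq> 0 \<Longrightarrow> g A \<Longrightarrow> \<mu> \<le> 2"
  shows "1 / (real CARD('l) - 1) * real (card {A. A \<noteq> 0 \<and> g A}) \<le> 4 / \<mu> ^ 2"
proof (cases "\<mu> \<le> 2")
  case True
  then have "\<mu> ^ 2 \<le> 2 ^ 2" using assms(1) by (intro power_mono) auto
  then have "1 \<le> 4 / \<mu> ^ 2" using assms(1) by simp
  moreover have "real (card {A :: 'l mod_ring. A \<noteq> 0 \<and> g A}) \<le> real CARD('l) - 1"
  proof -
    have "card {A :: 'l mod_ring. A \<noteq> 0 \<and> g A} \<le> card (UNIV - {0 :: 'l mod_ring})" by (intro card_mono) auto
    also have "\<dots> = CARD('l) - 1" by (simp add: card_Diff_singleton)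
    finally have "card {A :: 'l mod_ring. A \<noteq> 0 \<and> g A} + 1 \<le> CARD('l)"
      using prime_gt_1_nat[OF prime_card[where 'a = 'l]] by linarith
    then have "real (card {A :: 'l mod_ring. A \<noteq> 0 \<and> g A} + 1) \<le> real CARD('l)" by (simp only: of_nat_le_iff)
    then show ?thesis by simp
  qed
  moreover have "real CARD('l) - 1 > 0" using prime_gt_1_nat[OF prime_card[where 'a = 'l]] by simp
  ultimately show ?thesis
    by (smt (verit) divide_le_eq_1_pos mult_cancel_right1 times_divide_eq_left)
next
  case False
  then have z: "card {A. A \<noteq> 0 \<and> g A} = 0" using assms(2) by (intro card_eq_0_iff[THEN iffD2] disjI1) blast
  show ?thesis unfolding z using assms(1) by simp
qed

lemma K_abs_bound:
  fixes c A :: "'l::prime_card mod_ring"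
  assumes l: "CARD('l) > 2" and c: "chi c = -1" and "A \<noteq> 0"
  shows "\<bar>real_of_int (K A (c * A)) + 1\<bar> \<le> 2 * sqrt (real CARD('l))"
proof -
  have "chi A ^ 2 = 1" using assms(3) chi_range[of A] chi_eq_0_iff[of A] by auto
  then have "(K A (c * A) + 1) ^ 2 \<le> 4 * int CARD('l)"
    using K_hasse[OF l c] K_nonresidue[OF assms] by (simp add: power_mult_distrib)
  then have "real_of_int ((K A (c * A) + 1) ^ 2) \<le> real_of_int (4 * int CARD('l))" by (simp only: of_int_le_iff)
  then have "(real_of_int (K A (c * A)) + 1) ^ 2 \<le> (2 * sqrt (real CARD('l))) ^ 2"
    by (simp add: power_mult_distrib)
  then show ?thesis by (metis abs_le_square_iff abs_of_nonneg mult_nonneg_nonneg of_nat_0_le_iff real_sqrt_ge_zero zero_le_numeral)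
qed

section \<open>The value sets\<close>

text \<open>
  \<open>v = a x + N/x\<close> is a quadratic equation for \<open>x\<close> with discriminant \<open>v\<^sup>2 - 4 a N\<close>.
\<close>

lemma H_eq:
  fixes a N :: "'l::prime_card mod_ring"
  assumes l: "CARD('l) > 2" and a: "a \<noteq> 0" and N: "N \<noteq> 0"
  shows "H a N = {v. chi (v ^ 2 - 4 * a * N) \<noteq> -1}"
proof (intro Set.set_eqI iffI)
  fix v assume "v \<in> H a N"
  then obtain x where x: "v = a * x + N * inverse x" "x \<noteq> 0" by (auto simp: H_def)
  define w where "w = inverse x"
  have "(a * x + N * w) ^ 2 = (a * x - N * w) ^ 2 + 4 * ((a * x) * (N * w))"
    by (simp add: power2_sum power2_diff)
  also have "(a * x) * (N * w) = a * N * (x * w)" by (simp add: mult_ac)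
  finally have "(a * x + N * w) ^ 2 = (a * x - N * w) ^ 2 + 4 * a * N * (x * w)" by (simp add: mult_ac)
  then have D: "v ^ 2 - 4 * a * N = (a * x - N * w) ^ 2"
    using x unfolding w_def by simp
  have "chi ((a * x - N * w) ^ 2) \<noteq> -1"
    using chi_power2[of "a * x - N * w"] by (cases "a * x - N * w = 0") (simp_all add: chi_eq_0_iff[THEN iffD2])
  then show "v \<in> {v. chi (v ^ 2 - 4 * a * N) \<noteq> -1}" using D by simp
next
  fix v assume "v \<in> {v. chi (v ^ 2 - 4 * a * N) \<noteq> -1}"
  then have "chi (v ^ 2 - 4 * a * N) = 0 \<or> chi (v ^ 2 - 4 * a * N) = 1"
    using chi_range[of "v ^ 2 - 4 * a * N"] by auto
  then obtain y where y: "y ^ 2 = v ^ 2 - 4 * a * N"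
    using chi_eq_1_iff chi_eq_0_iff by (metis zero_power2)
  have two: "(2::'l mod_ring) \<noteq> 0" by (rule two_neq_0_mod_ring[OF l])
  have four: "(4::'l mod_ring) \<noteq> 0" by (rule four_neq_0_mod_ring[OF l])
  define x where "x = (v + y) / (2 * a)"
  have x: "2 * a * x = v + y" using two a by (simp add: x_def)
  have "x \<noteq> 0"
  proof
    assume "x = 0"
    then have "y = - v" using x by (simp add: add_eq_0_iff2 add_eq_0_iff)
    then show False using y a N four by simp
  qed
  have "(2 * a * x) ^ 2 - 2 * v * (2 * a * x) + 4 * a * N = 0"
    unfolding x using y by (simp add: algebra_simps power2_eq_square)
  then have "4 * a * (a * x ^ 2 - v * x + N) = 0" by (simp add: algebra_simps power2_eq_square)
  then have "a * x ^ 2 - v * x + N = 0" using four a by (simp only: mult_eq_0_iff) simp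
  then have "a * x ^ 2 + N = v * x" using four a by (simp add: algebra_simps add_eq_0_iff2)
  then have "v = a * x + N * inverse x" using \<open>x \<noteq> 0\<close> by (simp add: field_simps power2_eq_square)
  then show "v \<in> H a N" using \<open>x \<noteq> 0\<close> by (auto simp: H_def)
qed

text \<open>
  A value \<open>v\<close> is missed by \<open>U\<close> iff both discriminants are nonresidues, which
  \<open>(1 - \<chi>(v\<^sup>2 - p)) (1 - \<chi>(v\<^sup>2 - r)) = 4\<close> detects, except when a discriminant vanishes.  Expanding
  the product produces \<open>K p r\<close> and two quadratic sums, each equal to \<open>-1\<close>.  Exactly one of \<open>p\<close>, \<open>r\<close>
  is a square, so there are just two exceptional values of \<open>v\<close>; their total \<open>e\<close> lies between \<open>0\<close>
  and \<open>4\<close>, and \<open>\<bar>e - 1\<bar> \<le> 3\<close>.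
\<close>

lemma card_U:
  fixes a b N :: "'l::prime_card mod_ring"
  assumes l: "CARD('l) > 2" and ab: "chi (a * b) = -1" and N: "N \<noteq> 0"
  shows "\<bar>4 * int (card (U a b N)) - 3 * int CARD('l)\<bar> \<le> \<bar>K (4 * a * N) (4 * b * N) + 1\<bar> + 3"
proof -
  have a: "a \<noteq> 0" "b \<noteq> 0" using ab chi_eq_0_iff[of "a * b"] by auto
  have two: "(2::'l mod_ring) \<noteq> 0" by (rule two_neq_0_mod_ring[OF l])
  have four: "(4::'l mod_ring) \<noteq> 0" by (rule four_neq_0_mod_ring[OF l])
  define p r where "p = 4 * a * N" and "r = 4 * b * N"
  have pr: "p \<noteq> 0" "r \<noteq> 0" using a N four by (auto simp: p_def r_def)
  have "p * r = (4 * N) ^ 2 * (a * b)" by (simp add: p_def r_def power2_eq_square mult_ac)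
  then have "chi (p * r) = chi ((4 * N) ^ 2) * chi (a * b)" by (simp only: chi_mult[OF l])
  then have chi_pr: "chi p * chi r = -1"
  proof -
    have "chi ((4 * N) ^ 2) = 1" using N four by (intro chi_power2) simp
    then show ?thesis using \<open>chi (p * r) = _\<close> ab chi_mult[OF l, of p r] by simp
  qed
  then have "p \<noteq> r" using chi_power2[OF pr(1)] unfolding power2_eq_square chi_mult[OF l] by auto
  let ?\<alpha> = "\<lambda>v. chi (v ^ 2 - p)" and ?\<beta> = "\<lambda>v. chi (v ^ 2 - r)"
  define e where "e = (\<Sum>v | v ^ 2 = p. 1 - ?\<beta> v) + (\<Sum>v | v ^ 2 = r. 1 - ?\<alpha> v)"
  have e_if: "e = (\<Sum>v\<in>UNIV. if v ^ 2 = p then 1 - ?\<beta> v else 0) + (\<Sum>v\<in>UNIV. if v ^ 2 = r then 1 - ?\<alpha> v else 0)"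
    unfolding e_def
    using sum.inter_filter[of UNIV "\<lambda>v. 1 - ?\<beta> v" "\<lambda>v. v ^ 2 = p"]
      sum.inter_filter[of UNIV "\<lambda>v. 1 - ?\<alpha> v" "\<lambda>v. v ^ 2 = r"]
    by (simp only: UNIV_I simp_thms finite_class.finite_UNIV True_implies_equals)
  have U: "- U a b N = {v. ?\<alpha> v = -1 \<and> ?\<beta> v = -1}"
    unfolding U_def H_eq[OF l a(1) N] H_eq[OF l a(2) N] p_def r_def by auto
  have ind: "(if v \<in> - U a b N then 4 else 0) = (1 - ?\<alpha> v) * (1 - ?\<beta> v)
     - (if v ^ 2 = p then 1 - ?\<beta> v else 0) - (if v ^ 2 = r then 1 - ?\<alpha> v else 0)" for v
  proof -
    have "?\<alpha> v = 0 \<longleftrightarrow> v ^ 2 = p" "?\<beta> v = 0 \<longleftrightarrow> v ^ 2 = r" by (simp_all add: chi_eq_0_iff)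
    then show ?thesis
      using chi_range[of "v ^ 2 - p"] chi_range[of "v ^ 2 - r"] \<open>p \<noteq> r\<close> unfolding U by auto
  qed
  have "4 * int (card (- U a b N)) = (\<Sum>v\<in>UNIV. if v \<in> - U a b N then 4 else 0)"
    by (simp add: sum.If_cases Compl_eq)
  also have "\<dots> = (\<Sum>v\<in>UNIV. (1 - ?\<alpha> v) * (1 - ?\<beta> v)) - e"
    unfolding ind sum_subtractf e_if by simp
  also have "(\<Sum>v\<in>UNIV. (1 - ?\<alpha> v) * (1 - ?\<beta> v)) =
      int CARD('l) - (\<Sum>v\<in>UNIV. ?\<alpha> v) - (\<Sum>v\<in>UNIV. ?\<beta> v) + (\<Sum>v\<in>UNIV. ?\<alpha> v * ?\<beta> v)"
    by (simp add: algebra_simps sum.distrib sum_subtractf)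
  also have "(\<Sum>v\<in>UNIV. ?\<alpha> v * ?\<beta> v) = K p r" unfolding K_def by (simp only: chi_mult[OF l])
  also have "(\<Sum>v\<in>UNIV. ?\<alpha> v) = -1" by (rule sum_chi_quadratic[OF l ab pr(1)])
  also have "(\<Sum>v\<in>UNIV. ?\<beta> v) = -1" by (rule sum_chi_quadratic[OF l ab pr(2)])
  finally have comp: "4 * int (card (- U a b N)) = int CARD('l) + 2 + K p r - e" by simp
  have "card (- U a b N) = CARD('l mod_ring) - card (U a b N)"
    by (simp add: Compl_eq_Diff_UNIV card_Diff_subset)
  moreover have "card (U a b N) \<le> CARD('l mod_ring)" by (rule card_mono) auto
  ultimately have "4 * int (card (U a b N)) - 3 * int CARD('l) = (e - 1) - (K p r + 1)"
    using comp by simp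
  moreover have "0 \<le> e \<and> e \<le> 4"
  proof -
    have b: "0 \<le> 1 - chi x \<and> 1 - chi x \<le> 2" for x :: "'l mod_ring" using chi_range[of x] by auto
    have "int (card {v. v ^ 2 = p}) + int (card {v. v ^ 2 = r}) = 2 + (chi p + chi r)"
      by (simp add: card_square_roots[OF l])
    also have "chi p + chi r = 0" using chi_pr chi_range[of p] chi_range[of r] by auto
    finally have "card {v. v ^ 2 = p} + card {v. v ^ 2 = r} = 2" by simp
    moreover have "(\<Sum>v | v ^ 2 = p. 1 - ?\<beta> v) \<le> int (card {v. v ^ 2 = p}) * 2"
      by (rule sum_bounded_above) (use b in auto)
    moreover have "(\<Sum>v | v ^ 2 = r. 1 - ?\<alpha> v) \<le> int (card {v. v ^ 2 = r}) * 2"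
      by (rule sum_bounded_above) (use b in auto)
    moreover have "0 \<le> (\<Sum>v | v ^ 2 = p. 1 - ?\<beta> v)" "0 \<le> (\<Sum>v | v ^ 2 = r. 1 - ?\<alpha> v)"
      by (intro sum_nonneg; use b in auto)+
    ultimately show ?thesis unfolding e_def by linarith
  qed
  ultimately show ?thesis unfolding p_def r_def by linarith
qed

text \<open>
  If the generator were a square, every power of it would be one, and so would \<open>c\<close>.
\<close>

lemma primitive_root_nonresidue:
  fixes \<gamma> c :: "'l::prime_card mod_ring"
  assumes \<gamma>: "primitive_root \<gamma>" and c: "chi c = -1"
  shows "chi \<gamma> = -1"
proof -
  have c0: "c \<noteq> 0" using c chi_eq_0_iff[of c] by auto
  have "\<gamma> ^ 1 \<in> UNIV - {0}" using \<gamma> unfolding primitive_root_def by blast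
  then have "\<gamma> \<noteq> 0" by simp
  moreover have "chi \<gamma> \<noteq> 1"
  proof
    assume "chi \<gamma> = 1"
    then obtain y where y: "y ^ 2 = \<gamma>" using chi_eq_1_iff by blast
    have "c \<in> range (\<lambda>i::nat. \<gamma> ^ i)" using \<gamma> c0 unfolding primitive_root_def by blast
    then obtain i where "c = (y ^ 2) ^ i" using y by blast
    then have "c = (y ^ i) ^ 2" by (metis power_mult mult.commute)
    then have "chi c = 1" using c0 unfolding chi_eq_1_iff by blast
    then show False using c by simp
  qed
  ultimately show ?thesis using chi_range[of \<gamma>] chi_eq_0_iff[of \<gamma>] by auto
qed

lemma K_tail:
  fixes c :: "'l::prime_card mod_ring" and \<mu> :: real
  assumes l: "CARD('l) > 2" and c: "chi c = -1" and \<mu>: "\<mu> > 0"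
  shows "1 / (real CARD('l) - 1) *
      real (card {A :: 'l mod_ring. A \<noteq> 0 \<and> \<bar>real_of_int (K A (c * A)) + 1\<bar> \<ge> \<mu> * sqrt (real CARD('l))})
    \<le> 4 / \<mu> ^ 2"
proof (rule tail_bound[OF \<mu>])
  fix A :: "'l mod_ring"
  assume "A \<noteq> 0" "\<bar>real_of_int (K A (c * A)) + 1\<bar> \<ge> \<mu> * sqrt (real CARD('l))"
  then have "\<mu> * sqrt (real CARD('l)) \<le> 2 * sqrt (real CARD('l))" using K_abs_bound[OF l c, of A] by linarith
  then show "\<mu> \<le> 2" using l by (simp add: mult_le_cancel_right)
qed

lemma U_tail:
  fixes c \<gamma> :: "'l::prime_card mod_ring" and \<mu> :: real
  assumes l: "CARD('l) > 2" and c: "chi c = -1" and \<gamma>: "primitive_root \<gamma>" and \<mu>: "\<mu> > 0"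
  shows "1 / (real CARD('l) - 1) *
      real (card {N :: 'l mod_ring. N \<noteq> 0 \<and>
        \<bar>real (card (U \<gamma> (\<gamma> ^ 2) N)) - 3 * real CARD('l) / 4\<bar> \<ge> (\<mu> * sqrt (real CARD('l)) + 3) / 4})
    \<le> 4 / \<mu> ^ 2"
proof (rule tail_bound[OF \<mu>])
  fix N :: "'l mod_ring"
  assume N: "N \<noteq> 0" and big: "\<bar>real (card (U \<gamma> (\<gamma> ^ 2) N)) - 3 * real CARD('l) / 4\<bar> \<ge> (\<mu> * sqrt (real CARD('l)) + 3) / 4"
  have g: "chi \<gamma> = -1" by (rule primitive_root_nonresidue[OF \<gamma> c])
  then have g0: "\<gamma> \<noteq> 0" using chi_eq_0_iff[of \<gamma>] by auto
  have "\<gamma> * \<gamma> ^ 2 = \<gamma> ^ 2 * \<gamma>" by (simp add: mult.commute)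
  then have gg: "chi (\<gamma> * \<gamma> ^ 2) = -1" using g chi_power2[OF g0] chi_mult[OF l, of \<gamma> "\<gamma> ^ 2"] by simp
  let ?A = "4 * \<gamma> * N"
  have A: "?A \<noteq> 0" using N g0 four_neq_0_mod_ring[OF l] by simp
  have AA: "4 * \<gamma> ^ 2 * N = \<gamma> * ?A" by (simp add: power2_eq_square mult_ac)
  have "\<bar>4 * int (card (U \<gamma> (\<gamma> ^ 2) N)) - 3 * int CARD('l)\<bar> \<le> \<bar>K ?A (\<gamma> * ?A) + 1\<bar> + 3"
    using card_U[OF l gg N] unfolding AA .
  then have "real_of_int \<bar>4 * int (card (U \<gamma> (\<gamma> ^ 2) N)) - 3 * int CARD('l)\<bar> \<le> real_of_int (\<bar>K ?A (\<gamma> * ?A) + 1\<bar> + 3)"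
    by (simp only: of_int_le_iff)
  then have "\<bar>4 * real (card (U \<gamma> (\<gamma> ^ 2) N)) - 3 * real CARD('l)\<bar> \<le> \<bar>real_of_int (K ?A (\<gamma> * ?A)) + 1\<bar> + 3"
    by simp
  moreover have "\<bar>real_of_int (K ?A (\<gamma> * ?A)) + 1\<bar> \<le> 2 * sqrt (real CARD('l))"
    by (rule K_abs_bound[OF l g A])
  moreover have "\<mu> * sqrt (real CARD('l)) + 3 \<le> \<bar>4 * real (card (U \<gamma> (\<gamma> ^ 2) N)) - 3 * real CARD('l)\<bar>"
    using big by (simp add: abs_if split: if_splits)
  ultimately have "\<mu> * sqrt (real CARD('l)) \<le> 2 * sqrt (real CARD('l))" by linarith
  then show "\<mu> \<le> 2" using l by (simp add: mult_le_cancel_right)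
qed

section \<open>Evaluation of multivariate polynomials\<close>

definition mon :: "(nat \<Rightarrow> 'b::comm_ring_1) \<Rightarrow> (nat \<Rightarrow>\<^sub>0 nat) \<Rightarrow> 'b" where
  "mon x m = (\<Prod>i\<in>Poly_Mapping.keys m. x i ^ Poly_Mapping.lookup m i)"

text \<open>
  Coefficients and arguments live in different rings: forms over a field are evaluated at vectors
  over an extension of that field, such as the generic point of a variety.
\<close>

definition mev :: "('a::comm_ring_1 \<Rightarrow> 'b::comm_ring_1) \<Rightarrow> 'a mpoly \<Rightarrow> (nat \<Rightarrow> 'b) \<Rightarrow> 'b" where
  "mev h p x = (\<Sum>m\<in>Poly_Mapping.keys p. h (Poly_Mapping.lookup p m) * mon x m)"

abbreviation Const :: "'a::comm_ring_1 \<Rightarrow> 'a mpoly" where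
  "Const c \<equiv> Poly_Mapping.single 0 c"

abbreviation Var :: "nat \<Rightarrow> 'a::comm_ring_1 mpoly" where
  "Var i \<equiv> Poly_Mapping.single (Poly_Mapping.single i 1) 1"

lemma mpoly_eval_mev: "mpoly_eval p x = mev (\<lambda>a. a) p x"
  by (simp add: mpoly_eval_def mev_def mon_def)

lemma mon_superset:
  assumes "finite A" "Poly_Mapping.keys m \<subseteq> A"
  shows "mon x m = (\<Prod>i\<in>A. x i ^ Poly_Mapping.lookup m i)"
  unfolding mon_def
  by (rule prod.mono_neutral_left) (use assms in \<open>auto simp: in_keys_iff\<close>)

lemma mon_0 [simp]: "mon x 0 = 1" by (simp add: mon_def)

lemma mon_single [simp]: "mon x (Poly_Mapping.single i k) = x i ^ k"
  by (simp add: mon_def)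

lemma mon_add: "mon x (m + m') = mon x m * mon x m'"
proof -
  let ?A = "Poly_Mapping.keys m \<union> Poly_Mapping.keys m'"
  have "mon x (m + m') = (\<Prod>i\<in>?A. x i ^ Poly_Mapping.lookup (m + m') i)"
    by (rule mon_superset) (use Poly_Mapping.keys_add[of m m'] in auto)
  also have "\<dots> = (\<Prod>i\<in>?A. x i ^ Poly_Mapping.lookup m i) * (\<Prod>i\<in>?A. x i ^ Poly_Mapping.lookup m' i)"
    by (simp add: lookup_add power_add prod.distrib)
  also have "\<dots> = mon x m * mon x m'"
    using mon_superset[of ?A m x] mon_superset[of ?A m' x] by simp
  finally show ?thesis .
qed

lemma mpoly_as_sum: "(\<Sum>m\<in>Poly_Mapping.keys p. Poly_Mapping.single m (Poly_Mapping.lookup p m)) = p"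
  by (rule poly_mapping_eqI)
     (auto simp: lookup_sum lookup_single when_def in_keys_iff sum.delta)

context comm_ring_hom
begin

lemma mev_superset:
  assumes "finite A" "Poly_Mapping.keys p \<subseteq> A"
  shows "mev hom p x = (\<Sum>m\<in>A. hom (Poly_Mapping.lookup p m) * mon x m)"
  unfolding mev_def
  by (rule sum.mono_neutral_left) (use assms in \<open>auto simp: in_keys_iff\<close>)

lemma mev_0 [simp]: "mev hom 0 x = 0" by (simp add: mev_def)

lemma mev_single [simp]: "mev hom (Poly_Mapping.single m c) x = hom c * mon x m"
  by (subst mev_superset[of "{m}"]) auto

lemma mev_1 [simp]: "mev hom 1 x = 1"
  using mev_single[of 0 1] by simp

lemma mev_add: "mev hom (p + q) x = mev hom p x + mev hom q x"
proof -
  let ?A = "Poly_Mapping.keys p \<union> Poly_Mapping.keys q"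
  have "mev hom (p + q) x = (\<Sum>m\<in>?A. hom (Poly_Mapping.lookup (p + q) m) * mon x m)"
    by (rule mev_superset) (use Poly_Mapping.keys_add[of p q] in auto)
  also have "\<dots> = mev hom p x + mev hom q x"
    using mev_superset[of ?A p x] mev_superset[of ?A q x]
    by (simp add: lookup_add hom_add distrib_right sum.distrib)
  finally show ?thesis .
qed

lemma mev_uminus: "mev hom (- p) x = - mev hom p x"
  using mev_add[of "- p" p x] by (simp add: eq_neg_iff_add_eq_0)

lemma mev_diff: "mev hom (p - q) x = mev hom p x - mev hom q x"
  using mev_add[of p "- q" x] by (simp add: mev_uminus)

lemma mev_sum: "mev hom (\<Sum>i\<in>A. f i) x = (\<Sum>i\<in>A. mev hom (f i) x)"
  by (induction A rule: infinite_finite_induct) (auto simp: mev_add)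

lemma mev_mult: "mev hom (p * q) x = mev hom p x * mev hom q x"
proof -
  let ?s = "\<lambda>p m. Poly_Mapping.single m (Poly_Mapping.lookup p m)"
  have "p * q = (\<Sum>m\<in>Poly_Mapping.keys p. ?s p m) * (\<Sum>m\<in>Poly_Mapping.keys q. ?s q m)"
    by (simp only: mpoly_as_sum)
  then have "mev hom (p * q) x =
      (\<Sum>m\<in>Poly_Mapping.keys p. \<Sum>m'\<in>Poly_Mapping.keys q. mev hom (?s p m * ?s q m') x)"
    by (simp add: sum_product mev_sum)
  also have "\<dots> = (\<Sum>m\<in>Poly_Mapping.keys p. \<Sum>m'\<in>Poly_Mapping.keys q.
      (hom (Poly_Mapping.lookup p m) * mon x m) * (hom (Poly_Mapping.lookup q m') * mon x m'))"
    by (simp add: mult_single hom_mult mon_add mult_ac)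
  finally show ?thesis by (simp add: mev_def sum_product)
qed

lemma mev_power: "mev hom (p ^ k) x = mev hom p x ^ k"
  by (induction k) (auto simp: mev_mult)

lemma mev_prod: "mev hom (\<Prod>i\<in>A. f i) x = (\<Prod>i\<in>A. mev hom (f i) x)"
  by (induction A rule: infinite_finite_induct) (auto simp: mev_mult)

lemma hom_mon: "hom (mon x m) = mon (\<lambda>i. hom (x i)) m"
  by (simp add: mon_def hom_prod hom_power)

end

lemma id_comm_ring_hom: "comm_ring_hom (\<lambda>a :: 'a :: comm_ring_1. a)"
  by unfold_locales auto

lemmas id_mev = comm_ring_hom.mev_sum[OF id_comm_ring_hom] comm_ring_hom.mev_single[OF id_comm_ring_hom]
  comm_ring_hom.mev_add[OF id_comm_ring_hom] comm_ring_hom.mev_mult[OF id_comm_ring_hom]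
  comm_ring_hom.mev_diff[OF id_comm_ring_hom] comm_ring_hom.mev_1[OF id_comm_ring_hom]

lemma hom_mev:
  assumes "comm_ring_hom h" and "comm_ring_hom g"
  shows "g (mev h p x) = mev (\<lambda>a. g (h a)) p (\<lambda>i. g (x i))"
proof -
  interpret g: comm_ring_hom g by fact
  show ?thesis by (simp add: mev_def g.hom_sum g.hom_mult g.hom_mon)
qed

text \<open>
  A relation between two rings that is compatible with the ring operations is preserved by
  evaluation.  Residues at a place, congruences modulo an ideal, and the passage from polynomial
  functions on a curve to elements of its function field are instances.
\<close>

lemma mev_rel:
  assumes h: "\<And>c. R (h c) (h' c)" and R0: "R 0 0" and R1: "R 1 1"
    and add: "\<And>a b a' b'. R a a' \<Longrightarrow> R b b' \<Longrightarrow> R (a + b) (a' + b')"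
    and mult: "\<And>a b a' b'. R a a' \<Longrightarrow> R b b' \<Longrightarrow> R (a * b) (a' * b')"
    and x: "\<And>m i. m \<in> Poly_Mapping.keys p \<Longrightarrow> i \<in> Poly_Mapping.keys m \<Longrightarrow> R (x i) (x' i)"
  shows "R (mev h p x) (mev h' p x')"
proof -
  have pow: "R (a ^ k) (a' ^ k)" if "R a a'" for a a' k
  proof (induction k)
    case (Suc k)
    show ?case unfolding power_Suc by (rule mult[OF that Suc])
  qed (simp add: R1)
  have "R (\<Prod>i\<in>A. x i ^ f i) (\<Prod>i\<in>A. x' i ^ f i)" if "\<And>i. i \<in> A \<Longrightarrow> R (x i) (x' i)" for A and f :: "nat \<Rightarrow> nat"
    using that
  proof (induction A rule: infinite_finite_induct)
    case (insert i A)
    have "R (x i ^ f i * (\<Prod>i\<in>A. x i ^ f i)) (x' i ^ f i * (\<Prod>i\<in>A. x' i ^ f i))"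
      using insert by (intro mult pow) simp_all
    then show ?case using insert by simp
  qed (simp_all add: R1)
  then have mon: "R (mon x m) (mon x' m)" if "m \<in> Poly_Mapping.keys p" for m
    unfolding mon_def using x that by blast
  have "R (\<Sum>m\<in>A. h (Poly_Mapping.lookup p m) * mon x m) (\<Sum>m\<in>A. h' (Poly_Mapping.lookup p m) * mon x' m)"
    if "A \<subseteq> Poly_Mapping.keys p" for A
    using finite_subset[OF that finite_keys] that
  proof (induction A rule: finite_induct)
    case (insert m A)
    have "R (h (Poly_Mapping.lookup p m) * mon x m + (\<Sum>m\<in>A. h (Poly_Mapping.lookup p m) * mon x m))
       (h' (Poly_Mapping.lookup p m) * mon x' m + (\<Sum>m\<in>A. h' (Poly_Mapping.lookup p m) * mon x' m))"
      using insert by (intro add mult h mon) simp_all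
    then show ?case using insert by simp
  qed (simp add: R0)
  then show ?thesis unfolding mev_def by blast
qed

subsection \<open>Forms\<close>

lemma hom_poly_keys: "hom_poly n d p \<Longrightarrow> m \<in> Poly_Mapping.keys p \<Longrightarrow> i \<in> Poly_Mapping.keys m \<Longrightarrow> i \<le> n"
  by (auto simp: hom_poly_def)

lemma hom_poly_0 [simp]: "hom_poly n d 0" by (simp add: hom_poly_def)

lemma hom_poly_add: "hom_poly n d p \<Longrightarrow> hom_poly n d q \<Longrightarrow> hom_poly n d (p + q)"
  using Poly_Mapping.keys_add[of p q] by (fastforce simp: hom_poly_def)

lemma hom_poly_uminus: "hom_poly n d p \<Longrightarrow> hom_poly n d (- p)"
  by (simp add: hom_poly_def in_keys_iff)

lemma hom_poly_diff: "hom_poly n d p \<Longrightarrow> hom_poly n d q \<Longrightarrow> hom_poly n d (p - q)"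
  using hom_poly_add[of n d p "- q"] hom_poly_uminus[of n d q] by simp

lemma hom_poly_sum: "(\<And>i. i \<in> A \<Longrightarrow> hom_poly n d (f i)) \<Longrightarrow> hom_poly n d (\<Sum>i\<in>A. f i)"
  by (induction A rule: infinite_finite_induct) (auto intro: hom_poly_add)

lemma hom_poly_mult:
  assumes "hom_poly n d p" "hom_poly n e q" shows "hom_poly n (d + e) (p * q)"
  unfolding hom_poly_def
proof
  fix m assume "m \<in> Poly_Mapping.keys (p * q)"
  then obtain a b where ab: "m = a + b" "a \<in> Poly_Mapping.keys p" "b \<in> Poly_Mapping.keys q"
    using keys_mult[of p q] by blast
  then show "Poly_Mapping.keys m \<subseteq> {..n} \<and> (\<Sum>i\<le>n. Poly_Mapping.lookup m i) = d + e"
    using assms Poly_Mapping.keys_add[of a b] by (fastforce simp: hom_poly_def lookup_add sum.distrib)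
qed

lemma hom_poly_Const [simp]: "hom_poly n 0 (Const c)" by (simp add: hom_poly_def)

lemma hom_poly_1 [simp]: "hom_poly n 0 1" using hom_poly_Const[of n 1] by simp

lemma hom_poly_Var: "i \<le> n \<Longrightarrow> hom_poly n 1 (Var i)"
  by (simp add: hom_poly_def lookup_single when_def sum.delta)

lemma hom_poly_Const_mult: "hom_poly n d p \<Longrightarrow> hom_poly n d (Const c * p)"
  using hom_poly_mult[OF hom_poly_Const] by fastforce

lemma hom_poly_power: "hom_poly n d p \<Longrightarrow> hom_poly n (k * d) (p ^ k)"
  by (induction k) (auto intro: hom_poly_mult simp: hom_poly_mult)

lemma hom_poly_prod:
  "(\<And>i. i \<in> A \<Longrightarrow> hom_poly n (d i) (f i)) \<Longrightarrow> hom_poly n (\<Sum>i\<in>A. d i) (\<Prod>i\<in>A. f i)"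
  by (induction A rule: infinite_finite_induct) (auto intro: hom_poly_mult)

lemma mon_scale: "mon (\<lambda>i. c * x i) m = c ^ (\<Sum>i\<in>Poly_Mapping.keys m. Poly_Mapping.lookup m i) * mon x m"
  by (simp add: mon_def power_mult_distrib prod.distrib power_sum)

lemma hom_poly_degree_keys:
  assumes "hom_poly n d p" "m \<in> Poly_Mapping.keys p"
  shows "(\<Sum>i\<in>Poly_Mapping.keys m. Poly_Mapping.lookup m i) = d"
proof -
  have "(\<Sum>i\<in>Poly_Mapping.keys m. Poly_Mapping.lookup m i) = (\<Sum>i\<le>n. Poly_Mapping.lookup m i)"
    by (rule sum.mono_neutral_left) (use assms in \<open>auto simp: hom_poly_def in_keys_iff\<close>)
  then show ?thesis using assms by (auto simp: hom_poly_def)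
qed

lemma mev_scale:
  assumes "hom_poly n d p"
  shows "mev h p (\<lambda>i. c * x i) = c ^ d * mev h p x"
  unfolding mev_def mon_scale sum_distrib_left
  by (intro sum.cong refl) (simp add: hom_poly_degree_keys[OF assms] mult_ac)

lemma mev_cong:
  assumes "hom_poly n d p" "\<And>i. i \<le> n \<Longrightarrow> x i = y i"
  shows "mev h p x = mev h p y"
  unfolding mev_def mon_def
  by (intro sum.cong prod.cong refl arg_cong2[where f = "(*)"]) (use assms hom_poly_keys in metis)

definition msubst :: "'a::comm_ring_1 mpoly \<Rightarrow> (nat \<Rightarrow> 'a mpoly) \<Rightarrow> 'a mpoly" where
  "msubst p F = mev Const p F"

lemma mev_msubst:
  assumes "comm_ring_hom h"
  shows "mev h (msubst p F) x = mev h p (\<lambda>i. mev h (F i) x)"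
proof -
  interpret comm_ring_hom h by fact
  show ?thesis unfolding msubst_def
    by (simp add: mev_def[of Const p] mev_def[of h p] mev_sum mev_mult)
       (simp add: mon_def mev_prod mev_power)
qed

lemma hom_poly_msubst:
  assumes p: "hom_poly n d p" and F: "\<And>i. i \<le> n \<Longrightarrow> hom_poly n' e (F i)"
  shows "hom_poly n' (d * e) (msubst p F)"
  unfolding msubst_def mev_def
proof (intro hom_poly_sum hom_poly_Const_mult)
  fix m assume m: "m \<in> Poly_Mapping.keys p"
  have "hom_poly n' (\<Sum>i\<in>Poly_Mapping.keys m. Poly_Mapping.lookup m i * e) (mon F m)"
    unfolding mon_def using hom_poly_keys[OF p m] by (intro hom_poly_prod hom_poly_power F) blast
  then show "hom_poly n' (d * e) (mon F m)"
    using hom_poly_degree_keys[OF p m] by (simp add: sum_distrib_right[symmetric])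
qed

subsection \<open>Derivatives\<close>

lemma monomial_induct [consumes 1, case_names zero step]:
  fixes m :: "nat \<Rightarrow>\<^sub>0 nat"
  assumes "Poly_Mapping.keys m \<subseteq> {..n}"
    and "P 0"
    and "\<And>m j. Poly_Mapping.keys m \<subseteq> {..n} \<Longrightarrow> j \<le> n \<Longrightarrow> P m \<Longrightarrow> P (m + Poly_Mapping.single j 1)"
  shows "P m"
  using assms(1)
proof (induction "\<Sum>i\<le>n. Poly_Mapping.lookup m i" arbitrary: m)
  case 0
  then have "\<forall>i\<le>n. Poly_Mapping.lookup m i = 0" by simp
  moreover have "\<forall>i>n. Poly_Mapping.lookup m i = 0" using 0 by (metis atMost_iff in_keys_iff leD subsetD)
  ultimately have "m = 0" by (intro poly_mapping_eqI) (metis leI lookup_zero)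
  then show ?case using assms(2) by simp
next
  case (Suc k)
  then obtain j where j: "j \<le> n" "Poly_Mapping.lookup m j > 0"
    by (metis (no_types, lifting) atMost_iff gr0I sum.neutral Zero_not_Suc)
  define m' where "m' = m - Poly_Mapping.single j 1"
  have m: "m = m' + Poly_Mapping.single j 1"
    unfolding m'_def by (rule poly_mapping_eqI) (use j in \<open>auto simp: lookup_add lookup_minus lookup_single when_def\<close>)
  have "Poly_Mapping.keys m' \<subseteq> {..n}"
    using Suc.prems unfolding m'_def by (auto simp: in_keys_iff lookup_minus subset_iff)
  moreover have "(\<Sum>i\<le>n. Poly_Mapping.lookup m i) = (\<Sum>i\<le>n. Poly_Mapping.lookup m' i) + 1"
    unfolding m using j(1) by (simp add: lookup_add sum.distrib lookup_single when_def sum.delta)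
  ultimately show ?case using Suc.hyps assms(3)[of m' j] j m by auto
qed

text \<open>
  The \<open>i\<close>-th partial derivative of a monomial, evaluated.
\<close>

definition dmon :: "nat \<Rightarrow> (nat \<Rightarrow> 'b::comm_ring_1) \<Rightarrow> (nat \<Rightarrow>\<^sub>0 nat) \<Rightarrow> 'b" where
  "dmon i x m = of_nat (Poly_Mapping.lookup m i) * mon x (m - Poly_Mapping.single i 1)"

lemma mpoly_eval_deriv:
  "mpoly_eval (mpoly_deriv i p) x = (\<Sum>m\<in>Poly_Mapping.keys p. Poly_Mapping.lookup p m * dmon i x m)"
  unfolding mpoly_eval_mev mpoly_deriv_def id_mev dmon_def
  by (simp add: mult_ac)

lemma dmon_0 [simp]: "dmon i x 0 = 0" by (simp add: dmon_def)

lemma mon_minus_single: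
  assumes "Poly_Mapping.lookup m i > 0"
  shows "x i * mon x (m - Poly_Mapping.single i 1) = mon x m"
proof -
  have "m = (m - Poly_Mapping.single i 1) + Poly_Mapping.single i 1"
    by (rule poly_mapping_eqI) (use assms in \<open>auto simp: lookup_add lookup_minus lookup_single when_def\<close>)
  then show ?thesis by (metis mon_add mon_single mult.commute power_one_right)
qed

lemma lookup_times_mon_minus_single:
  "x i * (of_nat (Poly_Mapping.lookup m i) * mon x (m - Poly_Mapping.single i 1)) =
     of_nat (Poly_Mapping.lookup m i) * mon x m"
proof (cases "Poly_Mapping.lookup m i = 0")
  case False
  then have "x i * mon x (m - Poly_Mapping.single i 1) = mon x m" by (intro mon_minus_single) simp
  then show ?thesis by (metis mult.left_commute)
qed simp

lemma dmon_step:
  "dmon i x (m + Poly_Mapping.single j 1) = dmon i x m * x j + (if i = j then mon x m else 0)"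
proof (cases "i = j")
  case True
  have 1: "m + Poly_Mapping.single j 1 - Poly_Mapping.single j 1 = m"
    by (rule poly_mapping_eqI) (auto simp: lookup_add lookup_minus)
  have 2: "of_nat (Poly_Mapping.lookup m j) * mon x (m - Poly_Mapping.single j 1) * x j =
     of_nat (Poly_Mapping.lookup m j) * mon x m"
    using lookup_times_mon_minus_single[of x j m] by (metis mult.commute)
  show ?thesis using True 2 unfolding dmon_def
    by (simp add: 1[simplified] lookup_add algebra_simps)
next
  case False
  show ?thesis
  proof (cases "Poly_Mapping.lookup m i")
    case 0
    then show ?thesis using False by (simp add: dmon_def lookup_add lookup_single_not_eq)
  next
    case (Suc k)
    have "m + Poly_Mapping.single j 1 - Poly_Mapping.single i 1 = (m - Poly_Mapping.single i 1) + Poly_Mapping.single j 1"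
      by (rule poly_mapping_eqI) (use Suc False in \<open>auto simp: lookup_add lookup_minus lookup_single when_def\<close>)
    then show ?thesis using False
      by (simp add: dmon_def lookup_add lookup_single_not_eq mon_add mult_ac)
  qed
qed

lemma euler_identity:
  assumes "hom_poly n d p"
  shows "(\<Sum>i\<le>n. x i * mpoly_eval (mpoly_deriv i p) x) = of_nat d * mpoly_eval p x"
proof -
  have mon: "(\<Sum>i\<le>n. x i * dmon i x m) = of_nat d * mon x m" if "m \<in> Poly_Mapping.keys p" for m
  proof -
    have "x i * dmon i x m = of_nat (Poly_Mapping.lookup m i) * mon x m" for i
      unfolding dmon_def by (rule lookup_times_mon_minus_single)
    then have "(\<Sum>i\<le>n. x i * dmon i x m) = of_nat (\<Sum>i\<le>n. Poly_Mapping.lookup m i) * mon x m"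
      by (simp add: sum_distrib_right)
    also have "(\<Sum>i\<le>n. Poly_Mapping.lookup m i) = d" using assms that by (auto simp: hom_poly_def)
    finally show ?thesis .
  qed
  have "(\<Sum>i\<le>n. x i * mpoly_eval (mpoly_deriv i p) x) =
      (\<Sum>i\<le>n. \<Sum>m\<in>Poly_Mapping.keys p. Poly_Mapping.lookup p m * (x i * dmon i x m))"
    unfolding mpoly_eval_deriv by (simp add: sum_distrib_left mult_ac)
  also have "\<dots> = (\<Sum>m\<in>Poly_Mapping.keys p. Poly_Mapping.lookup p m * (\<Sum>i\<le>n. x i * dmon i x m))"
    by (subst sum.swap) (simp add: sum_distrib_left)
  also have "\<dots> = (\<Sum>m\<in>Poly_Mapping.keys p. Poly_Mapping.lookup p m * (of_nat d * mon x m))"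
    by (intro sum.cong refl) (simp add: mon)
  also have "\<dots> = of_nat d * mpoly_eval p x"
    unfolding mpoly_eval_mev mev_def by (simp add: sum_distrib_left mult_ac)
  finally show ?thesis .
qed

text \<open>
  Modulo products of two increments a form is its linear Taylor polynomial; by induction on the
  monomials, this holds in every characteristic.  \<open>R\<close> plays the part of a local ring and \<open>I\<close> that
  of the square of its maximal ideal.
\<close>

lemma taylor_first_order:
  fixes h :: "'a::comm_ring_1 \<Rightarrow> 'b::comm_ring_1"
  assumes hom: "comm_ring_hom h" and p: "hom_poly n d p"
    and I0: "0 \<in> I" and Iadd: "\<And>a b. a \<in> I \<Longrightarrow> b \<in> I \<Longrightarrow> a + b \<in> I"
    and Imult: "\<And>a b. a \<in> I \<Longrightarrow> b \<in> R \<Longrightarrow> a * b \<in> I"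
    and Rh: "\<And>c. h c \<in> R" and Rz: "\<And>i. i \<le> n \<Longrightarrow> h (q i) + z i \<in> R"
    and zz: "\<And>i j. i \<le> n \<Longrightarrow> j \<le> n \<Longrightarrow> z i * z j \<in> I"
  shows "mev h p (\<lambda>i. h (q i) + z i) - h (mpoly_eval p q)
           - (\<Sum>i\<le>n. h (mpoly_eval (mpoly_deriv i p) q) * z i) \<in> I"
proof -
  interpret comm_ring_hom h by fact
  have Isum: "sum f A \<in> I" if "\<And>i. i \<in> A \<Longrightarrow> f i \<in> I" for f and A :: "'c set"
    using that by (induction A rule: infinite_finite_induct) (auto intro: I0 Iadd)
  define \<Delta> where "\<Delta> m = mon (\<lambda>i. h (q i) + z i) m - h (mon q m) - (\<Sum>i\<le>n. h (dmon i q m) * z i)" for m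
  have \<Delta>: "\<Delta> m \<in> I" if "Poly_Mapping.keys m \<subseteq> {..n}" for m
    using that
  proof (induction m rule: monomial_induct)
    case zero
    then show ?case by (simp add: \<Delta>_def I0)
  next
    case (step m j)
    have "(\<Sum>i\<le>n. h (dmon i q (m + Poly_Mapping.single j 1)) * z i) =
        (\<Sum>i\<le>n. h (dmon i q m) * z i) * h (q j) + (\<Sum>i\<le>n. if i = j then h (mon q m) * z i else 0)"
    proof -
      have "h (dmon i q (m + Poly_Mapping.single j 1)) * z i =
          h (dmon i q m) * z i * h (q j) + (if i = j then h (mon q m) * z i else 0)" for i
        unfolding dmon_step by (simp add: hom_add hom_mult algebra_simps)
      then show ?thesis by (simp add: sum.distrib sum_distrib_right)
    qed
    also have "(\<Sum>i\<le>n. if i = j then h (mon q m) * z i else 0) = h (mon q m) * z j"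
      using step.hyps(2) by (simp add: sum.delta)
    finally have "\<Delta> (m + Poly_Mapping.single j 1) =
        \<Delta> m * (h (q j) + z j) + (\<Sum>i\<le>n. h (dmon i q m) * z i) * z j"
      unfolding \<Delta>_def mon_add by (simp add: hom_mult algebra_simps)
    also have "(\<Sum>i\<le>n. h (dmon i q m) * z i) * z j = (\<Sum>i\<le>n. (z i * z j) * h (dmon i q m))"
      by (simp add: sum_distrib_left mult_ac)
    also have "\<Delta> m * (h (q j) + z j) + \<dots> \<in> I"
      using step by (intro Iadd Imult Isum Rh Rz zz) auto
    finally show ?case .
  qed
  have "mev h p (\<lambda>i. h (q i) + z i) - h (mpoly_eval p q)
           - (\<Sum>i\<le>n. h (mpoly_eval (mpoly_deriv i p) q) * z i) =
        (\<Sum>m\<in>Poly_Mapping.keys p. \<Delta> m * h (Poly_Mapping.lookup p m))"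
  proof -
    have "(\<Sum>i\<le>n. h (mpoly_eval (mpoly_deriv i p) q) * z i) =
       (\<Sum>m\<in>Poly_Mapping.keys p. h (Poly_Mapping.lookup p m) * (\<Sum>i\<le>n. h (dmon i q m) * z i))"
      unfolding mpoly_eval_deriv
      by (simp add: hom_sum hom_mult sum_distrib_left sum_distrib_right mult_ac)
         (rule sum.swap)
    then show ?thesis
      by (simp add: mpoly_eval_mev mev_def hom_sum hom_mult \<Delta>_def algebra_simps sum_subtractf sum.distrib)
  qed
  also have "\<dots> \<in> I" using \<Delta> p by (intro Isum Imult Rh) (auto simp: hom_poly_def)
  finally show ?thesis .
qed

section \<open>Points of projective space\<close>

lemma proj_pt_self: "x \<in> proj_pt x"
  by (auto simp: proj_pt_def intro: exI[of _ 1])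

lemma proj_pt_eq: "y \<in> proj_pt x \<Longrightarrow> proj_pt y = proj_pt x"
proof -
  assume "y \<in> proj_pt x"
  then obtain a where a: "a \<noteq> 0" "y = (\<lambda>i. a * x i)" by (auto simp: proj_pt_def)
  show ?thesis
  proof (intro Set.set_eqI iffI)
    fix z assume "z \<in> proj_pt y"
    then obtain b where "b \<noteq> 0" "z = (\<lambda>i. b * y i)" by (auto simp: proj_pt_def)
    then show "z \<in> proj_pt x" using a unfolding proj_pt_def by (intro CollectI exI[of _ "b * a"]) (simp add: mult.assoc)
  next
    fix z assume "z \<in> proj_pt x"
    then obtain b where "b \<noteq> 0" "z = (\<lambda>i. b * x i)" by (auto simp: proj_pt_def)
    then show "z \<in> proj_pt y" using a unfolding proj_pt_def by (intro CollectI exI[of _ "b / a"]) simp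
  qed
qed

lemma proj_pt_scale: "c \<noteq> 0 \<Longrightarrow> proj_pt (\<lambda>i. c * x i) = proj_pt x"
  by (rule proj_pt_eq) (auto simp: proj_pt_def)

lemma proj_space_E:
  assumes "P \<in> proj_space n" "x \<in> P"
  shows "P = proj_pt x" "\<And>i. i > n \<Longrightarrow> x i = 0" "\<exists>i\<le>n. x i \<noteq> 0"
proof -
  obtain y where y: "P = proj_pt y" "\<forall>i>n. y i = 0" "\<exists>i\<le>n. y i \<noteq> 0" using assms by (auto simp: proj_space_def)
  then show "P = proj_pt x" using assms proj_pt_eq by blast
  obtain a where "a \<noteq> 0" "x = (\<lambda>i. a * y i)" using assms y by (auto simp: proj_pt_def)
  then show "\<And>i. i > n \<Longrightarrow> x i = 0" "\<exists>i\<le>n. x i \<noteq> 0" using y by auto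
qed

lemma proj_pt_in_proj_space: "(\<And>i. i > n \<Longrightarrow> x i = 0) \<Longrightarrow> i \<le> n \<Longrightarrow> x i \<noteq> 0 \<Longrightarrow> proj_pt x \<in> proj_space n"
  by (auto simp: proj_space_def)

lemma mpoly_eval_scale: "hom_poly n d f \<Longrightarrow> mpoly_eval f (\<lambda>i. c * x i) = c ^ d * mpoly_eval f x"
  unfolding mpoly_eval_mev by (rule mev_scale)

lemma vanishes_at_proj_pt:
  fixes x :: "nat \<Rightarrow> 'a::field"
  assumes "hom_poly n d f" shows "vanishes_at f (proj_pt x) \<longleftrightarrow> mpoly_eval f x = 0"
proof
  assume "vanishes_at f (proj_pt x)"
  then show "mpoly_eval f x = 0" using proj_pt_self by (auto simp: vanishes_at_def)
next
  assume "mpoly_eval f x = 0"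
  then show "vanishes_at f (proj_pt x)"
    by (auto simp: vanishes_at_def proj_pt_def mpoly_eval_scale[OF assms])
qed

section \<open>Places\<close>

text \<open>
  \<open>res a r\<close> states that \<open>a\<close> is regular with value \<open>r\<close>.  The regular elements form a local ring
  inside the field \<open>F\<close> with residue field \<open>'a\<close>, and \<open>res a 0\<close> describes its maximal ideal.  Encoding
  the ring together with its residue map as one relation makes the equality of two places an
  equality of relations.
\<close>

locale place =
  fixes \<iota> :: "'a::field \<Rightarrow> 'm::field" and F :: "'m set" and res :: "'m \<Rightarrow> 'a \<Rightarrow> bool"
  assumes hom: "comm_ring_hom \<iota>"
    and functional: "res a r \<Longrightarrow> res a r' \<Longrightarrow> r = r'"
    and const: "res (\<iota> c) c"
    and add: "res a r \<Longrightarrow> res b s \<Longrightarrow> res (a + b) (r + s)"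
    and mult: "res a r \<Longrightarrow> res b s \<Longrightarrow> res (a * b) (r * s)"
    and inverse: "res a r \<Longrightarrow> r \<noteq> 0 \<Longrightarrow> res (inverse a) (inverse r)"
    and in_field: "res a r \<Longrightarrow> a \<in> F"
begin

sublocale \<iota>: comm_ring_hom \<iota> by (rule hom)

definition "regular a \<longleftrightarrow> (\<exists>r. res a r)"

lemma res_0: "res 0 0" and res_1: "res 1 1"
  using const[of 0] const[of 1] by simp_all

lemma neg: "res a r \<Longrightarrow> res (- a) (- r)"
  using mult[OF const[of "-1"], of a r] by (simp add: \<iota>.hom_uminus)

lemma diff: "res a r \<Longrightarrow> res b s \<Longrightarrow> res (a - b) (r - s)"
  using add[OF _ neg] by (metis diff_conv_add_uminus)

lemma res_power: "res a r \<Longrightarrow> res (a ^ k) (r ^ k)"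
  by (induction k) (auto intro: mult res_1)

lemma res_sum: "(\<And>i. i \<in> A \<Longrightarrow> res (f i) (g i)) \<Longrightarrow> res (\<Sum>i\<in>A. f i) (\<Sum>i\<in>A. g i)"
  by (induction A rule: infinite_finite_induct) (auto intro: add res_0)

lemma regularI: "res a r \<Longrightarrow> regular a"
  by (auto simp: regular_def)

lemma regular_const: "regular (\<iota> c)" and regular_0: "regular 0" and regular_1: "regular 1"
  by (rule regularI[OF const], rule regularI[OF res_0], rule regularI[OF res_1])

lemma regular_add: "regular a \<Longrightarrow> regular b \<Longrightarrow> regular (a + b)"
  unfolding regular_def by (elim exE) (rule exI, erule (1) add)

lemma regular_mult: "regular a \<Longrightarrow> regular b \<Longrightarrow> regular (a * b)"
  unfolding regular_def by (elim exE) (rule exI, erule (1) mult)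

lemma regular_neg: "regular a \<Longrightarrow> regular (- a)"
  unfolding regular_def by (elim exE) (rule exI, erule neg)

lemma regular_sum: "(\<And>i. i \<in> A \<Longrightarrow> regular (f i)) \<Longrightarrow> regular (\<Sum>i\<in>A. f i)"
  by (induction A rule: infinite_finite_induct) (auto intro: regular_add regular_0)

lemma max_ideal_mult: "res a 0 \<Longrightarrow> regular b \<Longrightarrow> res (a * b) 0"
  unfolding regular_def using mult by fastforce

lemma max_ideal_mult_left: "res a 0 \<Longrightarrow> regular b \<Longrightarrow> res (b * a) 0"
  using max_ideal_mult by (simp add: mult.commute)

lemma max_ideal_sum: "(\<And>i. i \<in> A \<Longrightarrow> res (f i) 0) \<Longrightarrow> res (\<Sum>i\<in>A. f i) 0"
  using res_sum[of A f "\<lambda>_. 0"] by simp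

lemma not_res_1_0: "\<not> res 1 0" using functional res_1 by fastforce

lemma res_neq_0: "res a r \<Longrightarrow> r \<noteq> 0 \<Longrightarrow> a \<noteq> 0" using functional res_0 by blast

lemma res_mev:
  assumes "\<And>m i. m \<in> Poly_Mapping.keys p \<Longrightarrow> i \<in> Poly_Mapping.keys m \<Longrightarrow> res (x i) (y i)"
  shows "res (mev \<iota> p x) (mpoly_eval p y)"
  unfolding mpoly_eval_mev
  by (rule mev_rel[where R = res]) (fact const res_0 res_1 add mult assms | erule (1) add mult assms)+

text \<open>
  If the \<open>z i\<close> are multiples of \<open>t\<close> modulo \<open>\<mm>\<close> times the span of the \<open>z k\<close>, then they are multiples of
  \<open>t\<close>.  The equation of one \<open>z x\<close> can be solved for it, since \<open>1 - c x\<close> is a unit, and eliminates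
  it from the others.
\<close>

lemma nakayama:
  assumes "finite I"
    and "\<And>i. i \<in> I \<Longrightarrow> \<exists>u c. regular u \<and> (\<forall>k\<in>I. res (c k) 0) \<and> z i = u * t + (\<Sum>k\<in>I. c k * z k)"
    and "i \<in> I"
  shows "\<exists>u. regular u \<and> z i = u * t"
  using assms
proof (induction I arbitrary: i rule: finite_induct)
  case (insert x I)
  obtain u c where uc: "regular u" "\<forall>k\<in>insert x I. res (c k) 0" "z x = u * t + (\<Sum>k\<in>insert x I. c k * z k)"
    using insert.prems(1)[of x] by auto
  \<comment> \<open>the inverse of a unit, as \<open>c x\<close> lies in the maximal ideal\<close>
  define v where "v = inverse (1 - c x)"
  have "res (1 - c x) 1" using diff[OF res_1] uc(2) by fastforce
  then have v: "regular v" "(1 - c x) * v = 1"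
    unfolding v_def regular_def using inverse res_neq_0 by (fastforce, fastforce)
  have "(1 - c x) * z x = u * t + (\<Sum>k\<in>I. c k * z k)"
    using uc(3) insert.hyps by (simp add: algebra_simps)
  then have "v * ((1 - c x) * z x) = v * (u * t + (\<Sum>k\<in>I. c k * z k))" by simp
  moreover have "v * ((1 - c x) * z x) = z x" using v(2) by (metis mult.assoc mult.commute mult_1)
  ultimately have zx: "z x = (v * u) * t + (\<Sum>k\<in>I. v * c k * z k)"
    by (simp add: distrib_left sum_distrib_left mult.assoc)
  have small: "\<exists>u. regular u \<and> z i = u * t" if "i \<in> I" for i
  proof (rule insert.IH[OF _ that])
    fix i assume "i \<in> I"
    then obtain u' c' where *: "regular u'" "\<forall>k\<in>insert x I. res (c' k) 0"
       "z i = u' * t + (\<Sum>k\<in>insert x I. c' k * z k)"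
      using insert.prems(1)[of i] by auto
    have "z i = u' * t + c' x * ((v * u) * t + (\<Sum>k\<in>I. v * c k * z k)) + (\<Sum>k\<in>I. c' k * z k)"
      using *(3) insert.hyps zx by (simp add: add.assoc)
    also have "\<dots> = (u' + c' x * (v * u)) * t + (\<Sum>k\<in>I. (c' x * (v * c k) + c' k) * z k)"
      by (simp add: algebra_simps sum_distrib_left sum.distrib)
    finally have "z i = (u' + c' x * (v * u)) * t + (\<Sum>k\<in>I. (c' x * (v * c k) + c' k) * z k)" .
    moreover have "regular (u' + c' x * (v * u))"
      using * v uc by (intro regular_add regular_mult) (auto simp: regular_def)
    moreover have "res (c' x * (v * c k) + c' k) 0" if "k \<in> I" for k
    proof -
      have "res (c' x * (v * c k)) 0" using *(2) v uc that by (intro max_ideal_mult regular_mult) (auto simp: regular_def)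
      then show ?thesis using add *(2) that by fastforce
    qed
    ultimately show "\<exists>u c. regular u \<and> (\<forall>k\<in>I. res (c k) 0) \<and> z i = u * t + (\<Sum>k\<in>I. c k * z k)"
      by (intro exI[of _ "u' + c' x * (v * u)"] exI[of _ "\<lambda>k. c' x * (v * c k) + c' k"]) blast
  qed
  show ?case
  proof (cases "i = x")
    case True
    obtain w where w: "\<And>i. i \<in> I \<Longrightarrow> regular (w i)" "\<And>i. i \<in> I \<Longrightarrow> z i = w i * t" using small by metis
    have "z x = (v * u) * t + (\<Sum>k\<in>I. v * c k * (w k * t))"
      unfolding zx using w(2) by simp
    also have "\<dots> = (v * u + (\<Sum>k\<in>I. v * c k * w k)) * t"
      by (simp add: distrib_right sum_distrib_right mult.assoc)
    finally have "z x = (v * u + (\<Sum>k\<in>I. v * c k * w k)) * t" .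
    moreover have "regular (v * u + (\<Sum>k\<in>I. v * c k * w k))"
      using v uc w by (intro regular_add regular_mult regular_sum) (auto simp: regular_def)
    ultimately show ?thesis using True by blast
  next
    case False
    then show ?thesis using small insert.prems by auto
  qed
qed simp

definition valuation :: bool where
  "valuation \<longleftrightarrow> (\<forall>a\<in>F. regular a \<or> regular (inverse a))"

lemma regular_poly: "regular a \<Longrightarrow> regular (poly (map_poly \<iota> p) a)"
proof (induction p)
  case (pCons c p)
  then show ?case
    by (cases "p = 0") (auto simp: \<iota>.map_poly_pCons_hom intro!: regular_add regular_mult regular_const)
qed (simp add: regular_0)

lemma regular_poly2:
  "regular a \<Longrightarrow> regular b \<Longrightarrow> regular (poly (map_poly (\<lambda>p. poly (map_poly \<iota> p) b) P) a)"
proof (induction P)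
  case (pCons p P)
  have "map_poly (\<lambda>p. poly (map_poly \<iota> p) b) (pCons p P) =
      pCons (poly (map_poly \<iota> p) b) (map_poly (\<lambda>p. poly (map_poly \<iota> p) b) P)"
    by (rule Polynomial.map_poly_pCons) simp
  then show ?case using pCons
    by (auto intro!: regular_add regular_mult regular_poly)
qed (simp add: regular_0)

text \<open>
  The lowest nonzero coefficient of \<open>p\<close> is the residue of the cofactor \<open>u\<close>.
\<close>

lemma poly_at_uniformizer:
  assumes t: "res t 0" and p: "p \<noteq> 0"
  shows "\<exists>k u r. res u r \<and> r \<noteq> 0 \<and> poly (map_poly \<iota> p) t = t ^ k * u"
  using p
proof (induction p)
  case (pCons c p)
  have reg: "regular (poly (map_poly \<iota> p) t)" using t regular_poly by (auto simp: regular_def)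
  show ?case
  proof (cases "c = 0")
    case False
    have "res (\<iota> c + t * poly (map_poly \<iota> p) t) (c + 0)"
      using const max_ideal_mult[OF t reg] by (intro add)
    then show ?thesis using False
      by (intro exI[of _ 0] exI[of _ "\<iota> c + t * poly (map_poly \<iota> p) t"] exI[of _ c])
         (simp add: \<iota>.map_poly_pCons_hom)
  next
    case True
    then have "p \<noteq> 0" using pCons by auto
    then obtain k u r where "res u r" "r \<noteq> 0" "poly (map_poly \<iota> p) t = t ^ k * u" using pCons by blast
    then show ?thesis using True
      by (intro exI[of _ "Suc k"] exI[of _ u] exI[of _ r]) (simp add: \<iota>.map_poly_pCons_hom mult.assoc)
  qed
qed simp

text \<open>
  An algebraic relation between \<open>f\<close> and \<open>t\<close> may be divided by powers of \<open>f\<close> until its constant term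
  in \<open>f\<close> is a nonzero polynomial in \<open>t\<close>.
\<close>

lemma relation_with_constant_term:
  fixes P :: "'a poly poly"
  assumes "P \<noteq> 0" "f \<noteq> 0" "poly (map_poly (\<lambda>p. poly (map_poly \<iota> p) t) P) f = 0"
  shows "\<exists>p Q. p \<noteq> 0 \<and> poly (map_poly \<iota> p) t + f * poly (map_poly (\<lambda>p. poly (map_poly \<iota> p) t) Q) f = 0"
  using assms
proof (induction P)
  case (pCons p P)
  have *: "map_poly (\<lambda>p. poly (map_poly \<iota> p) t) (pCons p P) =
      pCons (poly (map_poly \<iota> p) t) (map_poly (\<lambda>p. poly (map_poly \<iota> p) t) P)"
    by (rule Polynomial.map_poly_pCons) simp
  show ?case
  proof (cases "p = 0")
    case True
    then show ?thesis using pCons * by auto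
  next
    case False
    then show ?thesis using pCons.prems * by (intro exI[of _ p] exI[of _ P]) simp
  qed
qed simp

text \<open>
  When \<open>\<mm>\<close> is generated by \<open>t\<close>, every nonzero regular \<open>f\<close> has to be shown to be a power of \<open>t\<close> times a
  unit, that is, not divisible by arbitrarily high powers of \<open>t\<close>.  This instance of Krull's
  intersection theorem holds because \<open>f\<close> satisfies an algebraic relation over \<open>t\<close> with nonzero constant
  term: \<open>f\<close> divides a nonzero polynomial in \<open>t\<close>, which is a unit times some \<open>t\<^sup>k\<close>.
\<close>

lemma valuation_if_principal:
  assumes t: "res t 0" and principal: "\<And>a. res a 0 \<Longrightarrow> \<exists>b. regular b \<and> a = t * b"
    and F: "\<And>a. a \<in> F \<Longrightarrow> \<exists>b c. regular b \<and> regular c \<and> a = b / c"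
    and dep: "\<And>a b. a \<in> F \<Longrightarrow> b \<in> F \<Longrightarrow>
      \<exists>P :: 'a poly poly. P \<noteq> 0 \<and> poly (map_poly (\<lambda>p. poly (map_poly \<iota> p) b) P) a = 0"
  shows valuation
proof -
  have unit_inv: "regular (inverse u)" if "res u r" "r \<noteq> 0" for u r
    using inverse that by (auto simp: regular_def)
  have factor: "\<exists>k u r. res u r \<and> r \<noteq> 0 \<and> f = t ^ k * u" if f: "regular f" "f \<noteq> 0" for f
  proof (cases "t = 0")
    case True
    obtain r where r: "res f r" using f by (auto simp: regular_def)
    have "r \<noteq> 0" using principal[of f] r f True by auto
    then show ?thesis using r by (intro exI[of _ 0] exI[of _ f] exI[of _ r]) simp
  next
    case False
    have "f \<in> F" "t \<in> F" using f t in_field by (auto simp: regular_def)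
    then obtain P :: "'a poly poly" where
      P: "P \<noteq> 0" "poly (map_poly (\<lambda>p. poly (map_poly \<iota> p) t) P) f = 0"
      using dep by blast
    from relation_with_constant_term[OF P(1) f(2) P(2)] obtain p Q where
      pQ: "p \<noteq> 0" "poly (map_poly \<iota> p) t + f * poly (map_poly (\<lambda>p. poly (map_poly \<iota> p) t) Q) f = 0" by blast
    obtain k u r where u: "res u r" "r \<noteq> 0" "poly (map_poly \<iota> p) t = t ^ k * u"
      using poly_at_uniformizer[OF t pQ(1)] by blast
    define w where "w = poly (map_poly (\<lambda>p. poly (map_poly \<iota> p) t) Q) f"
    have w: "regular w" unfolding w_def using f t by (intro regular_poly2) (auto simp: regular_def)
    have fw: "t ^ k * u = - (f * w)" using pQ(2) u(3) unfolding w_def by (simp add: eq_neg_iff_add_eq_0)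
    have no: "\<not> (\<exists>b. regular b \<and> f = t ^ Suc k * b)"
    proof
      assume "\<exists>b. regular b \<and> f = t ^ Suc k * b"
      then obtain b where b: "regular b" "f = t ^ Suc k * b" by blast
      have "t ^ k * u = t ^ k * (t * (- b * w))" using fw b by simp
      then have "u = t * (- b * w)" using False by (metis mult_left_cancel power_not_zero)
      moreover have "res (t * (- b * w)) 0" using b w by (intro max_ideal_mult[OF t] regular_mult regular_neg)
      ultimately show False using u functional by metis
    qed
    \<comment> \<open>the order of vanishing of \<open>f\<close>\<close>
    define e where "e = (LEAST e. \<not> (\<exists>b. regular b \<and> f = t ^ Suc e * b))"
    have e: "\<not> (\<exists>b. regular b \<and> f = t ^ Suc e * b)" unfolding e_def by (rule LeastI[of _ k]) (rule no)
    have "\<exists>b. regular b \<and> f = t ^ e * b"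
    proof (cases e)
      case 0
      then show ?thesis using f by auto
    next
      case (Suc e')
      then show ?thesis using not_less_Least[of e' "\<lambda>e. \<not> (\<exists>b. regular b \<and> f = t ^ Suc e * b)"] e_def by auto
    qed
    then obtain b s where b: "res b s" "f = t ^ e * b" by (auto simp: regular_def)
    have "s \<noteq> 0"
    proof
      assume "s = 0"
      then obtain b' where "regular b'" "b = t * b'" using principal b by blast
      then show False using e b by (auto simp: mult.assoc)
    qed
    then show ?thesis using b by blast
  qed
  show ?thesis unfolding valuation_def
  proof
    fix a assume "a \<in> F"
    then obtain b c where bc: "regular b" "regular c" "a = b / c" using F by blast
    show "regular a \<or> regular (inverse a)"
    proof (cases "b = 0 \<or> c = 0")
      case True
      then show ?thesis using bc regular_0 by auto
    next
      case False
      obtain k u r where u: "res u r" "r \<noteq> 0" "b = t ^ k * u" using factor bc False by blast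
      obtain l v s where v: "res v s" "s \<noteq> 0" "c = t ^ l * v" using factor bc False by blast
      have t0: "t ^ m \<noteq> 0" if "m \<le> k \<or> m \<le> l" for m using False u v that by (cases "t = 0") (auto simp: power_0_left split: if_splits)
      have rt: "regular (t ^ m)" for m using res_power[OF t] by (auto simp: regular_def)
      have ru: "regular u" "regular v" using u v by (auto simp: regular_def)
      show ?thesis
      proof (cases "l \<le> k")
        case True
        then have "t ^ k = t ^ l * t ^ (k - l)" by (simp add: power_add[symmetric])
        then have "a = t ^ (k - l) * u * inverse v"
          unfolding bc u(3) v(3) using t0[of l] True by (simp add: field_simps)
        then show ?thesis using rt ru unit_inv[OF v(1,2)] by (auto intro!: regular_mult)
      next
        case F: False
        then have "t ^ l = t ^ k * t ^ (l - k)" by (simp add: power_add[symmetric])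
        then have "inverse a = (t ^ k * (t ^ (l - k) * v)) / (t ^ k * u)"
          unfolding bc u(3) v(3) by (simp add: mult.assoc)
        also have "\<dots> = (t ^ (l - k) * v) / u" using t0[of k] by (intro mult_divide_mult_cancel_left) simp
        also have "\<dots> = t ^ (l - k) * v * inverse u" by (simp add: divide_inverse)
        finally have "inverse a = t ^ (l - k) * v * inverse u" .
        then show ?thesis using rt ru unit_inv[OF u(1,2)] by (auto intro!: regular_mult)
      qed
    qed
  qed
qed

end

text \<open>
  Valuation rings are maximal for domination: an element outside the ring of \<open>res2\<close> has its inverse
  in the maximal ideal of \<open>res2\<close>, hence of \<open>res1\<close>, and cannot be regular for \<open>res1\<close>.
\<close>

lemma place_domination:
  assumes "place \<iota> F res1" "place \<iota> F res2" "place.valuation F res2"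
    and le: "\<And>a r. res2 a r \<Longrightarrow> res1 a r"
  shows "res1 = res2"
proof (intro ext iffI)
  interpret p1: place \<iota> F res1 by fact
  interpret p2: place \<iota> F res2 by fact
  fix a r assume a: "res1 a r"
  show "res2 a r"
  proof (cases "p2.regular a")
    case True
    then show ?thesis using le a p1.functional by (metis p2.regular_def)
  next
    case False
    then obtain s where s: "res2 (inverse a) s"
      using assms(3) p1.in_field[OF a] unfolding p2.valuation_def p2.regular_def by blast
    then have "s = 0" using p2.inverse[OF s] False by (auto simp: p2.regular_def)
    moreover have "a \<noteq> 0" using False p2.regular_0 by auto
    ultimately have "res1 1 0" using p1.mult[OF a le[OF s]] by simp
    then show ?thesis using p1.not_res_1_0 by blast
  qed
qed (rule le)

section \<open>Local rings of a projective variety\<close>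

text \<open>
  \<open>\<eta>\<close> is a generic point of a variety over a big field, so that quotients of forms of equal degree
  at \<open>\<eta>\<close> are rational functions on the variety; this is evaluation of those that are defined at \<open>q\<close>.
\<close>

definition place_of ::
  "('a::field \<Rightarrow> 'm::field) \<Rightarrow> nat \<Rightarrow> (nat \<Rightarrow> 'm) \<Rightarrow> (nat \<Rightarrow> 'a) \<Rightarrow> 'm \<Rightarrow> 'a \<Rightarrow> bool" where
  "place_of \<iota> n \<eta> q a r \<longleftrightarrow> (\<exists>d A B. hom_poly n d A \<and> hom_poly n d B \<and> mpoly_eval B q \<noteq> 0 \<and>
     a = mev \<iota> A \<eta> / mev \<iota> B \<eta> \<and> r = mpoly_eval A q / mpoly_eval B q)"

definition function_field :: "('a::field \<Rightarrow> 'm::field) \<Rightarrow> nat \<Rightarrow> (nat \<Rightarrow> 'm) \<Rightarrow> 'm set" where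
  "function_field \<iota> n \<eta> = {mev \<iota> A \<eta> / mev \<iota> B \<eta> | A B d. hom_poly n d A \<and> hom_poly n d B \<and> mev \<iota> B \<eta> \<noteq> 0}"

lemma place_ofE:
  assumes "place_of \<iota> n \<eta> q a r"
  obtains d A B where "hom_poly n d A" "hom_poly n d B" "mpoly_eval B q \<noteq> 0"
     "a = mev \<iota> A \<eta> / mev \<iota> B \<eta>" "r = mpoly_eval A q / mpoly_eval B q"
  using assms unfolding place_of_def by (elim exE conjE) (rule that)

lemma place_of_scale:
  assumes "c \<noteq> 0" shows "place_of \<iota> n \<eta> (\<lambda>i. c * q i) = place_of \<iota> n \<eta> q"
proof (intro ext)
  fix a r
  have "(hom_poly n d A \<and> hom_poly n d B \<and> mpoly_eval B (\<lambda>i. c * q i) \<noteq> 0 \<and>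
     a = mev \<iota> A \<eta> / mev \<iota> B \<eta> \<and> r = mpoly_eval A (\<lambda>i. c * q i) / mpoly_eval B (\<lambda>i. c * q i)) =
    (hom_poly n d A \<and> hom_poly n d B \<and> mpoly_eval B q \<noteq> 0 \<and>
     a = mev \<iota> A \<eta> / mev \<iota> B \<eta> \<and> r = mpoly_eval A q / mpoly_eval B q)" for d A B
    using assms by (auto simp: mpoly_eval_scale)
  then show "place_of \<iota> n \<eta> (\<lambda>i. c * q i) a r = place_of \<iota> n \<eta> q a r"
    unfolding place_of_def by presburger
qed

context vector_space
begin

text \<open>
  A generating set with at most \<open>n\<close> elements cannot contain two vectors that are independent modulo
  a subspace of dimension \<open>n - 1\<close>.
\<close>

lemma span_corank_one:
  assumes G: "finite G" "card G \<le> n" and W: "W \<subseteq> span G" "dim W = n - 1"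
  shows "\<exists>v\<in>span G. G \<subseteq> span (insert v W)"
proof -
  obtain B where B: "B \<subseteq> W" "independent B" "W \<subseteq> span B" "card B = dim W" by (rule basis_exists)
  have sp: "span B = span W" using B by (metis span_mono span_minimal subspace_span subset_antisym)
  show ?thesis
  proof (cases "G \<subseteq> span B")
    case True
    then show ?thesis using sp span_zero by (intro bexI[of _ 0]) auto
  next
    case False
    then obtain u where u: "u \<in> G" "u \<notin> span B" by blast
    have n: "n \<ge> 1" using u G by (metis One_nat_def Suc_leI card_gt_0_iff empty_iff le_trans)
    have Bu: "independent (insert u B)" "u \<notin> B" using u B independent_insertI span_base by blast+
    have finB: "finite B" using independent_span_bound[OF G(1) B(2)] B W by auto
    have "G \<subseteq> span (insert u B)"
    proof
      fix v assume v: "v \<in> G"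
      show "v \<in> span (insert u B)"
      proof (rule ccontr)
        assume nv: "v \<notin> span (insert u B)"
        then have "independent (insert v (insert u B))" using Bu independent_insertI by blast
        moreover have "insert v (insert u B) \<subseteq> span G" using v u B W span_base by blast
        ultimately have "card (insert v (insert u B)) \<le> card G" using independent_span_bound[OF G(1)] by blast
        moreover have "v \<notin> insert u B" using nv span_base by blast
        then have "card (insert v (insert u B)) = n + 1" using Bu(2) finB B(4) W(2) n by simp
        ultimately show False using G by simp
      qed
    qed
    moreover have "span (insert u B) \<subseteq> span (insert u W)" using B by (intro span_mono) blast
    ultimately show ?thesis using u span_base by blast
  qed
qed

lemma span_full:
  assumes G: "finite G" "card G \<le> dim W" and W: "W \<subseteq> span G"
  shows "G \<subseteq> span W"
proof -
  obtain B where B: "B \<subseteq> W" "independent B" "W \<subseteq> span B" "card B = dim W" by (rule basis_exists)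
  have finB: "finite B" using independent_span_bound[OF G(1) B(2)] B W by auto
  have "G \<subseteq> span B"
  proof
    fix v assume v: "v \<in> G"
    show "v \<in> span B"
    proof (rule ccontr)
      assume nv: "v \<notin> span B"
      then have "independent (insert v B)" using B independent_insertI by blast
      moreover have "insert v B \<subseteq> span G" using v B W span_base by blast
      ultimately have "card (insert v B) \<le> card G" using independent_span_bound[OF G(1)] by blast
      moreover have "v \<notin> B" using nv span_base by blast
      ultimately show False using finB B(4) G by simp
    qed
  qed
  then show ?thesis using B span_mono by blast
qed

end

lemma sum_fun_apply: "(\<Sum>i\<in>A. f i) k = (\<Sum>i\<in>A. f i k)"
  by (induction A rule: infinite_finite_induct) auto

lemma function_vector_space: "vector_space (\<lambda>(a::'a::field) v (i::nat). a * v i)"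
  by unfold_locales (auto simp: fun_eq_iff algebra_simps)

text \<open>
  The coordinates of \<open>\<eta>\<close> satisfy exactly the homogeneous equations that hold on \<open>V\<close>.  Varieties
  with generic points in a common field \<open>'m\<close> can be compared through their function fields, which
  are subfields of \<open>'m\<close>.
\<close>

locale generic_point =
  fixes \<iota> :: "'a::field \<Rightarrow> 'm::field" and n :: nat and V :: "'a ppoint set" and \<eta> :: "nat \<Rightarrow> 'm"
  assumes hom: "comm_ring_hom \<iota>"
    and sub: "V \<subseteq> proj_space n"
    and generic: "hom_poly n d A \<Longrightarrow> mev \<iota> A \<eta> = 0 \<longleftrightarrow> (\<forall>P\<in>V. vanishes_at A P)"
begin

sublocale \<iota>: comm_ring_hom \<iota> by (rule hom)

lemma eval_eq_0: "P \<in> V \<Longrightarrow> q \<in> P \<Longrightarrow> hom_poly n d A \<Longrightarrow> mev \<iota> A \<eta> = 0 \<Longrightarrow> mpoly_eval A q = 0"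
  using generic by (auto simp: vanishes_at_def)

text \<open>
  Well-definedness is where genericity enters: two representations of an element differ by a form
  that vanishes at \<open>\<eta>\<close>, hence on all of \<open>V\<close>.
\<close>

lemma place_at:
  assumes P: "P \<in> V" "q \<in> P"
  shows "place \<iota> (function_field \<iota> n \<eta>) (place_of \<iota> n \<eta> q)"
proof
  note ev = mpoly_eval_mev id_mev
  have nz: "mev \<iota> B \<eta> \<noteq> 0" if "hom_poly n d B" "mpoly_eval B q \<noteq> 0" for d B
    using eval_eq_0[OF P that(1)] that(2) by blast
  show "r = r'" if asm: "place_of \<iota> n \<eta> q a r" "place_of \<iota> n \<eta> q a r'" for a r r'
  proof -
    obtain d A B where 1: "hom_poly n d A" "hom_poly n d B" "mpoly_eval B q \<noteq> 0"
      "a = mev \<iota> A \<eta> / mev \<iota> B \<eta>" "r = mpoly_eval A q / mpoly_eval B q" by (rule place_ofE[OF asm(1)])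
    obtain d' A' B' where 2: "hom_poly n d' A'" "hom_poly n d' B'" "mpoly_eval B' q \<noteq> 0"
      "a = mev \<iota> A' \<eta> / mev \<iota> B' \<eta>" "r' = mpoly_eval A' q / mpoly_eval B' q" by (rule place_ofE[OF asm(2)])
    have "hom_poly n (d + d') (A * B')" "hom_poly n (d' + d) (A' * B)" using 1 2 by (auto intro: hom_poly_mult)
    then have h: "hom_poly n (d + d') (A * B' - A' * B)" by (intro hom_poly_diff) (auto simp: add.commute)
    have "mev \<iota> (A * B' - A' * B) \<eta> = 0"
      using 1(4) 2(4) nz[OF 1(2,3)] nz[OF 2(2,3)] by (simp add: \<iota>.mev_diff \<iota>.mev_mult field_simps)
    then have "mpoly_eval (A * B' - A' * B) q = 0" using eval_eq_0[OF P h] by blast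
    then have "mpoly_eval A q * mpoly_eval B' q = mpoly_eval A' q * mpoly_eval B q" by (simp add: ev)
    then show ?thesis unfolding 1(5) 2(5) using 1(3) 2(3) by (simp add: frac_eq_eq)
  qed
  show "place_of \<iota> n \<eta> q (\<iota> c) c" for c
    unfolding place_of_def
    by (intro exI[of _ 0] exI[of _ "Const c"] exI[of _ 1]) (simp add: ev)
  show "place_of \<iota> n \<eta> q (a + b) (r + s)" if asm: "place_of \<iota> n \<eta> q a r" "place_of \<iota> n \<eta> q b s" for a b r s
  proof -
    obtain d A B where 1: "hom_poly n d A" "hom_poly n d B" "mpoly_eval B q \<noteq> 0"
      "a = mev \<iota> A \<eta> / mev \<iota> B \<eta>" "r = mpoly_eval A q / mpoly_eval B q" by (rule place_ofE[OF asm(1)])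
    obtain d' A' B' where 2: "hom_poly n d' A'" "hom_poly n d' B'" "mpoly_eval B' q \<noteq> 0"
      "b = mev \<iota> A' \<eta> / mev \<iota> B' \<eta>" "s = mpoly_eval A' q / mpoly_eval B' q" by (rule place_ofE[OF asm(2)])
    have h: "hom_poly n (d + d') (A * B' + A' * B)" "hom_poly n (d + d') (B * B')"
      using hom_poly_mult[OF 1(1) 2(2)] hom_poly_mult[OF 2(1) 1(2)] hom_poly_mult[OF 1(2) 2(2)]
      by (auto intro: hom_poly_add simp: add.commute)
    have "a + b = mev \<iota> (A * B' + A' * B) \<eta> / mev \<iota> (B * B') \<eta>"
      unfolding 1(4) 2(4) \<iota>.mev_add \<iota>.mev_mult by (rule add_frac_eq[OF nz[OF 1(2,3)] nz[OF 2(2,3)]])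
    moreover have "r + s = mpoly_eval (A * B' + A' * B) q / mpoly_eval (B * B') q"
      unfolding 1(5) 2(5) ev using 1(3) 2(3) by (intro add_frac_eq) (simp_all add: ev)
    moreover have "mpoly_eval (B * B') q \<noteq> 0" using 1(3) 2(3) by (simp add: ev)
    ultimately show ?thesis unfolding place_of_def using h by blast
  qed
  show "place_of \<iota> n \<eta> q (a * b) (r * s)" if asm: "place_of \<iota> n \<eta> q a r" "place_of \<iota> n \<eta> q b s" for a b r s
  proof -
    obtain d A B where 1: "hom_poly n d A" "hom_poly n d B" "mpoly_eval B q \<noteq> 0"
      "a = mev \<iota> A \<eta> / mev \<iota> B \<eta>" "r = mpoly_eval A q / mpoly_eval B q" by (rule place_ofE[OF asm(1)])
    obtain d' A' B' where 2: "hom_poly n d' A'" "hom_poly n d' B'" "mpoly_eval B' q \<noteq> 0"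
      "b = mev \<iota> A' \<eta> / mev \<iota> B' \<eta>" "s = mpoly_eval A' q / mpoly_eval B' q" by (rule place_ofE[OF asm(2)])
    have "hom_poly n (d + d') (A * A')" "hom_poly n (d + d') (B * B')"
      using 1 2 by (auto intro!: hom_poly_mult)
    then show ?thesis
      unfolding place_of_def using 1 2
      by (intro exI[of _ "d + d'"] exI[of _ "A * A'"] exI[of _ "B * B'"])
         (simp add: ev \<iota>.mev_mult)
  qed
  show "place_of \<iota> n \<eta> q (inverse a) (inverse r)" if asm: "place_of \<iota> n \<eta> q a r" "r \<noteq> 0" for a r
  proof -
    obtain d A B where 1: "hom_poly n d A" "hom_poly n d B" "mpoly_eval B q \<noteq> 0"
      "a = mev \<iota> A \<eta> / mev \<iota> B \<eta>" "r = mpoly_eval A q / mpoly_eval B q" by (rule place_ofE[OF asm(1)])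
    then show ?thesis unfolding place_of_def using asm(2)
      by (intro exI[of _ d] exI[of _ B] exI[of _ A]) (auto simp: inverse_eq_divide)
  qed
  show "a \<in> function_field \<iota> n \<eta>" if asm: "place_of \<iota> n \<eta> q a r" for a r
    using asm nz unfolding place_of_def function_field_def by blast
qed

lemma coordinate_nonzero:
  assumes "P \<in> V" "q \<in> P" "j \<le> n" "q j \<noteq> 0" shows "\<eta> j \<noteq> 0"
  using eval_eq_0[OF assms(1,2) hom_poly_Var[OF assms(3)]] assms(4)
  by (auto simp: mpoly_eval_mev id_mev)

lemma place_of_coordinate:
  assumes "P \<in> V" "q \<in> P" "i \<le> n" "j \<le> n" "q j \<noteq> 0"
  shows "place_of \<iota> n \<eta> q (\<eta> i / \<eta> j) (q i / q j)"
  unfolding place_of_def using assms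
  by (intro exI[of _ 1] exI[of _ "Var i"] exI[of _ "Var j"]) (auto simp: hom_poly_Var[simplified] mpoly_eval_mev id_mev)

text \<open>
  Scaling a coordinate \<open>q j\<close> to \<open>1\<close> makes the \<open>\<eta> i / \<eta> j\<close> affine coordinates at the point; the
  differences \<open>loc i\<close> to their values will be seen to generate the maximal ideal.
\<close>

context
  fixes P q j
  assumes P: "P \<in> V" "q \<in> P" and j: "j \<le> n" "q j = 1"
begin

interpretation pl: place \<iota> "function_field \<iota> n \<eta>" "place_of \<iota> n \<eta> q"
  by (rule place_at[OF P])

definition "aff i = \<eta> i / \<eta> j"
definition "loc i = aff i - \<iota> (q i)"

lemma eta_j: "\<eta> j \<noteq> 0" using coordinate_nonzero[OF P j(1)] j by simp

lemma res_aff: "i \<le> n \<Longrightarrow> place_of \<iota> n \<eta> q (aff i) (q i)"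
  using place_of_coordinate[OF P _ j(1), of i] j by (simp add: aff_def)

lemma res_loc: "i \<le> n \<Longrightarrow> place_of \<iota> n \<eta> q (loc i) 0"
  using pl.diff[OF res_aff[of i] pl.const[of "q i"]] by (simp add: loc_def)

lemma loc_j: "loc j = 0" using eta_j j by (simp add: loc_def aff_def)

lemma mev_aff: "hom_poly n d A \<Longrightarrow> mev \<iota> A aff = mev \<iota> A \<eta> / \<eta> j ^ d"
  using mev_scale[of n d A \<iota> "inverse (\<eta> j)" \<eta>]
  by (simp add: aff_def[abs_def] divide_inverse mult.commute power_inverse)

lemma res_mev_aff: "hom_poly n d A \<Longrightarrow> place_of \<iota> n \<eta> q (mev \<iota> A aff) (mpoly_eval A q)"
  by (rule pl.res_mev) (meson res_aff hom_poly_keys)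

lemma function_field_quotient:
  assumes "a \<in> function_field \<iota> n \<eta>"
  shows "\<exists>b c. pl.regular b \<and> pl.regular c \<and> a = b / c"
proof -
  obtain A B d where AB: "a = mev \<iota> A \<eta> / mev \<iota> B \<eta>" "hom_poly n d A" "hom_poly n d B"
    using assms by (auto simp: function_field_def)
  then have "a = mev \<iota> A aff / mev \<iota> B aff" using eta_j by (simp add: mev_aff)
  then show ?thesis using AB res_mev_aff pl.regularI by blast
qed

text \<open>
  Every polynomial in the affine coordinates is congruent to its value modulo the ideal \<open>J\<close> generated
  by the \<open>loc i\<close>; the relation of being regular and congruent to a constant is preserved by ring
  operations, so \<open>mev_rel\<close> applies.
\<close>

lemma max_ideal_generated:
  assumes "place_of \<iota> n \<eta> q a 0"
  shows "\<exists>c. (\<forall>i\<le>n. pl.regular (c i)) \<and> a = (\<Sum>i\<le>n. c i * loc i)"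
proof -
  define J where "J = {\<Sum>i\<le>n. c i * loc i | c. \<forall>i\<le>n. pl.regular (c i)}"
  have J0: "0 \<in> J" unfolding J_def by (intro CollectI exI[of _ "\<lambda>_. 0"]) (simp add: pl.regular_0)
  have Jadd: "a + b \<in> J" if J: "a \<in> J" "b \<in> J" for a b
  proof -
    obtain c c' where "\<forall>i\<le>n. pl.regular (c i)" "a = (\<Sum>i\<le>n. c i * loc i)"
       "\<forall>i\<le>n. pl.regular (c' i)" "b = (\<Sum>i\<le>n. c' i * loc i)" using J by (auto simp: J_def)
    then show ?thesis unfolding J_def
      by (intro CollectI exI[of _ "\<lambda>i. c i + c' i"]) (simp add: distrib_right sum.distrib pl.regular_add)
  qed
  have Jmult: "b * a \<in> J" if J: "a \<in> J" "pl.regular b" for a b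
  proof -
    obtain c where "\<forall>i\<le>n. pl.regular (c i)" "a = (\<Sum>i\<le>n. c i * loc i)" using J by (auto simp: J_def)
    moreover have "b * a = (\<Sum>i\<le>n. (b * c i) * loc i)"
    proof -
      have "b * a = b * (\<Sum>i\<le>n. c i * loc i)" using calculation by simp
      also have "\<dots> = (\<Sum>i\<le>n. b * (c i * loc i))" by (rule sum_distrib_left)
      finally show ?thesis by (simp only: mult.assoc)
    qed
    ultimately show ?thesis unfolding J_def
      using J(2) by (intro CollectI exI[of _ "\<lambda>i. b * c i"]) (simp add: pl.regular_mult)
  qed
  have Jloc: "loc i \<in> J" if "i \<le> n" for i
  proof -
    have "(\<Sum>k\<le>n. (if k = i then 1 else 0) * loc k) = loc i" using that by (simp add: if_distrib[of "\<lambda>x. x * _"] cong: if_cong)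
    then show ?thesis unfolding J_def
      by (intro CollectI exI[of _ "\<lambda>k. if k = i then 1 else 0"]) (auto simp: pl.regular_0 pl.regular_1)
  qed
  have mevJ: "mev \<iota> A aff - \<iota> (mpoly_eval A q) \<in> J" if A: "hom_poly n d A" for A d
  proof -
    let ?R = "\<lambda>u u'. pl.regular u \<and> u - \<iota> u' \<in> J"
    have "?R (mev \<iota> A aff) (mev (\<lambda>a. a) A q)"
    proof (rule mev_rel[where R = ?R])
      fix a b a' b' assume 1: "?R a a'" and 2: "?R b b'"
      have "(a + b) - \<iota> (a' + b') = (a - \<iota> a') + (b - \<iota> b')" by (simp add: \<iota>.hom_add)
      then show "?R (a + b) (a' + b')" using 1 2 Jadd pl.regular_add by metis
      have "a * b - \<iota> (a' * b') = b * (a - \<iota> a') + \<iota> a' * (b - \<iota> b')" by (simp add: \<iota>.hom_mult algebra_simps)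
      then show "?R (a * b) (a' * b')" using 1 2 Jadd Jmult pl.regular_mult pl.regular_const by metis
    next
      fix m i assume "m \<in> Poly_Mapping.keys A" "i \<in> Poly_Mapping.keys m"
      then have "i \<le> n" using hom_poly_keys[OF A] by blast
      then show "?R (aff i) (q i)" using Jloc[of i] res_aff[of i] pl.regularI by (auto simp: loc_def)
    qed (simp_all add: pl.regular_0 pl.regular_1 pl.regular_const J0)
    then show ?thesis by (simp add: mpoly_eval_mev)
  qed
  obtain d A B where AB: "hom_poly n d A" "hom_poly n d B" "mpoly_eval B q \<noteq> 0"
      "a = mev \<iota> A \<eta> / mev \<iota> B \<eta>" "0 = mpoly_eval A q / mpoly_eval B q" by (rule place_ofE[OF assms])
  then have "mpoly_eval A q = 0" by simp
  then have "mev \<iota> A aff \<in> J" using mevJ[OF AB(1)] by simp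
  moreover have "pl.regular (inverse (mev \<iota> B aff))"
    using pl.inverse[OF res_mev_aff[OF AB(2)] AB(3)] by (rule pl.regularI)
  ultimately have "inverse (mev \<iota> B aff) * mev \<iota> A aff \<in> J" by (rule Jmult)
  moreover have "a = inverse (mev \<iota> B aff) * mev \<iota> A aff"
    using AB eta_j by (simp add: mev_aff field_simps)
  ultimately show ?thesis by (simp add: J_def) blast
qed

text \<open>
  This is \<open>\<mm>\<^sup>2\<close>: as the \<open>loc k\<close> generate \<open>\<mm>\<close>, products of two elements of \<open>\<mm>\<close> are their combinations
  with coefficients in \<open>\<mm>\<close>.
\<close>

definition "square_ideal = {\<Sum>k\<le>n. c k * loc k | c. \<forall>k\<le>n. place_of \<iota> n \<eta> q (c k) 0}"

lemma square_ideal_0: "0 \<in> square_ideal"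
  unfolding square_ideal_def by (intro CollectI exI[of _ "\<lambda>_. 0"]) (simp add: pl.res_0)

lemma square_ideal_add:
  assumes "a \<in> square_ideal" "b \<in> square_ideal" shows "a + b \<in> square_ideal"
proof -
  obtain c c' where *: "\<forall>k\<le>n. place_of \<iota> n \<eta> q (c k) 0" "a = (\<Sum>i\<le>n. c i * loc i)"
     "\<forall>k\<le>n. place_of \<iota> n \<eta> q (c' k) 0" "b = (\<Sum>i\<le>n. c' i * loc i)" using assms by (auto simp: square_ideal_def)
  have "place_of \<iota> n \<eta> q (c k + c' k) 0" if "k \<le> n" for k using pl.add[of "c k" 0 "c' k" 0] * that by simp
  then show ?thesis unfolding square_ideal_def using *
    by (intro CollectI exI[of _ "\<lambda>i. c i + c' i"]) (simp add: distrib_right sum.distrib)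
qed

lemma square_ideal_mult:
  assumes "a \<in> square_ideal" "pl.regular b" shows "a * b \<in> square_ideal"
proof -
  obtain c where *: "\<forall>k\<le>n. place_of \<iota> n \<eta> q (c k) 0" "a = (\<Sum>i\<le>n. c i * loc i)"
    using assms by (auto simp: square_ideal_def)
  have "place_of \<iota> n \<eta> q (c k * b) 0" if "k \<le> n" for k using pl.max_ideal_mult[of "c k" b] * that assms by simp
  moreover have "a * b = (\<Sum>i\<le>n. (c i * b) * loc i)" unfolding * by (simp add: sum_distrib_left mult_ac)
  ultimately show ?thesis unfolding square_ideal_def
    by (intro CollectI exI[of _ "\<lambda>i. c i * b"]) simp
qed

lemma square_ideal_prod: "i \<le> n \<Longrightarrow> k \<le> n \<Longrightarrow> loc i * loc k \<in> square_ideal"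
  unfolding square_ideal_def
  by (intro CollectI exI[of _ "\<lambda>l. if l = k then loc i else 0"])
     (auto simp: pl.res_0 res_loc if_distrib[of "\<lambda>x. x * _"] cong: if_cong)

text \<open>
  Modulo \<open>\<mm>\<^sup>2\<close> this identifies a covector at \<open>q\<close> with an element of the cotangent space \<open>\<mm>/\<mm>\<^sup>2\<close>.
\<close>

definition "differential v = (\<Sum>i\<le>n. \<iota> (v i) * loc i)"

text \<open>
  For a form vanishing on \<open>V\<close> the first-order Taylor formula at \<open>q\<close> has no constant term and its left
  side vanishes at the generic point.
\<close>

lemma differential_gradient:
  assumes f: "hom_poly n d f" "\<forall>P\<in>V. vanishes_at f P"
  shows "differential (gradient n f q) \<in> square_ideal"
proof -
  have reg: "pl.regular (\<iota> (q i) + loc i)" if "i \<le> n" for i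
    using res_aff[OF that] pl.regularI by (simp add: loc_def)
  have "mev \<iota> f (\<lambda>i. \<iota> (q i) + loc i) - \<iota> (mpoly_eval f q)
           - (\<Sum>i\<le>n. \<iota> (mpoly_eval (mpoly_deriv i f) q) * loc i) \<in> square_ideal"
    by (rule taylor_first_order[OF hom f(1), where R = "Collect pl.regular"])
       (auto simp: pl.regular_const reg intro: square_ideal_0 square_ideal_add square_ideal_mult square_ideal_prod)
  moreover have "mev \<iota> f (\<lambda>i. \<iota> (q i) + loc i) = 0"
    using mev_aff[OF f(1)] generic[OF f(1)] f(2) by (simp add: loc_def)
  moreover have "mpoly_eval f q = 0" using f P by (auto simp: vanishes_at_def)
  moreover have "differential (gradient n f q) = (\<Sum>i\<le>n. \<iota> (mpoly_eval (mpoly_deriv i f) q) * loc i)"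
    by (simp add: differential_def gradient_def)
  ultimately have "- differential (gradient n f q) \<in> square_ideal" by simp
  then have "- differential (gradient n f q) * \<iota> (-1) \<in> square_ideal" by (rule square_ideal_mult) (rule pl.regular_const)
  then show ?thesis by (simp add: \<iota>.hom_uminus)
qed

interpretation vs: vector_space "\<lambda>(a::'a) v (i::nat). a * v i"
  by (rule function_vector_space)

abbreviation "gradients \<equiv> {gradient n f q | f. form n f \<and> (\<forall>P\<in>V. vanishes_at f P)}"

text \<open>
  By Euler's identity gradients of forms through \<open>q\<close> are orthogonal to the vector \<open>q\<close>.  These are
  \<open>n\<close> covectors spanning the orthogonal complement of \<open>q\<close>, and their differentials are the
  \<open>loc i\<close>.
\<close>

definition "cotangent i = (\<lambda>k. if k = i then 1 else if k = j then - q i else 0)"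

abbreviation "cotangents \<equiv> cotangent ` ({..n} - {j})"

lemma differential_add: "differential (v + w) = differential v + differential w"
  by (simp add: differential_def \<iota>.hom_add distrib_right sum.distrib)

lemma differential_scale: "differential (\<lambda>i. a * v i) = \<iota> a * differential v"
  by (simp add: differential_def \<iota>.hom_mult sum_distrib_left mult.assoc)

lemma differential_cotangent:
  assumes "i \<le> n" "i \<noteq> j" shows "differential (cotangent i) = loc i"
proof -
  have "\<iota> (cotangent i k) * loc k = (if k = i then loc k else 0)" for k
    using loc_j by (auto simp: cotangent_def)
  then show ?thesis using assms by (simp add: differential_def)
qed

lemma card_cotangents: "finite cotangents" "card cotangents \<le> n"
proof -
  have "card cotangents \<le> card ({..n} - {j})" by (rule card_image_le) simp
  also have "\<dots> = n" using j by simp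
  finally show "card cotangents \<le> n" .
qed simp

lemma gradients_subset: "gradients \<subseteq> vs.span cotangents"
proof
  fix v assume "v \<in> gradients"
  then obtain f d where f: "v = gradient n f q" "hom_poly n d f" "\<forall>P\<in>V. vanishes_at f P" by (auto simp: form_def)
  have "mpoly_eval f q = 0" using f P by (auto simp: vanishes_at_def)
  then have "(\<Sum>i\<le>n. q i * v i) = 0" using euler_identity[OF f(2), of q] by (simp add: f gradient_def)
  then have vj: "v j = - (\<Sum>i\<in>{..n} - {j}. q i * v i)"
    using j by (subst (asm) sum.remove[of _ j]) (auto simp: eq_neg_iff_add_eq_0)
  have "v = (\<Sum>i\<in>{..n} - {j}. (\<lambda>k. v i * cotangent i k))"
  proof
    fix k
    have "(\<Sum>i\<in>{..n} - {j}. (\<lambda>k. v i * cotangent i k)) k = (\<Sum>i\<in>{..n} - {j}. v i * cotangent i k)"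
      by (rule sum_fun_apply)
    also have "\<dots> = v k"
    proof (cases "k = j")
      case True
      then have "(\<Sum>i\<in>{..n} - {j}. v i * cotangent i k) = (\<Sum>i\<in>{..n} - {j}. - (q i * v i))"
        by (intro sum.cong) (auto simp: cotangent_def)
      then show ?thesis using vj True by (simp add: sum_negf)
    next
      case False
      then have "(\<Sum>i\<in>{..n} - {j}. v i * cotangent i k) = (\<Sum>i\<in>{..n} - {j}. if k = i then v i else 0)"
        by (intro sum.cong) (auto simp: cotangent_def)
      then show ?thesis using False by (auto simp: f gradient_def)
    qed
    finally show "v k = (\<Sum>i\<in>{..n} - {j}. (\<lambda>k. v i * cotangent i k)) k" by simp
  qed
  moreover have "(\<Sum>i\<in>{..n} - {j}. (\<lambda>k. v i * cotangent i k)) \<in> vs.span cotangents"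
    by (intro vs.span_sum vs.span_scale vs.span_base imageI)
  ultimately show "v \<in> vs.span cotangents" by simp
qed

lemma differential_span:
  assumes "v \<in> vs.span gradients" shows "differential v \<in> square_ideal"
  using assms
proof (induction rule: vs.span_induct_alt)
  case base
  then show ?case using square_ideal_0 by (simp add: differential_def)
next
  case (step c x y)
  then obtain f d where "x = gradient n f q" "hom_poly n d f" "\<forall>P\<in>V. vanishes_at f P" by (auto simp: form_def)
  then have "differential x \<in> square_ideal" using differential_gradient[of d f] by simp
  then have "differential x * \<iota> c \<in> square_ideal"
    by (intro square_ideal_mult pl.regular_const)
  then have "\<iota> c * differential x + differential y \<in> square_ideal"
    using step by (intro square_ideal_add) (simp_all add: mult.commute)
  then show ?case by (simp only: differential_add differential_scale)
qed

lemma jacobian_rank_eq: "jacobian_rank n V q = vs.dim gradients"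
  by (simp add: jacobian_rank_def)

lemma jacobian_rank_le: "jacobian_rank n V q \<le> n"
  unfolding jacobian_rank_eq
  using vs.dim_le_card[OF gradients_subset card_cotangents(1)] card_cotangents(2) by linarith

text \<open>
  At rank \<open>n\<close> every \<open>loc i\<close> lies in \<open>\<mm>\<^sup>2\<close>, so that \<open>\<mm> = \<mm>\<^sup>2\<close> and Nakayama's lemma gives \<open>\<mm> = 0\<close>:
  all affine coordinates are then constant.
\<close>

lemma full_rank_imp_constant:
  assumes "jacobian_rank n V q = n" "i \<le> n"
  shows "\<eta> i = \<eta> j * \<iota> (q i)"
proof -
  have "cotangents \<subseteq> vs.span gradients"
  proof (rule vs.span_full[OF card_cotangents(1) _ gradients_subset])
    show "card cotangents \<le> vs.dim gradients"
      using assms(1) card_cotangents(2) jacobian_rank_eq by linarith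
  qed
  then have sq: "loc i \<in> square_ideal" if "i \<le> n" for i
    using that differential_span[of "cotangent i"] differential_cotangent[of i] loc_j square_ideal_0
    by (cases "i = j") auto
  have "\<exists>u. pl.regular u \<and> loc i = u * 0"
  proof (rule pl.nakayama[of "{..n}"])
    fix i assume "i \<in> {..n}"
    then obtain c where "\<forall>k\<le>n. place_of \<iota> n \<eta> q (c k) 0" "loc i = (\<Sum>k\<le>n. c k * loc k)"
      using sq[of i] by (auto simp: square_ideal_def)
    then show "\<exists>u c. pl.regular u \<and> (\<forall>k\<in>{..n}. place_of \<iota> n \<eta> q (c k) 0) \<and>
        loc i = u * 0 + (\<Sum>k\<in>{..n}. c k * loc k)"
      using pl.regular_0 by (intro exI[of _ 0] exI[of _ c]) auto
  qed (use assms in auto)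
  then have "loc i = 0" by simp
  then show ?thesis using eta_j by (simp add: loc_def aff_def field_simps)
qed

text \<open>
  At rank \<open>n - 1\<close> one covector \<open>v\<close> together with the gradients spans all cotangents.  Hence its
  differential \<open>t\<close> generates \<open>\<mm>\<close> modulo \<open>\<mm>\<^sup>2\<close>, and by Nakayama's lemma it generates \<open>\<mm>\<close>.
\<close>

lemma nonsingular_imp_valuation:
  assumes rank: "jacobian_rank n V q = n - 1"
    and dep: "\<And>a b. a \<in> function_field \<iota> n \<eta> \<Longrightarrow> b \<in> function_field \<iota> n \<eta> \<Longrightarrow>
      \<exists>P :: 'a poly poly. P \<noteq> 0 \<and> poly (map_poly (\<lambda>p. poly (map_poly \<iota> p) b) P) a = 0"
  shows "pl.valuation"
proof -
  obtain v where v: "v \<in> vs.span cotangents" "cotangents \<subseteq> vs.span (insert v gradients)"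
    using vs.span_corank_one[OF card_cotangents gradients_subset] rank jacobian_rank_eq by auto
  define t where "t = differential v"
  have t: "place_of \<iota> n \<eta> q t 0"
    unfolding t_def differential_def
    by (intro pl.max_ideal_sum pl.max_ideal_mult_left res_loc pl.regular_const) simp
  have gen: "\<exists>u. pl.regular u \<and> loc i = u * t" if "i \<le> n" for i
  proof (rule pl.nakayama[of "{..n}"])
    fix i assume "i \<in> {..n}"
    then have i: "i \<le> n" by simp
    have "\<exists>k. loc i - \<iota> k * t \<in> square_ideal"
    proof (cases "i = j")
      case True
      then show ?thesis using loc_j square_ideal_0 by (intro exI[of _ 0]) simp
    next
      case False
      then have "cotangent i \<in> vs.span (insert v gradients)" using v i by auto
      then obtain k where "cotangent i - (\<lambda>l. k * v l) \<in> vs.span gradients"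
        unfolding vs.span_insert by blast
      then have "differential (cotangent i - (\<lambda>l. k * v l)) \<in> square_ideal" by (rule differential_span)
      moreover have "differential (cotangent i - (\<lambda>l. k * v l)) = loc i - \<iota> k * t"
        using differential_add[of "cotangent i - (\<lambda>l. k * v l)" "\<lambda>l. k * v l"]
        by (simp add: differential_scale differential_cotangent[OF i False] t_def)
      ultimately show ?thesis by auto
    qed
    then obtain k c where "\<forall>k\<le>n. place_of \<iota> n \<eta> q (c k) 0" "loc i - \<iota> k * t = (\<Sum>k\<le>n. c k * loc k)"
      by (auto simp: square_ideal_def)
    then show "\<exists>u c. pl.regular u \<and> (\<forall>k\<in>{..n}. place_of \<iota> n \<eta> q (c k) 0) \<and>
        loc i = u * t + (\<Sum>k\<in>{..n}. c k * loc k)"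
      using pl.regular_const by (intro exI[of _ "\<iota> k"] exI[of _ c]) (auto simp: algebra_simps)
  qed (use that in auto)
  then obtain u where u: "\<And>i. i \<le> n \<Longrightarrow> pl.regular (u i)" "\<And>i. i \<le> n \<Longrightarrow> loc i = u i * t" by metis
  show ?thesis
  proof (rule pl.valuation_if_principal[OF t _ function_field_quotient dep])
    fix a assume "place_of \<iota> n \<eta> q a 0"
    then obtain c where c: "\<forall>i\<le>n. pl.regular (c i)" "a = (\<Sum>i\<le>n. c i * loc i)" using max_ideal_generated by blast
    have "a = (\<Sum>i\<le>n. c i * (u i * t))" unfolding c(2) by (intro sum.cong) (auto simp: u)
    also have "\<dots> = t * (\<Sum>i\<le>n. c i * u i)" by (simp add: sum_distrib_left mult_ac)
    finally show "\<exists>b. pl.regular b \<and> a = t * b"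
      using c u by (intro exI[of _ "\<Sum>i\<le>n. c i * u i"]) (auto intro!: pl.regular_sum pl.regular_mult)
  qed
qed

end

end

section \<open>Birational models\<close>

lemma proj_space_rep: "P \<in> proj_space n \<Longrightarrow> \<exists>x. P = proj_pt x"
  unfolding proj_space_def by blast

text \<open>
  Properness of projective space, in the form of the valuative criterion: dividing by a coordinate of
  least valuation makes all coordinates regular.
\<close>

lemma (in place) dominant_coordinate:
  assumes val: valuation and "finite I" and "\<exists>i\<in>I. w i \<noteq> 0"
    and "\<And>i k. i \<in> I \<Longrightarrow> k \<in> I \<Longrightarrow> w k \<noteq> 0 \<Longrightarrow> w i / w k \<in> F"
  shows "\<exists>j\<in>I. w j \<noteq> 0 \<and> (\<forall>i\<in>I. regular (w i / w j))"
  using assms(2-)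
proof (induction I rule: finite_induct)
  case (insert x I)
  show ?case
  proof (cases "\<exists>i\<in>I. w i \<noteq> 0")
    case False
    then have "w i = 0" if "i \<in> I" for i using that by blast
    then show ?thesis using insert.prems(1) regular_0 regular_1 by auto
  next
    case True
    then obtain j where j: "j \<in> I" "w j \<noteq> 0" "\<forall>i\<in>I. regular (w i / w j)"
      using insert.IH insert.prems(2) by (metis insertCI)
    show ?thesis
    proof (cases "regular (w x / w j)")
      case True
      then show ?thesis using j by auto
    next
      case False
      moreover have "w x / w j \<in> F" using insert.prems(2)[of x j] j by auto
      ultimately have r: "regular (inverse (w x / w j))" using val unfolding valuation_def by blast
      have x0: "w x \<noteq> 0" using False regular_0 by auto
      have "regular (w i / w x)" if "i \<in> I" for i
      proof -
        have "w i / w x = (w i / w j) * inverse (w x / w j)" using j(2) x0 by simp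
        then show ?thesis using j(3) r that regular_mult by metis
      qed
      then show ?thesis using x0 regular_1 by (intro bexI[of _ x]) auto
    qed
  qed
qed simp

text \<open>
  The values of the quotients of coordinates can be read off from the place.
\<close>

lemma place_determines_point:
  assumes g: "generic_point \<iota> n V \<eta>"
    and P: "P \<in> V" "q \<in> P" and P': "P' \<in> V" "q' \<in> P'"
    and eq: "place_of \<iota> n \<eta> q = place_of \<iota> n \<eta> q'"
  shows "P = P'"
proof -
  interpret generic_point \<iota> n V \<eta> by fact
  interpret p': place \<iota> "function_field \<iota> n \<eta>" "place_of \<iota> n \<eta> q'" by (rule place_at[OF P'])
  have PP: "P \<in> proj_space n" "P' \<in> proj_space n" using P P' sub by auto
  obtain j where j: "j \<le> n" "q j \<noteq> 0" using proj_space_E(3)[OF PP(1) P(2)] by blast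
  obtain k where k: "k \<le> n" "q' k \<noteq> 0" using proj_space_E(3)[OF PP(2) P'(2)] by blast
  have nz: "\<eta> j \<noteq> 0" "\<eta> k \<noteq> 0" using coordinate_nonzero[OF P j] coordinate_nonzero[OF P' k] by auto
  have "place_of \<iota> n \<eta> q' ((\<eta> j / \<eta> k) * (\<eta> k / \<eta> j)) ((q' j / q' k) * (q k / q j))"
    using place_of_coordinate[OF P' j(1) k] place_of_coordinate[OF P k(1) j] unfolding eq by (rule p'.mult)
  then have "place_of \<iota> n \<eta> q' 1 ((q' j / q' k) * (q k / q j))" using nz by simp
  then have "(q' j / q' k) * (q k / q j) = 1" using p'.functional p'.res_1 by blast
  then have j': "q' j \<noteq> 0" by auto
  have "q i / q j = q' i / q' j" if "i \<le> n" for i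
    using place_of_coordinate[OF P that j] place_of_coordinate[OF P' that j(1) j'] p'.functional unfolding eq by blast
  then have "q i = (q j / q' j) * q' i" for i
    using j j' proj_space_E(2)[OF PP(1) P(2), of i] proj_space_E(2)[OF PP(2) P'(2), of i]
    by (cases "i \<le> n") (auto simp: field_simps)
  then have "q = (\<lambda>i. (q j / q' j) * q' i)" by blast
  moreover have "q j / q' j \<noteq> 0" using j j' by simp
  ultimately have "q \<in> proj_pt q'" unfolding proj_pt_def by blast
  then show ?thesis using proj_pt_eq proj_space_E(1)[OF PP(1) P(2)] proj_space_E(1)[OF PP(2) P'(2)] by blast
qed

text \<open>
  The place at \<open>q1\<close> specialises the generic point of \<open>V2\<close> to a point \<open>q2\<close> of \<open>V2\<close>: after division by
  a dominant coordinate all coordinates of \<open>\<eta>2\<close> are regular, and the equations of \<open>V2\<close> persist for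
  their residues.  The place at \<open>q1\<close> then dominates the one at \<open>q2\<close>, which is a valuation.
\<close>

lemma places_correspond:
  assumes g1: "generic_point \<iota> n1 V1 \<eta>1" and g2: "generic_point \<iota> n2 V2 \<eta>2"
    and closed: "zariski_closed n2 V2" and ne: "V2 \<noteq> {}"
    and F: "function_field \<iota> n1 \<eta>1 = function_field \<iota> n2 \<eta>2"
    and val1: "place.valuation (function_field \<iota> n1 \<eta>1) (place_of \<iota> n1 \<eta>1 q1)"
    and val2: "\<And>P q. P \<in> V2 \<Longrightarrow> q \<in> P \<Longrightarrow> place.valuation (function_field \<iota> n2 \<eta>2) (place_of \<iota> n2 \<eta>2 q)"
    and P1: "P1 \<in> V1" "q1 \<in> P1"
  shows "\<exists>P2\<in>V2. \<exists>q2\<in>P2. place_of \<iota> n1 \<eta>1 q1 = place_of \<iota> n2 \<eta>2 q2"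
proof -
  interpret g1: generic_point \<iota> n1 V1 \<eta>1 by fact
  interpret g2: generic_point \<iota> n2 V2 \<eta>2 by fact
  interpret p1: place \<iota> "function_field \<iota> n1 \<eta>1" "place_of \<iota> n1 \<eta>1 q1" by (rule g1.place_at[OF P1])
  obtain j where j: "j \<le> n2" "\<eta>2 j \<noteq> 0" "\<forall>i\<le>n2. p1.regular (\<eta>2 i / \<eta>2 j)"
  proof -
    obtain Q where Q: "Q \<in> V2" using ne by blast
    then obtain y where y: "y \<in> Q" using g2.sub proj_pt_self proj_space_rep by blast
    obtain k where "k \<le> n2" "y k \<noteq> 0" using proj_space_E(3)[of Q n2 y] Q y g2.sub by blast
    then have nz: "\<exists>k\<in>{..n2}. \<eta>2 k \<noteq> 0" using g2.coordinate_nonzero[OF Q y] by blast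
    have "\<eta>2 i / \<eta>2 k \<in> function_field \<iota> n1 \<eta>1" if "i \<le> n2" "k \<le> n2" "\<eta>2 k \<noteq> 0" for i k
      unfolding F unfolding function_field_def using that
      by (intro CollectI exI[of _ "Var i"] exI[of _ "Var k"] exI[of _ 1])
         (simp add: hom_poly_Var[simplified] g1.\<iota>.mev_single)
    then have "\<exists>j\<in>{..n2}. \<eta>2 j \<noteq> 0 \<and> (\<forall>i\<in>{..n2}. p1.regular (\<eta>2 i / \<eta>2 j))"
      using nz by (intro p1.dominant_coordinate[OF val1]) auto
    then show ?thesis using that by auto
  qed
  define w where "w i = \<eta>2 i / \<eta>2 j" for i
  obtain r where r: "\<And>i. i \<le> n2 \<Longrightarrow> place_of \<iota> n1 \<eta>1 q1 (w i) (r i)"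
    using j(3) unfolding p1.regular_def w_def by metis
  define q2 where "q2 i = (if i \<le> n2 then r i else 0)" for i
  have q2: "place_of \<iota> n1 \<eta>1 q1 (mev \<iota> A w) (mpoly_eval A q2)" if "hom_poly n2 d A" for A d
  proof (rule p1.res_mev)
    fix m i assume "m \<in> Poly_Mapping.keys A" "i \<in> Poly_Mapping.keys m"
    then have "i \<le> n2" using hom_poly_keys[OF that] by blast
    then show "place_of \<iota> n1 \<eta>1 q1 (w i) (q2 i)" using r by (simp add: q2_def)
  qed
  have mev_w: "mev \<iota> A w = mev \<iota> A \<eta>2 / \<eta>2 j ^ d" if "hom_poly n2 d A" for A d
    using mev_scale[OF that, of \<iota> "inverse (\<eta>2 j)" \<eta>2]
    by (simp add: w_def[abs_def] divide_inverse mult.commute power_inverse)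
  have "w j = 1" using j by (simp add: w_def)
  then have "q2 j = 1" using r[OF j(1)] p1.functional p1.res_1 j(1) by (simp add: q2_def)
  then have in_sp: "proj_pt q2 \<in> proj_space n2" by (intro proj_pt_in_proj_space[of _ _ j]) (use j in \<open>auto simp: q2_def\<close>)
  obtain S where S: "\<forall>f\<in>S. form n2 f" "V2 = proj_zeros n2 S" using closed by (auto simp: zariski_closed_def)
  have "vanishes_at f (proj_pt q2)" if f: "f \<in> S" for f
  proof -
    obtain d where d: "hom_poly n2 d f" using S(1) f unfolding form_def by blast
    have "\<forall>P\<in>V2. vanishes_at f P" using S(2) f by (auto simp: proj_zeros_def)
    then have "mev \<iota> f w = 0" using g2.generic[OF d] mev_w[OF d] by simp
    then have "mpoly_eval f q2 = 0" using q2[OF d] p1.functional p1.res_0 by metis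
    then show ?thesis using vanishes_at_proj_pt[OF d] by simp
  qed
  then have V2: "proj_pt q2 \<in> V2" using in_sp S(2) by (simp add: proj_zeros_def)
  have "place_of \<iota> n1 \<eta>1 q1 = place_of \<iota> n2 \<eta>2 q2"
  proof (rule place_domination)
    show "place \<iota> (function_field \<iota> n1 \<eta>1) (place_of \<iota> n1 \<eta>1 q1)" by (rule g1.place_at[OF P1])
    show "place \<iota> (function_field \<iota> n1 \<eta>1) (place_of \<iota> n2 \<eta>2 q2)"
      unfolding F by (rule g2.place_at[OF V2 proj_pt_self])
    show "place.valuation (function_field \<iota> n1 \<eta>1) (place_of \<iota> n2 \<eta>2 q2)"
      unfolding F by (rule val2[OF V2 proj_pt_self])
    fix a s assume "place_of \<iota> n2 \<eta>2 q2 a s"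
    then obtain d A B where AB: "hom_poly n2 d A" "hom_poly n2 d B" "mpoly_eval B q2 \<noteq> 0"
      "a = mev \<iota> A \<eta>2 / mev \<iota> B \<eta>2" "s = mpoly_eval A q2 / mpoly_eval B q2" by (rule place_ofE)
    have "place_of \<iota> n1 \<eta>1 q1 (mev \<iota> A w * inverse (mev \<iota> B w)) (mpoly_eval A q2 * inverse (mpoly_eval B q2))"
      by (intro p1.mult p1.inverse q2[OF AB(1)] q2[OF AB(2)] AB(3))
    moreover have "mev \<iota> A w * inverse (mev \<iota> B w) = a"
      unfolding mev_w[OF AB(1)] mev_w[OF AB(2)] AB(4) using j(2) by (simp add: field_simps)
    ultimately show "place_of \<iota> n1 \<eta>1 q1 a s" unfolding AB(5) by (simp add: divide_inverse)
  qed
  then show ?thesis using V2 proj_pt_self by blast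
qed

subsection \<open>Frobenius\<close>

definition conj_poly :: "('a::comm_ring_1 \<Rightarrow> 'a) \<Rightarrow> 'a mpoly \<Rightarrow> 'a mpoly" where
  "conj_poly \<sigma> A = (\<Sum>m\<in>Poly_Mapping.keys A. Poly_Mapping.single m (\<sigma> (Poly_Mapping.lookup A m)))"

lemma hom_poly_conj: "hom_poly n d A \<Longrightarrow> hom_poly n d (conj_poly \<sigma> A)"
  unfolding conj_poly_def
  by (intro hom_poly_sum) (auto simp: hom_poly_def split: if_splits)

lemma mpoly_eval_conj:
  assumes "comm_ring_hom \<sigma>"
  shows "mpoly_eval (conj_poly \<sigma> A) (\<lambda>i. \<sigma> (z i)) = \<sigma> (mpoly_eval A z)"
proof -
  have "\<sigma> (mpoly_eval A z) = mev \<sigma> A (\<lambda>i. \<sigma> (z i))"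
    unfolding mpoly_eval_mev using hom_mev[OF id_comm_ring_hom assms] by simp
  then show ?thesis by (simp add: conj_poly_def mpoly_eval_mev id_mev) (simp add: mev_def)
qed

lemma mpoly_eval_fixed:
  assumes \<sigma>: "comm_ring_hom \<sigma>" and "\<And>m. \<sigma> (Poly_Mapping.lookup A m) = Poly_Mapping.lookup A m"
  shows "mpoly_eval A (\<lambda>i. \<sigma> (z i)) = \<sigma> (mpoly_eval A z)"
proof -
  have "conj_poly \<sigma> A = A" unfolding conj_poly_def assms(2) by (rule mpoly_as_sum)
  then show ?thesis using mpoly_eval_conj[OF \<sigma>, of A z] by simp
qed

text \<open>
  Let \<open>A/B\<close> be a representation of the function with \<open>B q \<noteq> 0\<close>.  The conjugate \<open>A\<^sup>\<sigma>/B\<^sup>\<sigma>\<close> represents the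
  same function, because \<open>V\<close> and \<open>NN/DD\<close> are stable under conjugation, and at the fixed point \<open>q\<close>
  its value is \<open>\<sigma> r\<close>.
\<close>

lemma rational_place_value:
  assumes g: "generic_point \<iota> n V \<eta>" and P: "P \<in> V" "q \<in> P"
    and \<sigma>: "comm_ring_hom \<sigma>"
    and stable: "\<And>P x. P \<in> V \<Longrightarrow> x \<in> P \<Longrightarrow> \<exists>P'\<in>V. \<exists>x'\<in>P'. x = (\<lambda>i. \<sigma> (x' i))"
    and q: "\<And>i. \<sigma> (q i) = q i"
    and NN: "hom_poly n e NN" "hom_poly n e DD" "mev \<iota> DD \<eta> \<noteq> 0"
    and NEQ: "\<And>z. mpoly_eval NN (\<lambda>i. \<sigma> (z i)) = \<sigma> (mpoly_eval NN z)"
      "\<And>z. mpoly_eval DD (\<lambda>i. \<sigma> (z i)) = \<sigma> (mpoly_eval DD z)"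
    and r: "place_of \<iota> n \<eta> q (mev \<iota> NN \<eta> / mev \<iota> DD \<eta>) r"
  shows "\<sigma> r = r"
proof -
  interpret generic_point \<iota> n V \<eta> by fact
  interpret \<sigma>: comm_ring_hom \<sigma> by fact
  interpret pl: place \<iota> "function_field \<iota> n \<eta>" "place_of \<iota> n \<eta> q" by (rule place_at[OF P])
  note ev = mpoly_eval_mev id_mev
  obtain d A B where AB: "hom_poly n d A" "hom_poly n d B" "mpoly_eval B q \<noteq> 0"
    "mev \<iota> NN \<eta> / mev \<iota> DD \<eta> = mev \<iota> A \<eta> / mev \<iota> B \<eta>" "r = mpoly_eval A q / mpoly_eval B q"
    using r by (rule place_ofE)
  have B0: "mev \<iota> B \<eta> \<noteq> 0" using eval_eq_0[OF P AB(2)] AB(3) by blast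
  let ?A = "conj_poly \<sigma> A" and ?B = "conj_poly \<sigma> B"
  have hom: "hom_poly n (d + e) (A * DD - B * NN)" "hom_poly n (d + e) (?A * DD - ?B * NN)"
    by (intro hom_poly_diff hom_poly_mult hom_poly_conj AB NN)+
  have "mev \<iota> (A * DD - B * NN) \<eta> = 0"
    using AB(4) B0 NN(3) by (simp add: \<iota>.mev_diff \<iota>.mev_mult field_simps)
  then have van: "\<forall>P\<in>V. vanishes_at (A * DD - B * NN) P" using generic[OF hom(1)] by simp
  have "\<forall>P\<in>V. vanishes_at (?A * DD - ?B * NN) P"
    unfolding vanishes_at_def
  proof (intro ballI)
    fix P x assume "P \<in> V" "x \<in> P"
    then obtain P' x' where x': "P' \<in> V" "x' \<in> P'" "x = (\<lambda>i. \<sigma> (x' i))" using stable by blast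
    have "mpoly_eval (?A * DD - ?B * NN) x = \<sigma> (mpoly_eval (A * DD - B * NN) x')"
      unfolding x'(3) using mpoly_eval_conj[OF \<sigma>, of A x'] mpoly_eval_conj[OF \<sigma>, of B x'] NEQ[of x']
      by (simp add: ev \<sigma>.hom_minus \<sigma>.hom_mult)
    also have "mpoly_eval (A * DD - B * NN) x' = 0" using van x' by (auto simp: vanishes_at_def)
    finally show "mpoly_eval (?A * DD - ?B * NN) x = 0" by simp
  qed
  then have "mev \<iota> (?A * DD - ?B * NN) \<eta> = 0" using generic[OF hom(2)] by simp
  then have rel: "mev \<iota> ?A \<eta> * mev \<iota> DD \<eta> = mev \<iota> ?B \<eta> * mev \<iota> NN \<eta>" by (simp add: \<iota>.mev_diff \<iota>.mev_mult)
  have conj: "mpoly_eval ?A q = \<sigma> (mpoly_eval A q)" "mpoly_eval ?B q = \<sigma> (mpoly_eval B q)"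
    using mpoly_eval_conj[OF \<sigma>, of A q] mpoly_eval_conj[OF \<sigma>, of B q] by (simp_all add: q)
  have inv: "\<sigma> (mpoly_eval B q) * \<sigma> (inverse (mpoly_eval B q)) = 1"
    using AB(3) by (simp add: \<sigma>.hom_mult[symmetric])
  then have B'q: "mpoly_eval ?B q \<noteq> 0" unfolding conj by auto
  then have "mev \<iota> ?B \<eta> \<noteq> 0" using eval_eq_0[OF P hom_poly_conj[OF AB(2)]] by blast
  then have "mev \<iota> NN \<eta> / mev \<iota> DD \<eta> = mev \<iota> ?A \<eta> / mev \<iota> ?B \<eta>" using rel NN(3) by (simp add: field_simps)
  then have "place_of \<iota> n \<eta> q (mev \<iota> NN \<eta> / mev \<iota> DD \<eta>) (mpoly_eval ?A q / mpoly_eval ?B q)"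
    unfolding place_of_def using hom_poly_conj[OF AB(1)] hom_poly_conj[OF AB(2)] B'q by blast
  then have "r = mpoly_eval ?A q / mpoly_eval ?B q" using pl.functional r by blast
  also have "\<dots> = \<sigma> (mpoly_eval A q) * \<sigma> (inverse (mpoly_eval B q))"
    unfolding conj using inv B'q unfolding conj by (simp add: field_simps)
  also have "\<dots> = \<sigma> r" unfolding AB(5) by (simp add: \<sigma>.hom_mult[symmetric] divide_inverse)
  finally show ?thesis by simp
qed

subsection \<open>Transfer of generic points\<close>

lemma proj_pt_eq_imp_scale: "proj_pt x = proj_pt y \<Longrightarrow> \<exists>a. a \<noteq> 0 \<and> x = (\<lambda>i. a * y i)"
  using proj_pt_self[of x] by (auto simp: proj_pt_def)

lemma map_pt_proj_pt:
  fixes x :: "nat \<Rightarrow> 'a::field"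
  assumes "\<And>i. i \<le> n \<Longrightarrow> hom_poly m d (F i)"
  shows "map_pt n F (proj_pt x) = proj_pt (tuple_eval n F x)"
proof -
  have "proj_pt (tuple_eval n F y) = proj_pt (tuple_eval n F x)" if y: "y \<in> proj_pt x" for y
  proof -
    obtain a where a: "a \<noteq> 0" "y = (\<lambda>i. a * x i)" using y by (auto simp: proj_pt_def)
    have "tuple_eval n F y = (\<lambda>i. a ^ d * tuple_eval n F x i)"
      unfolding a(2) tuple_eval_def by (intro ext) (simp add: mpoly_eval_scale[OF assms])
    then show ?thesis using proj_pt_scale[of "a ^ d"] a by simp
  qed
  then show ?thesis unfolding map_pt_def using proj_pt_self by blast
qed

lemma defined_at_proj_pt:
  fixes x :: "nat \<Rightarrow> 'a::field"
  assumes "\<And>i. i \<le> n \<Longrightarrow> hom_poly m d (F i)"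
  shows "defined_at n F (proj_pt x) \<longleftrightarrow> (\<exists>i\<le>n. mpoly_eval (F i) x \<noteq> 0)"
  unfolding defined_at_def using vanishes_at_proj_pt[OF assms] by blast

lemma vanishes_on_closed:
  assumes "zariski_closed n V" "\<forall>f\<in>S. form n f"
  shows "zariski_closed n {P \<in> V. \<forall>f\<in>S. vanishes_at f P}"
proof -
  obtain T where T: "\<forall>f\<in>T. form n f" "V = proj_zeros n T" using assms by (auto simp: zariski_closed_def)
  have "{P \<in> V. \<forall>f\<in>S. vanishes_at f P} = proj_zeros n (T \<union> S)" unfolding T proj_zeros_def by blast
  moreover have "\<forall>f\<in>T \<union> S. form n f" using T(1) assms(2) by (auto dest: bspec)
  ultimately show ?thesis unfolding zariski_closed_def by (intro exI[of _ "T \<union> S"] conjI)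
qed

definition image_point :: "('a::field \<Rightarrow> 'm::field) \<Rightarrow> nat \<Rightarrow> (nat \<Rightarrow> 'a mpoly) \<Rightarrow> (nat \<Rightarrow> 'm) \<Rightarrow> nat \<Rightarrow> 'm" where
  "image_point \<iota> m F \<xi> = (\<lambda>i. if i \<le> m then mev \<iota> (F i) \<xi> else 0)"

text \<open>
  Birational maps carry generic points to generic points.  A form \<open>A\<close> that vanishes at the image of
  \<open>\<eta>\<close> vanishes at every point of \<open>W\<close> at which the composite \<open>F \<circ> G\<close> is defined; the other points
  of \<open>W\<close> lie on the common zero set of all the products \<open>G\<^sub>k \<cdot> (F\<^sub>i \<circ> G)\<close>, a proper closed subset,
  so irreducibility of \<open>W\<close> gives the claim.  The composite \<open>G \<circ> F\<close> fixes \<open>\<eta>\<close> up to scaling because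
  the expressions \<open>(G\<^sub>i \<circ> F) X\<^sub>k - (G\<^sub>k \<circ> F) X\<^sub>i\<close> vanish wherever \<open>F\<close> is defined; the factor \<open>F\<^sub>l\<close>
  extends this to all of \<open>V\<close>.
\<close>

lemma (in generic_point) birational_generic_point:
  assumes irr: "irreducible_closed m W"
    and F: "\<And>i. i \<le> m \<Longrightarrow> hom_poly n d (F i)" and G: "\<And>i. i \<le> n \<Longrightarrow> hom_poly m e (G i)"
    and FW: "\<And>P. P \<in> V \<Longrightarrow> defined_at m F P \<Longrightarrow> map_pt m F P \<in> W"
    and GV: "\<And>P. P \<in> W \<Longrightarrow> defined_at n G P \<Longrightarrow> map_pt n G P \<in> V"
    and FG: "left_inverse_on m n W G F" and GF: "left_inverse_on n m V F G"
  shows "generic_point \<iota> m W (image_point \<iota> m F \<eta>)"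
    and "\<exists>c. c \<noteq> 0 \<and> (\<forall>i\<le>n. mev \<iota> (G i) (image_point \<iota> m F \<eta>) = c * \<eta> i)"
    and "function_field \<iota> m (image_point \<iota> m F \<eta>) = function_field \<iota> n \<eta>"
proof -
  let ?\<eta> = "image_point \<iota> m F \<eta>"
  note ev = mpoly_eval_mev id_mev
  have mev_F: "mev \<iota> (msubst A F) \<eta> = mev \<iota> A ?\<eta>" if "hom_poly m k A" for A k
    unfolding mev_msubst[OF hom] by (rule mev_cong[OF that]) (simp add: image_point_def)
  have eval_F: "mpoly_eval (msubst A F) x = mpoly_eval A (tuple_eval m F x)" if "hom_poly m k A" for A k x
    unfolding mpoly_eval_mev mev_msubst[OF id_comm_ring_hom]
    by (rule mev_cong[OF that]) (simp add: tuple_eval_def mpoly_eval_mev)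
  have eval_G: "mpoly_eval (msubst A G) x = mpoly_eval A (tuple_eval n G x)" if "hom_poly n k A" for A k x
    unfolding mpoly_eval_mev mev_msubst[OF id_comm_ring_hom]
    by (rule mev_cong[OF that]) (simp add: tuple_eval_def mpoly_eval_mev)
  have dF: "defined_at m F (proj_pt x) \<longleftrightarrow> (\<exists>i\<le>m. mpoly_eval (F i) x \<noteq> 0)" for x
    by (rule defined_at_proj_pt) (rule F)
  have dG: "defined_at n G (proj_pt x) \<longleftrightarrow> (\<exists>i\<le>n. mpoly_eval (G i) x \<noteq> 0)" for x
    by (rule defined_at_proj_pt) (rule G)
  have mF: "map_pt m F (proj_pt x) = proj_pt (tuple_eval m F x)" for x
    by (rule map_pt_proj_pt) (rule F)
  have mG: "map_pt n G (proj_pt x) = proj_pt (tuple_eval n G x)" for x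
    by (rule map_pt_proj_pt) (rule G)
  have hF: "hom_poly n (k * d) (msubst A F)" if "hom_poly m k A" for A k by (rule hom_poly_msubst[OF that]) (rule F)
  have hG: "hom_poly m (k * e) (msubst A G)" if "hom_poly n k A" for A k by (rule hom_poly_msubst[OF that]) (rule G)
  have W: "zariski_closed m W" "W \<noteq> {}" "W \<subseteq> proj_space m"
    using irr by (auto simp: irreducible_closed_def zariski_closed_def proj_zeros_def)
  have F_zero_or: "mpoly_eval (F i) x = 0" if "\<not> defined_at m F (proj_pt x)" "i \<le> m" for i x
    using that unfolding dF by blast
  have rep: "\<exists>x. P = proj_pt x" if "P \<in> V \<or> P \<in> W" for P
    using that sub W(3) proj_space_rep by blast
  have generic_W: "mev \<iota> A ?\<eta> = 0 \<longleftrightarrow> (\<forall>P\<in>W. vanishes_at A P)" if A: "hom_poly m k A" for A k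
  proof
    assume van: "\<forall>P\<in>W. vanishes_at A P"
    have "\<forall>P\<in>V. vanishes_at (msubst A F) P"
    proof
      fix P assume P: "P \<in> V"
      then obtain x where x: "P = proj_pt x" using rep by blast
      have "mpoly_eval A (tuple_eval m F x) = 0"
      proof (cases "defined_at m F P")
        case True
        then have "proj_pt (tuple_eval m F x) \<in> W" using FW[OF P] mF x by simp
        then show ?thesis using van proj_pt_self by (auto simp: vanishes_at_def)
      next
        case False
        \<comment> \<open>a form vanishing somewhere on \<open>W\<close> also vanishes at the origin, by scaling\<close>
        then have "tuple_eval m F x = (\<lambda>i. 0)" using F_zero_or x by (auto simp: tuple_eval_def)
        obtain Q y where "Q \<in> W" "y \<in> Q" using W(2) rep proj_pt_self by blast
        then have "mpoly_eval A y = 0" using van by (auto simp: vanishes_at_def)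
        then have "mpoly_eval A (\<lambda>i. 0 * y i) = 0" using mpoly_eval_scale[OF A, of 0 y] by simp
        then show ?thesis using \<open>tuple_eval m F x = (\<lambda>i. 0)\<close> by simp
      qed
      then show "vanishes_at (msubst A F) P"
        unfolding x vanishes_at_proj_pt[OF hF[OF A]] eval_F[OF A] .
    qed
    then show "mev \<iota> A ?\<eta> = 0" using generic[OF hF[OF A]] mev_F[OF A] by simp
  next
    assume "mev \<iota> A ?\<eta> = 0"
    then have van: "\<forall>P\<in>V. vanishes_at (msubst A F) P" using generic[OF hF[OF A]] mev_F[OF A] by simp
    define Z1 where "Z1 = {P \<in> W. \<forall>f\<in>{A}. vanishes_at f P}"
    define Z2 where "Z2 = {P \<in> W. \<forall>f\<in>{G k * msubst (F i) G | i k. i \<le> m \<and> k \<le> n}. vanishes_at f P}"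
    have hGF: "hom_poly m (e + d * e) (G k * msubst (F i) G)" if "i \<le> m" "k \<le> n" for i k
      using that by (intro hom_poly_mult G hG F)
    have ev_GF: "mpoly_eval (G k * msubst (F i) G) y = mpoly_eval (G k) y * mpoly_eval (F i) (tuple_eval n G y)"
      if "i \<le> m" for i k y
      using eval_G[OF F[OF that]] by (simp add: ev)
    have closed: "zariski_closed m Z1" "zariski_closed m Z2"
      unfolding Z1_def Z2_def by (intro vanishes_on_closed[OF W(1)]; use A hGF in \<open>auto simp: form_def\<close>)+
    have "P \<in> Z1" if P: "P \<in> W" "P \<notin> Z2" for P
    proof -
      obtain y where y: "P = proj_pt y" using rep P by blast
      obtain i k where ik: "i \<le> m" "k \<le> n" "\<not> vanishes_at (G k * msubst (F i) G) P" using P by (auto simp: Z2_def)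
      then have nz: "mpoly_eval (G k) y \<noteq> 0" "mpoly_eval (F i) (tuple_eval n G y) \<noteq> 0"
        unfolding y vanishes_at_proj_pt[OF hGF[OF ik(1,2)]] ev_GF[OF ik(1)] by auto
      then have True: "defined_at n G P" unfolding y dG using ik by blast
      show ?thesis
      proof -
        have GP: "map_pt n G P = proj_pt (tuple_eval n G y)" unfolding y by (rule mG)
        have "defined_at m F (map_pt n G P)" unfolding GP dF using nz ik by blast
        then have "map_pt m F (map_pt n G P) = P" using FG P(1) True by (auto simp: left_inverse_on_def)
        then have eq: "proj_pt (tuple_eval m F (tuple_eval n G y)) = P" unfolding GP mF .
        have "vanishes_at (msubst A F) (proj_pt (tuple_eval n G y))" using van GV[OF P(1) True] GP by simp
        then have "mpoly_eval A (tuple_eval m F (tuple_eval n G y)) = 0"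
          unfolding vanishes_at_proj_pt[OF hF[OF A]] eval_F[OF A] .
        then have "vanishes_at A P" unfolding eq[symmetric] vanishes_at_proj_pt[OF A] .
        then show ?thesis using P by (simp add: Z1_def)
      qed
    qed
    then have "W = Z1 \<union> Z2" by (auto simp: Z1_def Z2_def)
    then have "W = Z1 \<or> W = Z2" using irr closed unfolding irreducible_closed_def by blast
    moreover have "W \<noteq> Z2"
    proof -
      obtain P where P: "P \<in> W" "defined_at n G P" "defined_at m F (map_pt n G P)"
        using FG by (auto simp: left_inverse_on_def)
      obtain y where y: "P = proj_pt y" using rep P by blast
      obtain i where i: "i \<le> m" "mpoly_eval (F i) (tuple_eval n G y) \<noteq> 0"
        using P(3) unfolding y mG dF by blast
      obtain k where k: "k \<le> n" "mpoly_eval (G k) y \<noteq> 0"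
        using P(2) unfolding y dG by blast
      have "\<not> vanishes_at (G k * msubst (F i) G) P"
        unfolding y vanishes_at_proj_pt[OF hGF[OF i(1) k(1)]] ev_GF[OF i(1)] using i k by simp
      then have "P \<notin> Z2" using i k by (auto simp: Z2_def)
      then show ?thesis using P(1) by blast
    qed
    ultimately show "\<forall>P\<in>W. vanishes_at A P" by (auto simp: Z1_def)
  qed
  show 1: "generic_point \<iota> m W ?\<eta>"
    by unfold_locales (use hom W(3) generic_W in auto)
  interpret W: generic_point \<iota> m W ?\<eta> by (rule 1)
  obtain P0 where P0: "P0 \<in> V" "defined_at m F P0" "defined_at n G (map_pt m F P0)"
    using GF by (auto simp: left_inverse_on_def)
  obtain x0 where x0: "P0 = proj_pt x0" using rep P0 by blast
  have x0P: "x0 \<in> P0" by (simp add: x0 proj_pt_self)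
  obtain l where l: "l \<le> m" "mpoly_eval (F l) x0 \<noteq> 0" using P0(2) unfolding x0 dF by blast
  have Fl: "mev \<iota> (F l) \<eta> \<noteq> 0" using eval_eq_0[OF P0(1) x0P F[OF l(1)]] l by blast
  have GFeq: "mev \<iota> (G i) ?\<eta> * \<eta> k = mev \<iota> (G k) ?\<eta> * \<eta> i" if i: "i \<le> n" and k: "k \<le> n" for i k
  proof -
    define A where "A = F l * (msubst (G i) F * Var k - msubst (G k) F * Var i)"
    have hA: "hom_poly n (d + (e * d + 1)) A"
      unfolding A_def by (intro hom_poly_mult hom_poly_diff hF G F hom_poly_Var i k l)
    have "\<forall>P\<in>V. vanishes_at A P"
    proof
      fix P assume P: "P \<in> V"
      then obtain x where x: "P = proj_pt x" using rep by blast
      let ?g = "tuple_eval n G (tuple_eval m F x)"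
      have Ax: "mpoly_eval A x = mpoly_eval (F l) x * (?g i * x k - ?g k * x i)"
        using eval_F[OF G[OF i]] eval_F[OF G[OF k]] i k by (simp add: A_def ev tuple_eval_def)
      have "mpoly_eval A x = 0"
      proof (cases "defined_at m F P \<and> defined_at n G (map_pt m F P)")
        case True
        then have "map_pt n G (map_pt m F P) = P" using GF P by (auto simp: left_inverse_on_def)
        then have "proj_pt ?g = proj_pt x" unfolding x mF mG .
        then obtain a where "?g = (\<lambda>i. a * x i)" using proj_pt_eq_imp_scale by blast
        then show ?thesis unfolding Ax by simp
      next
        case False
        then have "mpoly_eval (F l) x = 0 \<or> (?g i = 0 \<and> ?g k = 0)"
          using l i k unfolding x mF dF dG
          by (auto simp: tuple_eval_def)
        then show ?thesis unfolding Ax by auto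
      qed
      then show "vanishes_at A P" unfolding x vanishes_at_proj_pt[OF hA] .
    qed
    then have "mev \<iota> A \<eta> = 0" using generic[OF hA] by simp
    then show ?thesis using Fl mev_F[OF G[OF i]] mev_F[OF G[OF k]]
      by (simp add: A_def \<iota>.mev_mult \<iota>.mev_diff \<iota>.mev_single)
  qed
  show 2: "\<exists>c. c \<noteq> 0 \<and> (\<forall>i\<le>n. mev \<iota> (G i) ?\<eta> = c * \<eta> i)"
  proof -
    obtain k where k: "k \<le> n" "x0 k \<noteq> 0" using proj_space_E(3)[of P0 n x0] sub P0(1) x0P by blast
    have ek: "\<eta> k \<noteq> 0" using coordinate_nonzero[OF P0(1) x0P k] .
    define c where "c = mev \<iota> (G k) ?\<eta> / \<eta> k"
    have c: "mev \<iota> (G i) ?\<eta> = c * \<eta> i" if "i \<le> n" for i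
      using GFeq[OF that k(1)] ek by (simp add: c_def field_simps)
    obtain i where i: "i \<le> n" "mpoly_eval (G i) (tuple_eval m F x0) \<noteq> 0"
      using P0(3) unfolding x0 mF dG by blast
    then have "mpoly_eval (msubst (G i) F) x0 \<noteq> 0" using eval_F[OF G] by simp
    then have "mev \<iota> (G i) ?\<eta> \<noteq> 0" using eval_eq_0[OF P0(1) x0P hF[OF G[OF i(1)]]] mev_F[OF G[OF i(1)]] by auto
    then have "c \<noteq> 0" using c[OF i(1)] by auto
    then show ?thesis using c by blast
  qed
  then obtain c where c: "c \<noteq> 0" "\<And>i. i \<le> n \<Longrightarrow> mev \<iota> (G i) ?\<eta> = c * \<eta> i" by blast
  have mev_G: "mev \<iota> (msubst A G) ?\<eta> = c ^ k * mev \<iota> A \<eta>" if "hom_poly n k A" for A k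
    unfolding mev_msubst[OF hom] mev_scale[OF that, symmetric] by (rule mev_cong[OF that]) (simp add: c)
  show "function_field \<iota> m ?\<eta> = function_field \<iota> n \<eta>"
  proof (intro Set.set_eqI iffI)
    fix a assume "a \<in> function_field \<iota> m ?\<eta>"
    then obtain A B k where "a = mev \<iota> A ?\<eta> / mev \<iota> B ?\<eta>" "hom_poly m k A" "hom_poly m k B" "mev \<iota> B ?\<eta> \<noteq> 0"
      by (auto simp: function_field_def)
    then show "a \<in> function_field \<iota> n \<eta>" unfolding function_field_def
      by (intro CollectI exI[of _ "msubst A F"] exI[of _ "msubst B F"] exI[of _ "k * d"]) (simp add: hF mev_F)
  next
    fix a assume "a \<in> function_field \<iota> n \<eta>"
    then obtain A B k where "a = mev \<iota> A \<eta> / mev \<iota> B \<eta>" "hom_poly n k A" "hom_poly n k B" "mev \<iota> B \<eta> \<noteq> 0"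
      by (auto simp: function_field_def)
    then show "a \<in> function_field \<iota> m ?\<eta>" unfolding function_field_def using c
      by (intro CollectI exI[of _ "msubst A G"] exI[of _ "msubst B G"] exI[of _ "k * e"]) (simp add: hG mev_G)
  qed
qed

section \<open>Counting rational points on smooth models\<close>

lemma scale_in_point:
  assumes "P \<in> proj_space n" "q \<in> P" "a \<noteq> 0" shows "(\<lambda>i. a * q i) \<in> P"
  using proj_pt_scale[OF assms(3), of q] proj_pt_self[of "\<lambda>i. a * q i"] proj_space_E(1)[OF assms(1,2)] by simp

text \<open>
  A relation that is total and single-valued in both directions is the graph of a bijection.
\<close>

lemma card_eq_if_matching:
  assumes "\<And>a. a \<in> A \<Longrightarrow> \<exists>b\<in>B. R a b" "\<And>b. b \<in> B \<Longrightarrow> \<exists>a\<in>A. R a b"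
    and "\<And>a b b'. a \<in> A \<Longrightarrow> b \<in> B \<Longrightarrow> b' \<in> B \<Longrightarrow> R a b \<Longrightarrow> R a b' \<Longrightarrow> b = b'"
    and "\<And>a a' b. a \<in> A \<Longrightarrow> a' \<in> A \<Longrightarrow> b \<in> B \<Longrightarrow> R a b \<Longrightarrow> R a' b \<Longrightarrow> a = a'"
  shows "card A = card B"
proof (rule bij_betw_same_card)
  define f where "f a = (SOME b. b \<in> B \<and> R a b)" for a
  have f: "f a \<in> B \<and> R a (f a)" if "a \<in> A" for a
    unfolding f_def by (rule someI_ex) (use assms(1)[OF that] in blast)
  show "bij_betw f A B"
  proof (rule bij_betwI')
    show "f x = f y \<longleftrightarrow> x = y" if "x \<in> A" "y \<in> A" for x y
      using assms(4)[OF that] f[OF that(1)] f[OF that(2)] by metis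
    show "f x \<in> B" if "x \<in> A" for x using f[OF that] by blast
    show "\<exists>x\<in>A. y = f x" if y: "y \<in> B" for y
    proof -
      obtain a where "a \<in> A" "R a y" using assms(2)[OF y] by blast
      then show ?thesis using assms(3)[OF _ y] f by blast
    qed
  qed
qed

text \<open>
  The two properties of the Frobenius automorphism that matter for rationality: it is a bijective
  ring endomorphism of the algebraic closure, and its fixed points form the base field.
\<close>

locale frobenius =
  fixes \<sigma> :: "'k::field alg_closure \<Rightarrow> 'k alg_closure"
  assumes \<sigma>_hom: "comm_ring_hom \<sigma>" and \<sigma>_surj: "surj \<sigma>" and base_fixed: "base_field = {a. \<sigma> a = a}"
begin

sublocale \<sigma>: comm_ring_hom \<sigma> by (rule \<sigma>_hom)

lemma \<sigma>_eq_0: "\<sigma> a = 0 \<longleftrightarrow> a = 0"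
proof
  assume a: "\<sigma> a = 0"
  show "a = 0"
  proof (rule ccontr)
    assume "a \<noteq> 0"
    then have "\<sigma> a * \<sigma> (inverse a) = 1" by (simp add: \<sigma>.hom_mult[symmetric])
    then show False using a by simp
  qed
qed simp

lemma over_base_eval:
  assumes "over_base f" shows "mpoly_eval f (\<lambda>i. \<sigma> (z i)) = \<sigma> (mpoly_eval f z)"
  by (rule mpoly_eval_fixed[OF \<sigma>_hom]) (use assms base_fixed in \<open>auto simp: over_base_def\<close>)

lemma proj_zeros_stable:
  assumes S: "\<forall>f\<in>S. form n f \<and> over_base f" and P: "P \<in> proj_zeros n S" "x \<in> P"
  shows "\<exists>P'\<in>proj_zeros n S. \<exists>x'\<in>P'. x = (\<lambda>i. \<sigma> (x' i))"
proof -
  define x' where "x' i = (SOME a. \<sigma> a = x i)" for i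
  have x': "\<sigma> (x' i) = x i" for i unfolding x'_def by (rule someI_ex) (metis \<sigma>_surj surj_def)
  have Psp: "P \<in> proj_space n" using P by (simp add: proj_zeros_def)
  note E = proj_space_E[OF Psp P(2)]
  have "x' i = 0" if "i > n" for i using E(2)[OF that] x'[of i] \<sigma>_eq_0 by metis
  moreover obtain i where "i \<le> n" "x' i \<noteq> 0" using E(3) x' \<sigma>_eq_0 by metis
  ultimately have sp: "proj_pt x' \<in> proj_space n" by (intro proj_pt_in_proj_space)
  have "vanishes_at f (proj_pt x')" if f: "f \<in> S" for f
  proof -
    obtain d where d: "hom_poly n d f" using S f by (auto simp: form_def)
    have "mpoly_eval f x = 0" using P f by (auto simp: proj_zeros_def vanishes_at_def)
    moreover have "mpoly_eval f x = \<sigma> (mpoly_eval f x')"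
      using over_base_eval[of f x'] S f x' by simp
    ultimately show ?thesis using \<sigma>_eq_0 vanishes_at_proj_pt[OF d] by simp
  qed
  then have "proj_pt x' \<in> proj_zeros n S" using sp by (simp add: proj_zeros_def)
  then show ?thesis using proj_pt_self x' by (metis (no_types, lifting) ext)
qed

end

text \<open>
  Representatives of a point give the same place, so one with a coordinate equal to \<open>1\<close> may be chosen.
\<close>

lemma (in generic_point) nonsingular_curve_valuation:
  assumes ns: "nonsingular_curve n V" and P: "P \<in> V" "q \<in> P"
    and dep: "\<And>a b. a \<in> function_field \<iota> n \<eta> \<Longrightarrow> b \<in> function_field \<iota> n \<eta> \<Longrightarrow>
      \<exists>P :: 'a poly poly. P \<noteq> 0 \<and> poly (map_poly (\<lambda>p. poly (map_poly \<iota> p) b) P) a = 0"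
  shows "place.valuation (function_field \<iota> n \<eta>) (place_of \<iota> n \<eta> q)"
proof -
  have Psp: "P \<in> proj_space n" using P sub by blast
  obtain j where j: "j \<le> n" "q j \<noteq> 0" using proj_space_E(3)[OF Psp P(2)] by blast
  define q' where "q' = (\<lambda>i. inverse (q j) * q i)"
  have q': "q' \<in> P" unfolding q'_def using j by (intro scale_in_point[OF Psp P(2)]) simp
  have "q' j = 1" using j by (simp add: q'_def)
  moreover have "jacobian_rank n V q' = n - 1" using ns P q' by (simp add: nonsingular_curve_def)
  ultimately have "place.valuation (function_field \<iota> n \<eta>) (place_of \<iota> n \<eta> q')"
    using nonsingular_imp_valuation[OF P(1) q' j(1)] dep by blast
  moreover have "place_of \<iota> n \<eta> q' = place_of \<iota> n \<eta> q" unfolding q'_def using j by (intro place_of_scale) simp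
  ultimately show ?thesis by simp
qed

text \<open>
  The assumption \<open>dependent\<close> expresses that the function field has transcendence degree at most one.
\<close>

locale curve_with_generic_point = frobenius \<sigma> + C: generic_point \<iota> 2 C \<xi>
  for \<sigma> :: "'k::field alg_closure \<Rightarrow> 'k alg_closure" and \<iota> :: "'k alg_closure \<Rightarrow> 'm::field" and C \<xi> +
  assumes dependent: "a \<in> function_field \<iota> 2 \<xi> \<Longrightarrow> b \<in> function_field \<iota> 2 \<xi> \<Longrightarrow>
      \<exists>P :: 'k alg_closure poly poly. P \<noteq> 0 \<and> poly (map_poly (\<lambda>p. poly (map_poly \<iota> p) b) P) a = 0"
begin

text \<open>
  What a smooth model inherits from a generic point \<open>\<xi>\<close> of the affine curve: a generic point with the
  same function field, valuation rings at all points, stability under Frobenius, and birational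
  maps \<open>F\<close>, \<open>G\<close> over the base field.
\<close>

definition model_data where
  "model_data n E \<eta> F G d e \<longleftrightarrow> generic_point \<iota> n E \<eta> \<and> zariski_closed n E \<and> E \<noteq> {} \<and>
     function_field \<iota> n \<eta> = function_field \<iota> 2 \<xi> \<and>
     (\<forall>P\<in>E. \<forall>q\<in>P. place.valuation (function_field \<iota> n \<eta>) (place_of \<iota> n \<eta> q)) \<and>
     (\<forall>P\<in>E. \<forall>x\<in>P. \<exists>P'\<in>E. \<exists>x'\<in>P'. x = (\<lambda>i. \<sigma> (x' i))) \<and>
     \<eta> = image_point \<iota> n F \<xi> \<and>
     (\<forall>i\<le>n. hom_poly 2 d (F i) \<and> over_base (F i)) \<and> (\<forall>i\<le>2. hom_poly n e (G i) \<and> over_base (G i)) \<and>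
     (\<exists>c. c \<noteq> 0 \<and> (\<forall>i\<le>2. mev \<iota> (G i) \<eta> = c * \<xi> i))"

lemma model_dataD:
  assumes "model_data n E \<eta> F G d e"
  shows "generic_point \<iota> n E \<eta>" "zariski_closed n E" "E \<noteq> {}"
    "function_field \<iota> n \<eta> = function_field \<iota> 2 \<xi>"
    "\<And>P q. P \<in> E \<Longrightarrow> q \<in> P \<Longrightarrow> place.valuation (function_field \<iota> n \<eta>) (place_of \<iota> n \<eta> q)"
    "\<And>P x. P \<in> E \<Longrightarrow> x \<in> P \<Longrightarrow> \<exists>P'\<in>E. \<exists>x'\<in>P'. x = (\<lambda>i. \<sigma> (x' i))"
    "\<eta> = image_point \<iota> n F \<xi>"
    "\<And>i. i \<le> n \<Longrightarrow> hom_poly 2 d (F i)" "\<And>i. i \<le> n \<Longrightarrow> over_base (F i)"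
    "\<And>i. i \<le> 2 \<Longrightarrow> hom_poly n e (G i)" "\<And>i. i \<le> 2 \<Longrightarrow> over_base (G i)"
    "\<exists>c. c \<noteq> 0 \<and> (\<forall>i\<le>2. mev \<iota> (G i) \<eta> = c * \<xi> i)"
  using assms unfolding model_data_def by (elim conjE; simp)+

lemma smooth_model_data:
  assumes "smooth_projective_model C n E"
  shows "\<exists>\<eta> F G d e. model_data n E \<eta> F G d e"
proof -
  have curve: "projective_curve n E" and ns: "nonsingular_curve n E" and bir: "birational 2 n C E"
    using assms by (auto simp: smooth_projective_model_def)
  have irr: "irreducible_closed n E" using curve by (simp add: projective_curve_def)
  obtain S where S: "\<forall>f\<in>S. form n f \<and> over_base f" "E = proj_zeros n S"
    using curve unfolding projective_curve_def by blast
  obtain F G where FG: "rational_map 2 n C E F" "rational_map n 2 E C G"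
    "left_inverse_on 2 n C F G" "left_inverse_on n 2 E G F" using bir unfolding birational_def by blast
  obtain d where F: "\<forall>i\<le>n. hom_poly 2 d (F i) \<and> over_base (F i)"
    "\<forall>P\<in>C. defined_at n F P \<longrightarrow> map_pt n F P \<in> E" using FG(1) unfolding rational_map_def by blast
  obtain e where G: "\<forall>i\<le>2. hom_poly n e (G i) \<and> over_base (G i)"
    "\<forall>P\<in>E. defined_at 2 G P \<longrightarrow> map_pt 2 G P \<in> C" using FG(2) unfolding rational_map_def by blast
  note transfer = C.birational_generic_point[OF irr, of d F e G, OF _ _ _ _ FG(4,3)]
  have 1: "generic_point \<iota> n E (image_point \<iota> n F \<xi>)" by (rule transfer(1)) (use F G in auto)
  have 2: "\<exists>c. c \<noteq> 0 \<and> (\<forall>i\<le>2. mev \<iota> (G i) (image_point \<iota> n F \<xi>) = c * \<xi> i)"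
    by (rule transfer(2)) (use F G in auto)
  have 3: "function_field \<iota> n (image_point \<iota> n F \<xi>) = function_field \<iota> 2 \<xi>"
    by (rule transfer(3)) (use F G in auto)
  interpret E: generic_point \<iota> n E "image_point \<iota> n F \<xi>" by (rule 1)
  have 4: "place.valuation (function_field \<iota> n (image_point \<iota> n F \<xi>)) (place_of \<iota> n (image_point \<iota> n F \<xi>) q)"
    if "P \<in> E" "q \<in> P" for P q
    by (rule E.nonsingular_curve_valuation[OF ns that]) (use dependent 3 in simp)
  have 5: "\<exists>P'\<in>E. \<exists>x'\<in>P'. x = (\<lambda>i. \<sigma> (x' i))" if "P \<in> E" "x \<in> P" for P x
    using proj_zeros_stable[OF S(1)] that unfolding S(2) by blast
  have "zariski_closed n E" "E \<noteq> {}" using irr by (auto simp: irreducible_closed_def)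
  then have "model_data n E (image_point \<iota> n F \<xi>) F G d e"
    unfolding model_data_def using 1 2 3 4 5 F(1) G(1) by (intro conjI) blast+
  then show ?thesis by blast
qed

text \<open>
  The correspondence between the points of two models of one function field.
\<close>

definition same_place where
  "same_place n1 \<eta>1 n2 \<eta>2 P1 P2 \<longleftrightarrow> (\<exists>q1\<in>P1. \<exists>q2\<in>P2. place_of \<iota> n1 \<eta>1 q1 = place_of \<iota> n2 \<eta>2 q2)"

lemma same_place_sym: "same_place n1 \<eta>1 n2 \<eta>2 P1 P2 \<Longrightarrow> same_place n2 \<eta>2 n1 \<eta>1 P2 P1"
  unfolding same_place_def by metis

lemma place_of_representative:
  assumes "P \<in> proj_space n" "q \<in> P" "q' \<in> P"
  shows "place_of \<iota> n \<eta> q = place_of \<iota> n \<eta> q'"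
proof -
  have "q \<in> proj_pt q'" using assms proj_space_E(1)[OF assms(1,3)] by simp
  then obtain a where "a \<noteq> 0" "q = (\<lambda>i. a * q' i)" by (auto simp: proj_pt_def)
  then show ?thesis by (simp add: place_of_scale)
qed

lemma same_place_unique:
  assumes m1: "model_data n1 E1 \<eta>1 F1 G1 d1 e1" and m2: "model_data n2 E2 \<eta>2 F2 G2 d2 e2"
    and P: "P1 \<in> E1" "P2 \<in> E2" "P2' \<in> E2"
    and s: "same_place n1 \<eta>1 n2 \<eta>2 P1 P2" "same_place n1 \<eta>1 n2 \<eta>2 P1 P2'"
  shows "P2 = P2'"
proof -
  have g: "generic_point \<iota> n1 E1 \<eta>1" "generic_point \<iota> n2 E2 \<eta>2" using model_dataD(1) m1 m2 by blast+
  obtain q1 q2 where q: "q1 \<in> P1" "q2 \<in> P2" "place_of \<iota> n1 \<eta>1 q1 = place_of \<iota> n2 \<eta>2 q2"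
    using s(1) by (auto simp: same_place_def)
  obtain q1' q2' where q': "q1' \<in> P1" "q2' \<in> P2'" "place_of \<iota> n1 \<eta>1 q1' = place_of \<iota> n2 \<eta>2 q2'"
    using s(2) by (auto simp: same_place_def)
  have "P1 \<in> proj_space n1" using generic_point.sub[OF g(1)] P by blast
  then have "place_of \<iota> n1 \<eta>1 q1 = place_of \<iota> n1 \<eta>1 q1'" using q(1) q'(1) by (rule place_of_representative)
  then show ?thesis using q q' by (intro place_determines_point[OF g(2) P(2) q(2) P(3) q'(2)]) simp
qed

text \<open>
  The coordinates of the partner of a rational point are the residues of \<open>\<eta>2 i / \<eta>2 j\<close>.  As functions
  on the first model they are quotients of the forms \<open>F2 \<circ> G1\<close>, whose coefficients are fixed by
  Frobenius, so their values at a rational point are fixed as well.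
\<close>

lemma rational_point_transfer:
  assumes m1: "model_data n1 E1 \<eta>1 F1 G1 d1 e1" and m2: "model_data n2 E2 \<eta>2 F2 G2 d2 e2"
    and P1: "P1 \<in> rational_points E1"
  shows "\<exists>P2\<in>rational_points E2. same_place n1 \<eta>1 n2 \<eta>2 P1 P2"
proof -
  have g1: "generic_point \<iota> n1 E1 \<eta>1" and g2: "generic_point \<iota> n2 E2 \<eta>2" using model_dataD(1) m1 m2 by blast+
  interpret g1: generic_point \<iota> n1 E1 \<eta>1 by (rule g1)
  interpret g2: generic_point \<iota> n2 E2 \<eta>2 by (rule g2)
  obtain q1 where q1: "P1 \<in> E1" "q1 \<in> P1" "range q1 \<subseteq> base_field" using P1 by (auto simp: rational_points_def)
  have fixed: "\<sigma> (q1 i) = q1 i" for i using q1(3) base_fixed by blast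
  have ff: "function_field \<iota> n1 \<eta>1 = function_field \<iota> n2 \<eta>2" using model_dataD(4)[OF m1] model_dataD(4)[OF m2] by simp
  have "\<exists>P2\<in>E2. \<exists>q2\<in>P2. place_of \<iota> n1 \<eta>1 q1 = place_of \<iota> n2 \<eta>2 q2"
    by (rule places_correspond[OF g1 g2 model_dataD(2,3)[OF m2] ff model_dataD(5)[OF m1 q1(1,2)] model_dataD(5)[OF m2] q1(1,2)])
  then obtain P2 q2 where P2: "P2 \<in> E2" "q2 \<in> P2" "place_of \<iota> n1 \<eta>1 q1 = place_of \<iota> n2 \<eta>2 q2" by blast
  have sp: "P2 \<in> proj_space n2" using P2 g2.sub by blast
  obtain j where j: "j \<le> n2" "q2 j \<noteq> 0" using proj_space_E(3)[OF sp P2(2)] by blast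
  define q where "q = (\<lambda>i. inverse (q2 j) * q2 i)"
  have q: "q \<in> P2" unfolding q_def using j by (intro scale_in_point[OF sp P2(2)]) simp
  have qj: "q j = 1" using j by (simp add: q_def)
  have pl: "place_of \<iota> n1 \<eta>1 q1 = place_of \<iota> n2 \<eta>2 q"
    using P2(3) place_of_representative[OF sp P2(2) q] by simp
  have \<eta>j: "\<eta>2 j \<noteq> 0" using g2.coordinate_nonzero[OF P2(1) q j(1)] qj by simp
  obtain c where c: "c \<noteq> 0" "\<forall>i\<le>2. mev \<iota> (G1 i) \<eta>1 = c * \<xi> i" using model_dataD(12)[OF m1] by blast
  have F2: "hom_poly 2 d2 (F2 i)" "over_base (F2 i)" if "i \<le> n2" for i using model_dataD(8,9)[OF m2 that] by blast+
  have G1: "hom_poly n1 e1 (G1 i)" "over_base (G1 i)" if "i \<le> 2" for i using model_dataD(10,11)[OF m1 that] by blast+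
  have \<eta>2: "\<eta>2 = image_point \<iota> n2 F2 \<xi>" by (rule model_dataD(7)[OF m2])
  have hH: "hom_poly n1 (d2 * e1) (msubst (F2 i) G1)" if "i \<le> n2" for i
    by (rule hom_poly_msubst[OF F2(1)[OF that]]) (rule G1)
  have mH: "mev \<iota> (msubst (F2 i) G1) \<eta>1 = c ^ d2 * \<eta>2 i" if i: "i \<le> n2" for i
  proof -
    have "mev \<iota> (msubst (F2 i) G1) \<eta>1 = mev \<iota> (F2 i) (\<lambda>k. c * \<xi> k)"
      unfolding mev_msubst[OF C.hom] by (rule mev_cong[OF F2(1)[OF i]]) (use c in blast)
    also have "\<dots> = c ^ d2 * mev \<iota> (F2 i) \<xi>" by (rule mev_scale[OF F2(1)[OF i]])
    finally show ?thesis using i by (simp add: \<eta>2 image_point_def)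
  qed
  have eH: "mpoly_eval (msubst (F2 i) G1) (\<lambda>k. \<sigma> (z k)) = \<sigma> (mpoly_eval (msubst (F2 i) G1) z)" if i: "i \<le> n2" for i z
  proof -
    have ev: "mpoly_eval (msubst (F2 i) G1) z = mpoly_eval (F2 i) (\<lambda>k. mpoly_eval (G1 k) z)" for z
      unfolding mpoly_eval_mev by (rule mev_msubst[OF id_comm_ring_hom])
    have "mpoly_eval (F2 i) (\<lambda>k. mpoly_eval (G1 k) (\<lambda>k. \<sigma> (z k))) = mpoly_eval (F2 i) (\<lambda>k. \<sigma> (mpoly_eval (G1 k) z))"
      unfolding mpoly_eval_mev[of "F2 i"] by (rule mev_cong[OF F2(1)[OF i]]) (rule over_base_eval[OF G1(2)])
    also have "\<dots> = \<sigma> (mpoly_eval (F2 i) (\<lambda>k. mpoly_eval (G1 k) z))" by (rule over_base_eval[OF F2(2)[OF i]])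
    finally show ?thesis unfolding ev .
  qed
  have q_fixed: "\<sigma> (q i) = q i" if i: "i \<le> n2" for i
  proof (rule rational_place_value[OF g1 q1(1,2) \<sigma>_hom])
    show "\<exists>P'\<in>E1. \<exists>x'\<in>P'. x = (\<lambda>i. \<sigma> (x' i))" if "P \<in> E1" "x \<in> P" for P x
      by (rule model_dataD(6)[OF m1 that])
    show "hom_poly n1 (d2 * e1) (msubst (F2 i) G1)" "hom_poly n1 (d2 * e1) (msubst (F2 j) G1)" by (rule hH, fact)+
    show "mev \<iota> (msubst (F2 j) G1) \<eta>1 \<noteq> 0" using mH[OF j(1)] c \<eta>j by simp
    have "place_of \<iota> n1 \<eta>1 q1 (\<eta>2 i / \<eta>2 j) (q i)"
      using g2.place_of_coordinate[OF P2(1) q i j(1)] qj unfolding pl by simp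
    then show "place_of \<iota> n1 \<eta>1 q1 (mev \<iota> (msubst (F2 i) G1) \<eta>1 / mev \<iota> (msubst (F2 j) G1) \<eta>1) (q i)"
      unfolding mH[OF i] mH[OF j(1)] using c by simp
  qed (use fixed eH[OF i] eH[OF j(1)] in auto)
  have "q i \<in> base_field" for i
    using q_fixed proj_space_E(2)[OF sp q, of i] unfolding base_fixed by (cases "i \<le> n2") auto
  then have "P2 \<in> rational_points E2" using P2(1) q by (auto simp: rational_points_def)
  then show ?thesis using pl q q1(2) unfolding same_place_def by blast
qed

theorem card_rational_points_eq:
  assumes "smooth_projective_model C n1 E1" "smooth_projective_model C n2 E2"
  shows "card (rational_points E1) = card (rational_points E2)"
proof -
  obtain \<eta>1 F1 G1 d1 e1 where m1: "model_data n1 E1 \<eta>1 F1 G1 d1 e1" using smooth_model_data[OF assms(1)] by blast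
  obtain \<eta>2 F2 G2 d2 e2 where m2: "model_data n2 E2 \<eta>2 F2 G2 d2 e2" using smooth_model_data[OF assms(2)] by blast
  have sub: "rational_points E \<subseteq> E" for E :: "'k alg_closure ppoint set" by (auto simp: rational_points_def)
  show ?thesis
  proof (rule card_eq_if_matching[where R = "same_place n1 \<eta>1 n2 \<eta>2"])
    show "\<exists>b\<in>rational_points E2. same_place n1 \<eta>1 n2 \<eta>2 a b" if "a \<in> rational_points E1" for a
      by (rule rational_point_transfer[OF m1 m2 that])
    show "\<exists>a\<in>rational_points E1. same_place n1 \<eta>1 n2 \<eta>2 a b" if "b \<in> rational_points E2" for b
      using rational_point_transfer[OF m2 m1 that] same_place_sym by blast
    show "b = b'" if "a \<in> rational_points E1" "b \<in> rational_points E2" "b' \<in> rational_points E2"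
      "same_place n1 \<eta>1 n2 \<eta>2 a b" "same_place n1 \<eta>1 n2 \<eta>2 a b'" for a b b'
      using same_place_unique[OF m1 m2] that sub by blast
    show "a = a'" if "a \<in> rational_points E1" "a' \<in> rational_points E1" "b \<in> rational_points E2"
      "same_place n1 \<eta>1 n2 \<eta>2 a b" "same_place n1 \<eta>1 n2 \<eta>2 a' b" for a a' b
      using same_place_unique[OF m2 m1] that sub same_place_sym by blast
  qed
qed

end

section \<open>A generic point of a hyperelliptic curve\<close>

text \<open>
  The family \<open>w\<close> may repeat vectors, in which case the relation is a difference of two of its members.
\<close>

lemma (in vector_space) linear_relation:
  fixes w :: "'i \<Rightarrow> 'b"
  assumes "finite I" "finite B" "card I > card B" and w: "\<And>i. i \<in> I \<Longrightarrow> w i \<in> span B"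
  shows "\<exists>c. (\<exists>i\<in>I. c i \<noteq> 0) \<and> (\<Sum>i\<in>I. scale (c i) (w i)) = 0"
proof (cases "inj_on w I")
  case False
  then obtain i k where ik: "i \<in> I" "k \<in> I" "i \<noteq> k" "w i = w k" by (auto simp: inj_on_def)
  define c :: "'i \<Rightarrow> 'a" where "c l = (if l = i then 1 else if l = k then -1 else 0)" for l
  have "(\<Sum>l\<in>I. scale (c l) (w l)) = (\<Sum>l\<in>{i, k}. scale (c l) (w l))"
    by (rule sum.mono_neutral_right) (use assms ik in \<open>auto simp: c_def\<close>)
  also have "\<dots> = 0" using ik by (simp add: c_def)
  finally show ?thesis using ik by (intro exI[of _ c]) (auto simp: c_def)
next
  case True
  then have "card (w ` I) > card B" using assms by (simp add: card_image)
  then have "dependent (w ` I)" using independent_span_bound[OF assms(2), of "w ` I"] w by force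
  then obtain u where u: "(\<Sum>v\<in>w ` I. scale (u v) v) = 0" "\<exists>v\<in>w ` I. u v \<noteq> 0"
    using dependent_finite[of "w ` I"] assms(1) by auto
  then show ?thesis using True by (intro exI[of _ "\<lambda>i. u (w i)"]) (auto simp: sum.reindex)
qed

lemma infinite_alg_closed: "infinite (UNIV :: 'a::alg_closed_field set)"
proof
  assume fin: "finite (UNIV :: 'a set)"
  define p where "p = (\<Prod>a\<in>(UNIV :: 'a set). [:-a, 1:])"
  have "degree p = card (UNIV :: 'a set)" unfolding p_def by (subst degree_prod_eq_sum_degree) auto
  moreover have "card (UNIV :: 'a set) > 0" using fin by (simp add: card_gt_0_iff)
  ultimately have "degree (p + 1) > 0" by (subst degree_add_eq_left) auto
  then obtain x where "poly (p + 1) x = 0" using alg_closed_imp_poly_has_root by blast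
  moreover have "poly p x = 0" using fin unfolding p_def poly_prod by (intro prod_zero) auto
  ultimately show False by simp
qed

lemma square_root_exists: "\<exists>v. v ^ 2 = (w :: 'a::alg_closed_field)"
proof -
  obtain v where "poly [:-w, 0, 1:] v = 0" using alg_closed_imp_poly_has_root[of "[:-w, 0, 1:]"] by auto
  then show ?thesis by (intro exI[of _ v]) (simp add: power2_eq_square)
qed

text \<open>
  The root \<open>r\<close> has even order in \<open>a\<^sup>2\<close> and odd order in \<open>b\<^sup>2 g\<close>.
\<close>

lemma nonsquare_if_simple_root:
  fixes g h a b :: "'a::field poly"
  assumes g: "g = [:-r, 1:] * h" and h: "poly h r \<noteq> 0" and eq: "a ^ 2 = b ^ 2 * g"
  shows "b = 0"
proof (rule ccontr)
  assume b: "b \<noteq> 0"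
  have h0: "h \<noteq> 0" using h by auto
  then have rhs: "b * b * ([:-r, 1:] * h) \<noteq> 0" using b by (simp del: mult_pCons_left)
  then have "a \<noteq> 0" using eq g by (auto simp: power2_eq_square)
  then have "order r (a ^ 2) = 2 * order r a" by (simp add: power2_eq_square order_mult)
  moreover have "order r [:-r, 1:] = 1" using order_power_n_n[of r 1] by simp
  then have "order r ([:-r, 1:] * h) = 1" proof -
    have nz: "[:-r, 1:] * h \<noteq> 0" using h0 by (simp del: mult_pCons_left)
    show ?thesis unfolding order_mult[OF nz] using \<open>order r [:-r, 1:] = 1\<close> order_0I[OF h] by simp
  qed
  then have "order r (b * b * ([:-r, 1:] * h)) = 2 * order r b + 1"
    using rhs b by (simp add: order_mult del: mult_pCons_left)
  then have "order r (b ^ 2 * g) = 2 * order r b + 1" unfolding g power2_eq_square .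
  ultimately have "2 * order r a = 2 * order r b + 1" using eq by simp
  then show False by presburger
qed

text \<open>
  A generic point \<open>(x, y)\<close> of the curve \<open>v\<^sup>2 = g(u)\<close>.  The assumption \<open>nonsquare\<close> makes the norm
  \<open>a\<^sup>2 - b\<^sup>2 g\<close> of \<open>a + b y\<close> nonzero unless \<open>a\<close> and \<open>b\<close> vanish.
\<close>

locale quadratic_point =
  fixes \<iota> :: "'a::alg_closed_field \<Rightarrow> 'm::field" and g :: "'a poly" and x y :: 'm
  assumes hom: "comm_ring_hom \<iota>"
    and transcendental: "\<And>p. poly (map_poly \<iota> p) x = 0 \<Longrightarrow> p = 0"
    and y2: "y ^ 2 = poly (map_poly \<iota> g) x"
    and nonsquare: "\<And>a b. a ^ 2 = b ^ 2 * g \<Longrightarrow> b = 0"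
begin

sublocale \<iota>: comm_ring_hom \<iota> by (rule hom)
sublocale mp: map_poly_comm_ring_hom \<iota> ..

abbreviation "at_x p \<equiv> poly (map_poly \<iota> p) x"

definition on_curve :: "'a \<Rightarrow> 'a \<Rightarrow> bool" where "on_curve u v \<longleftrightarrow> v ^ 2 = poly g u"

text \<open>
  The function \<open>f\<close> on the curve and the element \<open>m\<close> of the big field are given by the same expression
  \<open>a + b y\<close>; modulo the equation of the curve every polynomial in \<open>u\<close> and \<open>v\<close> has this form.
\<close>

definition represents :: "('a \<times> 'a \<Rightarrow> 'a) \<Rightarrow> 'm \<Rightarrow> 'a poly \<Rightarrow> 'a poly \<Rightarrow> bool" where
  "represents f m a b \<longleftrightarrow> (\<forall>u v. on_curve u v \<longrightarrow> f (u, v) = poly a u + poly b u * v) \<and> m = at_x a + at_x b * y"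

definition corresponds :: "('a \<times> 'a \<Rightarrow> 'a) \<Rightarrow> 'm \<Rightarrow> bool" where
  "corresponds f m \<longleftrightarrow> (\<exists>a b. represents f m a b)"

lemma represents_add:
  "represents f m a b \<Longrightarrow> represents f' m' a' b' \<Longrightarrow> represents (f + f') (m + m') (a + a') (b + b')"
  by (simp add: represents_def mp.hom_add algebra_simps)

lemma represents_mult:
  assumes "represents f m a b" "represents f' m' a' b'"
  shows "represents (f * f') (m * m') (a * a' + b * b' * g) (a * b' + a' * b)"
proof -
  have "(f * f') (u, v) = poly (a * a' + b * b' * g) u + poly (a * b' + a' * b) u * v" if "on_curve u v" for u v
  proof -
    have "(f * f') (u, v) = (poly a u + poly b u * v) * (poly a' u + poly b' u * v)"
      using assms that by (simp add: represents_def)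
    also have "\<dots> = poly a u * poly a' u + poly b u * poly b' u * v ^ 2 + (poly a u * poly b' u + poly a' u * poly b u) * v"
      by (simp add: algebra_simps power2_eq_square)
    finally show ?thesis using that by (simp add: on_curve_def)
  qed
  moreover have "m * m' = at_x (a * a' + b * b' * g) + at_x (a * b' + a' * b) * y"
  proof -
    have "m * m' = at_x a * at_x a' + at_x b * at_x b' * y ^ 2 + (at_x a * at_x b' + at_x a' * at_x b) * y"
      using assms by (simp add: represents_def algebra_simps power2_eq_square)
    then show ?thesis by (simp add: y2 mp.hom_add mp.hom_mult)
  qed
  ultimately show ?thesis by (simp add: represents_def)
qed

lemma corresponds_const: "corresponds (\<lambda>p. c) (\<iota> c)"
  unfolding corresponds_def by (rule exI[of _ "[:c:]"], rule exI[of _ 0]) (simp add: represents_def \<iota>.map_poly_pCons_hom)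

lemma corresponds_x: "corresponds fst x"
  unfolding corresponds_def by (rule exI[of _ "[:0, 1:]"], rule exI[of _ 0]) (simp add: represents_def)

lemma corresponds_y: "corresponds snd y"
  unfolding corresponds_def by (rule exI[of _ 0], rule exI[of _ 1]) (simp add: represents_def)

lemma corresponds_add: "corresponds f m \<Longrightarrow> corresponds f' m' \<Longrightarrow> corresponds (f + f') (m + m')"
  unfolding corresponds_def using represents_add by blast

lemma corresponds_mult: "corresponds f m \<Longrightarrow> corresponds f' m' \<Longrightarrow> corresponds (f * f') (m * m')"
  unfolding corresponds_def using represents_mult by blast

lemma fun_const_hom: "comm_ring_hom (\<lambda>c :: 'a. (\<lambda>p :: 'a \<times> 'a. c))"
  by unfold_locales (auto simp: fun_eq_iff)

lemma fun_eval_hom: "comm_ring_hom (\<lambda>f :: 'a \<times> 'a \<Rightarrow> 'a. f p)"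
  by unfold_locales auto

lemma corresponds_mev:
  assumes "\<And>i. corresponds (Z i) (\<xi> i)"
  shows "corresponds (\<lambda>p. mpoly_eval A (\<lambda>i. Z i p)) (mev \<iota> A \<xi>)"
proof -
  have "corresponds (mev (\<lambda>c p. c) A Z) (mev \<iota> A \<xi>)"
  proof (rule mev_rel[where R = corresponds])
    show "corresponds 0 0" using corresponds_const[of 0] by (simp add: zero_fun_def)
    show "corresponds 1 1" using corresponds_const[of 1] by (simp add: one_fun_def)
  qed (rule corresponds_const assms corresponds_add corresponds_mult; assumption)+
  moreover have "mev (\<lambda>c p. c) A Z p = mpoly_eval A (\<lambda>i. Z i p)" for p
    unfolding mpoly_eval_mev by (rule hom_mev[OF fun_const_hom fun_eval_hom])
  then have "mev (\<lambda>c p. c) A Z = (\<lambda>p. mpoly_eval A (\<lambda>i. Z i p))" by (rule ext)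
  ultimately show ?thesis by simp
qed

lemma norm_eq_0:
  assumes "a ^ 2 - b ^ 2 * g = 0" shows "a = 0 \<and> b = 0"
proof -
  have "a ^ 2 = b ^ 2 * g" using assms by simp
  moreover from this have "b = 0" by (rule nonsquare)
  ultimately show ?thesis by simp
qed

lemma represents_eq_0_iff:
  assumes "represents f m a b"
  shows "m = 0 \<longleftrightarrow> a = 0 \<and> b = 0"
proof
  assume "m = 0"
  then have eq: "at_x a = - (at_x b * y)" using assms by (simp add: represents_def eq_neg_iff_add_eq_0)
  have "at_x (a ^ 2 - b ^ 2 * g) = at_x a ^ 2 - at_x b ^ 2 * y ^ 2"
    by (simp add: mp.hom_minus mp.hom_mult mp.hom_power y2)
  also have "\<dots> = 0" unfolding eq by (simp add: power_mult_distrib)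
  finally show "a = 0 \<and> b = 0" using transcendental norm_eq_0 by blast
qed (use assms in \<open>simp add: represents_def\<close>)

text \<open>
  A zero \<open>(u, v)\<close> of \<open>a + b v\<close> on the curve makes \<open>u\<close> a root of the norm \<open>a\<^sup>2 - b\<^sup>2 g\<close>.
\<close>

lemma represents_finite_zeros:
  assumes "represents f m a b" "m \<noteq> 0"
  shows "finite {(u, v). on_curve u v \<and> f (u, v) = 0}"
proof -
  define p where "p = a ^ 2 - b ^ 2 * g"
  have "p \<noteq> 0" using assms represents_eq_0_iff norm_eq_0 unfolding p_def by blast
  then have fin: "finite {u. poly p u = 0}" by (rule poly_roots_finite)
  have fin': "finite {v. v ^ 2 = w}" for w :: 'a
  proof -
    have "{v. v ^ 2 = w} = {v. poly [:-w, 0, 1:] v = 0}" by (auto simp: power2_eq_square)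
    then show ?thesis using poly_roots_finite[of "[:-w, 0, 1:]"] by simp
  qed
  have "{(u, v). on_curve u v \<and> f (u, v) = 0} \<subseteq> (SIGMA u:{u. poly p u = 0}. {v. v ^ 2 = poly g u})"
  proof (clarsimp simp: on_curve_def[symmetric])
    fix u v assume c: "on_curve u v" "f (u, v) = 0"
    then have "poly a u = - (poly b u * v)" using assms(1) by (auto simp: represents_def eq_neg_iff_add_eq_0)
    then have "poly a u ^ 2 = poly b u ^ 2 * poly g u" using c(1) by (simp add: on_curve_def power_mult_distrib)
    then show "poly p u = 0" by (simp add: p_def)
  qed
  moreover have "finite (SIGMA u:{u. poly p u = 0}. {v. v ^ 2 = poly g u})" by (intro finite_SigmaI fin fin')
  ultimately show ?thesis by (rule finite_subset)
qed

lemma infinite_curve: "infinite {(u, v). on_curve u v}"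
proof
  assume fin: "finite {(u, v). on_curve u v}"
  have "UNIV \<subseteq> fst ` {(u, v). on_curve u v}"
  proof
    fix u :: 'a
    obtain v where "v ^ 2 = poly g u" using square_root_exists by blast
    then show "u \<in> fst ` {(u, v). on_curve u v}" by (auto simp: on_curve_def image_iff)
  qed
  then show False using fin infinite_alg_closed finite_subset by blast
qed

text \<open>
  This is genericity of \<open>(x, y)\<close>: a nonzero element has finitely many zeros, whereas the curve has
  infinitely many points.
\<close>

lemma corresponds_eq_0_iff:
  assumes "corresponds f m"
  shows "m = 0 \<longleftrightarrow> (\<forall>u v. on_curve u v \<longrightarrow> f (u, v) = 0)"
proof -
  obtain a b where r: "represents f m a b" using assms by (auto simp: corresponds_def)
  show ?thesis
  proof
    assume "m = 0"
    then show "\<forall>u v. on_curve u v \<longrightarrow> f (u, v) = 0"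
      using represents_eq_0_iff[OF r] r by (simp add: represents_def)
  next
    assume z: "\<forall>u v. on_curve u v \<longrightarrow> f (u, v) = 0"
    show "m = 0"
    proof (rule ccontr)
      assume "m \<noteq> 0"
      then have "finite {(u, v). on_curve u v \<and> f (u, v) = 0}" using represents_finite_zeros[OF r] by blast
      moreover have "{(u, v). on_curve u v \<and> f (u, v) = 0} = {(u, v). on_curve u v}" using z by auto
      ultimately show False using infinite_curve by simp
    qed
  qed
qed

lemma corresponds_finite_zeros:
  "corresponds f m \<Longrightarrow> m \<noteq> 0 \<Longrightarrow> finite {(u, v). on_curve u v \<and> f (u, v) = 0}"
  unfolding corresponds_def using represents_finite_zeros by blast

text \<open>
  A filtration of the ring \<open>\<iota>(K)[x, y]\<close> whose steps have dimension growing linearly in \<open>e\<close>.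
\<close>

definition bounded :: "nat \<Rightarrow> 'm set" where
  "bounded e = {at_x a + at_x b * y | a b. degree a \<le> e \<and> degree b \<le> e}"

lemma bounded_mult:
  assumes "w \<in> bounded e" "w' \<in> bounded e'"
  shows "w * w' \<in> bounded (e + e' + degree g)"
proof -
  obtain a b where ab: "w = at_x a + at_x b * y" "degree a \<le> e" "degree b \<le> e" using assms by (auto simp: bounded_def)
  obtain a' b' where ab': "w' = at_x a' + at_x b' * y" "degree a' \<le> e'" "degree b' \<le> e'" using assms by (auto simp: bounded_def)
  have "w * w' = at_x a * at_x a' + at_x b * at_x b' * y ^ 2 + (at_x a * at_x b' + at_x a' * at_x b) * y"
    unfolding ab ab' by (simp add: algebra_simps power2_eq_square)
  then have eq: "w * w' = at_x (a * a' + b * b' * g) + at_x (a * b' + a' * b) * y"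
    by (simp add: y2 mp.hom_add mp.hom_mult)
  have d: "degree (p * q) \<le> k + l" if "degree p \<le> k" "degree q \<le> l" for p q :: "'a poly" and k l
    using degree_mult_le[of p q] that by linarith
  have "degree (a * a') \<le> e + e' + degree g" using d[OF ab(2) ab'(2)] by simp
  moreover have "degree (b * b' * g) \<le> e + e' + degree g" by (rule d[OF d[OF ab(3) ab'(3)] order_refl])
  moreover have "degree (a * b') \<le> e + e' + degree g" "degree (a' * b) \<le> e + e' + degree g"
    using d[OF ab(2) ab'(3)] d[OF ab'(2) ab(3)] by simp_all
  ultimately show ?thesis unfolding bounded_def eq by (blast intro: degree_add_le)
qed

lemma one_bounded: "1 \<in> bounded e"
  unfolding bounded_def by (intro CollectI exI[of _ 1] exI[of _ 0]) simp

lemma corresponds_bounded: "corresponds f m \<Longrightarrow> \<exists>e. m \<in> bounded e"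
proof -
  assume "corresponds f m"
  then obtain a b where "m = at_x a + at_x b * y" by (auto simp: corresponds_def represents_def)
  then show ?thesis unfolding bounded_def
    by (intro exI[of _ "max (degree a) (degree b)"] CollectI exI[of _ a] exI[of _ b]) simp
qed

lemma bounded_mono: "e \<le> e' \<Longrightarrow> bounded e \<subseteq> bounded e'"
  unfolding bounded_def by (auto intro: order_trans)

lemma bounded_power:
  assumes "w \<in> bounded e" shows "w ^ k \<in> bounded (k * (e + degree g))"
proof (induction k)
  case (Suc k)
  have "w * w ^ k \<in> bounded (e + k * (e + degree g) + degree g)" by (rule bounded_mult[OF assms Suc])
  then show ?case by (simp add: algebra_simps)
qed (simp add: one_bounded)

lemma scalar_vector_space: "vector_space (\<lambda>c (m :: 'm). \<iota> c * m)"
  by unfold_locales (auto simp: \<iota>.hom_add \<iota>.hom_mult algebra_simps)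

definition basis :: "nat \<Rightarrow> 'm set" where
  "basis e = (\<lambda>i. x ^ i) ` {..e} \<union> (\<lambda>i. x ^ i * y) ` {..e}"

lemma finite_basis: "finite (basis e)" "card (basis e) \<le> 2 * (e + 1)"
proof -
  have "card (basis e) \<le> card ((\<lambda>i. x ^ i) ` {..e}) + card ((\<lambda>i. x ^ i * y) ` {..e})"
    unfolding basis_def by (rule card_Un_le)
  also have "\<dots> \<le> card {..e} + card {..e}" by (intro add_mono card_image_le) auto
  finally show "card (basis e) \<le> 2 * (e + 1)" by simp
qed (simp add: basis_def)

lemma at_x_sum: "degree p \<le> e \<Longrightarrow> at_x p = (\<Sum>i\<le>e. \<iota> (coeff p i) * x ^ i)"
proof -
  assume d: "degree p \<le> e"
  have "degree (map_poly \<iota> p) \<le> e" using d degree_map_poly_le[of \<iota> p] by simp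
  then have "at_x p = (\<Sum>i\<le>e. coeff (map_poly \<iota> p) i * x ^ i)"
    unfolding poly_altdef by (intro sum.mono_neutral_left) (auto intro: le_degree)
  then show ?thesis by (simp add: coeff_map_poly)
qed

lemma bounded_span: "w \<in> bounded e \<Longrightarrow> w \<in> module.span (\<lambda>c (m :: 'm). \<iota> c * m) (basis e)"
proof -
  interpret vs: vector_space "\<lambda>c (m :: 'm). \<iota> c * m" by (rule scalar_vector_space)
  assume "w \<in> bounded e"
  then obtain a b where ab: "w = at_x a + at_x b * y" "degree a \<le> e" "degree b \<le> e" by (auto simp: bounded_def)
  have "w = (\<Sum>i\<le>e. \<iota> (coeff a i) * x ^ i) + (\<Sum>i\<le>e. \<iota> (coeff b i) * (x ^ i * y))"
    unfolding ab(1) at_x_sum[OF ab(2)] at_x_sum[OF ab(3)] by (simp add: sum_distrib_right mult.assoc)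
  also have "\<dots> \<in> vs.span (basis e)"
    by (intro vs.span_add vs.span_sum vs.span_scale vs.span_base) (auto simp: basis_def)
  finally show ?thesis .
qed

text \<open>
  A dimension count: the \<open>(N + 1)\<^sup>2\<close> products \<open>p\<^sup>i s\<^sup>j q\<^sup>2\<^sup>N\<^sup>-\<^sup>i\<^sup>-\<^sup>j\<close> with \<open>i, j \<le> N\<close> lie in a space whose
  dimension is linear in \<open>N\<close>, so they are linearly dependent for large \<open>N\<close>.  Dividing the relation
  by \<open>q\<^sup>2\<^sup>N\<close> gives a polynomial relation between \<open>p/q\<close> and \<open>s/q\<close>.
\<close>

lemma quotients_dependent:
  assumes p: "p \<in> bounded e" and s: "s \<in> bounded e" and q: "q \<in> bounded e" "q \<noteq> 0"
  shows "\<exists>P :: 'a poly poly. P \<noteq> 0 \<and> poly (map_poly (\<lambda>r. poly (map_poly \<iota> r) (s / q)) P) (p / q) = 0"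
proof -
  interpret vs: vector_space "\<lambda>c (m :: 'm). \<iota> c * m" by (rule scalar_vector_space)
  define D where "D = e + degree g"
  \<comment> \<open>chosen to make \<open>(N + 1)\<^sup>2\<close> exceed \<open>card (basis M)\<close>\<close>
  define N where "N = 4 * (D + degree g) + 2"
  define I where "I = {..N} \<times> {..N}"
  define w where "w = (\<lambda>(i, j). p ^ i * s ^ j * q ^ (2 * N - i - j))"
  define M where "M = 2 * N * (D + degree g)"
  have w: "w k \<in> vs.span (basis M)" if k: "k \<in> I" for k
  proof -
    obtain i j where ij: "k = (i, j)" "i \<le> N" "j \<le> N" using k by (auto simp: I_def)
    have "p ^ i * s ^ j * q ^ (2 * N - i - j) \<in>
        bounded (i * D + j * D + degree g + (2 * N - i - j) * D + degree g)"
      unfolding D_def by (intro bounded_mult bounded_power p s q)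
    moreover have "i * D + j * D + degree g + (2 * N - i - j) * D + degree g \<le> M"
    proof -
      have "i * D + j * D + (2 * N - i - j) * D = (i + j + (2 * N - i - j)) * D" by (simp add: distrib_right)
      also have "\<dots> = 2 * N * D" using ij by simp
      finally have "i * D + j * D + degree g + (2 * N - i - j) * D + degree g = 2 * N * D + 2 * degree g" by linarith
      moreover have "2 * degree g \<le> 2 * N * degree g" unfolding N_def by simp
      moreover have "M = 2 * N * D + 2 * N * degree g" by (simp add: M_def distrib_left)
      ultimately show ?thesis by linarith
    qed
    ultimately have "p ^ i * s ^ j * q ^ (2 * N - i - j) \<in> bounded M" using bounded_mono by blast
    then show ?thesis using bounded_span ij by (simp add: w_def)
  qed
  have "card (basis M) \<le> 2 * (M + 1)" by (rule finite_basis)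
  also have "\<dots> < (N + 1) * (N + 1)"
  proof -
    have "2 * (M + 1) = N * (4 * (D + degree g)) + 2" by (simp add: M_def algebra_simps)
    also have "4 * (D + degree g) = N - 2" by (simp add: N_def)
    also have "N * (N - 2) + 2 < (N + 1) * (N + 1)"
    proof -
      have "N * (N - 2) \<le> N * N" by simp
      moreover have "(N + 1) * (N + 1) = N * N + 2 * N + 1" by simp
      moreover have "2 \<le> N" by (simp add: N_def)
      ultimately show ?thesis by linarith
    qed
    finally show ?thesis .
  qed
  also have "\<dots> = card I" by (simp add: I_def)
  finally obtain c where c: "\<exists>k\<in>I. c k \<noteq> 0" "(\<Sum>k\<in>I. \<iota> (c k) * w k) = 0"
    using vs.linear_relation[of I "basis M" w] w finite_basis by (auto simp: I_def)
  define P where "P = (\<Sum>i\<le>N. monom (\<Sum>j\<le>N. monom (c (i, j)) j) i)"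
  have cP: "coeff (coeff P i) j = c (i, j)" if "i \<le> N" "j \<le> N" for i j
    using that by (simp add: P_def coeff_sum)
  then have "P \<noteq> 0" using c(1) by (force simp: I_def)
  moreover have "poly (map_poly (\<lambda>r. poly (map_poly \<iota> r) (s / q)) P) (p / q) = 0"
  proof -
    have h: "comm_ring_hom (\<lambda>r. poly (map_poly \<iota> r) (s / q))"
      by unfold_locales (auto simp: mp.hom_add mp.hom_mult)
    interpret h: map_poly_comm_ring_hom "\<lambda>r. poly (map_poly \<iota> r) (s / q)"
      using h by (simp add: map_poly_comm_ring_hom_def)
    have inner: "poly (map_poly \<iota> (\<Sum>j\<le>N. monom (c (i, j)) j)) (s / q) = (\<Sum>j\<le>N. \<iota> (c (i, j)) * (s / q) ^ j)" for i
      by (simp add: mp.hom_sum poly_sum map_poly_monom poly_monom)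
    have "poly (map_poly (\<lambda>r. poly (map_poly \<iota> r) (s / q)) P) (p / q) =
        (\<Sum>i\<le>N. poly (map_poly \<iota> (\<Sum>j\<le>N. monom (c (i, j)) j)) (s / q) * (p / q) ^ i)"
      unfolding P_def by (simp add: h.hom_sum poly_sum map_poly_monom poly_monom)
    also have "\<dots> = (\<Sum>i\<le>N. \<Sum>j\<le>N. \<iota> (c (i, j)) * (s / q) ^ j * (p / q) ^ i)"
      unfolding inner by (simp add: sum_distrib_right)
    also have "\<dots> = (\<Sum>(i, j)\<in>I. \<iota> (c (i, j)) * (s / q) ^ j * (p / q) ^ i)"
      unfolding I_def by (rule sum.cartesian_product)
    also have "\<dots> = (\<Sum>k\<in>I. \<iota> (c k) * w k / q ^ (2 * N))"
    proof (intro sum.cong refl, clarify)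
      fix i j assume "(i, j) \<in> I"
      then have "i + j + (2 * N - i - j) = 2 * N" by (auto simp: I_def)
      then have "q ^ (2 * N) = q ^ i * q ^ j * q ^ (2 * N - i - j)" by (metis power_add)
      then show "\<iota> (c (i, j)) * (s / q) ^ j * (p / q) ^ i = \<iota> (c (i, j)) * w (i, j) / q ^ (2 * N)"
        using q(2) by (simp add: w_def power_divide mult_ac)
    qed
    also have "\<dots> = 0" using c(2) by (simp add: sum_divide_distrib[symmetric])
    finally show ?thesis .
  qed
  ultimately show ?thesis by blast
qed

lemma corresponds_dependent:
  assumes "corresponds f1 p1" "corresponds f2 q1" "q1 \<noteq> 0" "corresponds f3 p2" "corresponds f4 q2" "q2 \<noteq> 0"
  shows "\<exists>P :: 'a poly poly. P \<noteq> 0 \<and> poly (map_poly (\<lambda>r. poly (map_poly \<iota> r) (p2 / q2)) P) (p1 / q1) = 0"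
proof -
  obtain e1 e2 e3 where e: "p1 * q2 \<in> bounded e1" "p2 * q1 \<in> bounded e2" "q1 * q2 \<in> bounded e3"
    using corresponds_bounded[OF corresponds_mult[OF assms(1,5)]] corresponds_bounded[OF corresponds_mult[OF assms(4,2)]]
      corresponds_bounded[OF corresponds_mult[OF assms(2,5)]] by blast
  define e where "e = e1 + e2 + e3"
  have "p1 * q2 \<in> bounded e" "p2 * q1 \<in> bounded e" "q1 * q2 \<in> bounded e"
    using e bounded_mono[of e1 e] bounded_mono[of e2 e] bounded_mono[of e3 e] by (auto simp: e_def)
  from quotients_dependent[OF this] assms show ?thesis by (simp add: mult.commute)
qed

end

section \<open>Finite sets are closed\<close>

lemma zariski_closed_Un:
  assumes "zariski_closed n Y" "zariski_closed n Z"
  shows "zariski_closed n (Y \<union> Z)"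
proof -
  obtain S T where S: "\<forall>f\<in>S. form n f" "Y = proj_zeros n S" and T: "\<forall>f\<in>T. form n f" "Z = proj_zeros n T"
    using assms by (auto simp: zariski_closed_def)
  define ST where "ST = {f * g | f g. f \<in> S \<and> g \<in> T}"
  have vanish: "vanishes_at (f * g) P \<longleftrightarrow> vanishes_at f P \<or> vanishes_at g P"
    if P: "P \<in> proj_space n" and fg: "f \<in> S" "g \<in> T" for f g P
  proof -
    obtain x where x: "P = proj_pt x" using proj_space_rep[OF P] by blast
    obtain d e where de: "hom_poly n d f" "hom_poly n e g" using S(1) T(1) fg unfolding form_def by blast
    show ?thesis
      unfolding x vanishes_at_proj_pt[OF de(1)] vanishes_at_proj_pt[OF de(2)] vanishes_at_proj_pt[OF hom_poly_mult[OF de]]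
      by (simp add: mpoly_eval_mev id_mev)
  qed
  have "Y \<union> Z = proj_zeros n ST"
  proof (intro Set.set_eqI iffI)
    fix P assume P: "P \<in> Y \<union> Z"
    then have sp: "P \<in> proj_space n" unfolding S(2) T(2) proj_zeros_def by blast
    have "vanishes_at h P" if h: "h \<in> ST" for h
    proof -
      obtain f g where fg: "h = f * g" "f \<in> S" "g \<in> T" using h unfolding ST_def by blast
      have "vanishes_at f P \<or> vanishes_at g P" using P fg unfolding S(2) T(2) proj_zeros_def by blast
      then show ?thesis using vanish[OF sp fg(2,3)] fg(1) by simp
    qed
    then show "P \<in> proj_zeros n ST" using sp by (simp add: proj_zeros_def)
  next
    fix P assume P: "P \<in> proj_zeros n ST"
    then have sp: "P \<in> proj_space n" by (simp add: proj_zeros_def)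
    show "P \<in> Y \<union> Z"
    proof (rule ccontr)
      assume "P \<notin> Y \<union> Z"
      then obtain f g where fg: "f \<in> S" "\<not> vanishes_at f P" "g \<in> T" "\<not> vanishes_at g P"
        using sp unfolding S(2) T(2) proj_zeros_def by blast
      then have "f * g \<in> ST" unfolding ST_def by blast
      then have "vanishes_at (f * g) P" using P by (simp add: proj_zeros_def)
      then show False using vanish[OF sp fg(1,3)] fg by simp
    qed
  qed
  moreover have "form n h" if h: "h \<in> ST" for h
  proof -
    obtain f g where fg: "h = f * g" "f \<in> S" "g \<in> T" using h unfolding ST_def by blast
    obtain d e where "hom_poly n d f" "hom_poly n e g" using S(1) T(1) fg unfolding form_def by blast
    then show ?thesis unfolding form_def fg(1) using hom_poly_mult by blast
  qed
  ultimately show ?thesis unfolding zariski_closed_def by blast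
qed

text \<open>
  The \<open>2 \<times> 2\<close> minors of the matrix with rows \<open>q\<close> and \<open>X\<close> cut out the point \<open>q\<close>.
\<close>

lemma zariski_closed_singleton:
  assumes P: "P \<in> proj_space n" shows "zariski_closed n {P}"
proof -
  obtain q where q: "P = proj_pt q" using proj_space_rep[OF P] by blast
  note qE = proj_space_E[OF P, of q, unfolded q, OF proj_pt_self]
  define M where "M i j = Const (q j) * Var i - Const (q i) * Var j" for i j
  have M: "hom_poly n 1 (M i j)" if "i \<le> n" "j \<le> n" for i j
    unfolding M_def by (intro hom_poly_diff hom_poly_Const_mult hom_poly_Var that)
  have evM: "mpoly_eval (M i j) x = q j * x i - q i * x j" for i j x
    by (simp add: M_def mpoly_eval_mev id_mev)
  let ?S = "{M i j | i j. i \<le> n \<and> j \<le> n}"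
  have "{P} = proj_zeros n ?S"
  proof (intro Set.set_eqI iffI)
    fix Q assume "Q \<in> {P}"
    then have Q: "Q = P" by simp
    have "vanishes_at f P" if "f \<in> ?S" for f
    proof -
      obtain i j where ij: "f = M i j" "i \<le> n" "j \<le> n" using \<open>f \<in> ?S\<close> by blast
      show ?thesis unfolding q ij(1) vanishes_at_proj_pt[OF M[OF ij(2,3)]] evM by simp
    qed
    then show "Q \<in> proj_zeros n ?S" using P Q by (simp add: proj_zeros_def)
  next
    fix Q assume Q: "Q \<in> proj_zeros n ?S"
    then have sp: "Q \<in> proj_space n" by (simp add: proj_zeros_def)
    obtain x where x: "Q = proj_pt x" using proj_space_rep[OF sp] by blast
    note xE = proj_space_E[OF sp, of x, unfolded x, OF proj_pt_self]
    have eq: "q j * x i = q i * x j" if ij: "i \<le> n" "j \<le> n" for i j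
    proof -
      have "vanishes_at (M i j) Q" using Q ij by (auto simp: proj_zeros_def)
      then show ?thesis unfolding x vanishes_at_proj_pt[OF M[OF ij]] evM by simp
    qed
    obtain j where j: "j \<le> n" "q j \<noteq> 0" using qE(3) by blast
    obtain k where k: "k \<le> n" "x k \<noteq> 0" using xE(3) by blast
    have xi: "x i = (x j / q j) * q i" for i
      using eq[OF _ j(1), of i] j(2) xE(2)[of i] qE(2)[of i] by (cases "i \<le> n") (auto simp: field_simps)
    have "x j / q j \<noteq> 0" using xi[of k] k by auto
    then have "proj_pt (\<lambda>i. (x j / q j) * q i) = proj_pt q" by (rule proj_pt_scale)
    moreover have "x = (\<lambda>i. (x j / q j) * q i)" using xi by blast
    ultimately show "Q \<in> {P}" using x q by simp
  qed
  moreover have "\<forall>f\<in>?S. form n f" using M by (auto simp: form_def)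
  ultimately show ?thesis unfolding zariski_closed_def by blast
qed

lemma zariski_closed_empty: "zariski_closed n ({} :: 'a::field ppoint set)"
proof -
  have one: "hom_poly n 0 (1 :: 'a mpoly)" by simp
  have "\<not> vanishes_at 1 P" if P: "P \<in> proj_space n" for P :: "'a ppoint"
  proof -
    obtain x where x: "P = proj_pt x" using proj_space_rep[OF P] by blast
    show ?thesis unfolding x vanishes_at_proj_pt[OF one] by (simp add: mpoly_eval_mev id_mev)
  qed
  then have "({} :: 'a ppoint set) = proj_zeros n {1}" by (auto simp: proj_zeros_def)
  then show ?thesis unfolding zariski_closed_def form_def
    by (intro exI[of _ "{1}"]) (auto intro: exI[of _ 0])
qed

lemma zariski_closed_finite:
  "finite Z \<Longrightarrow> Z \<subseteq> proj_space n \<Longrightarrow> zariski_closed n Z"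
proof (induction Z rule: finite_induct)
  case (insert P Z)
  then have "zariski_closed n ({P} \<union> Z)" by (intro zariski_closed_Un zariski_closed_singleton) auto
  then show ?case by simp
qed (rule zariski_closed_empty)

lemma finite_irreducible_singleton:
  assumes irr: "irreducible_closed n Z" and fin: "finite Z" and P: "P \<in> Z"
  shows "Z = {P}"
proof -
  have sp: "Z \<subseteq> proj_space n" using irr by (auto simp: irreducible_closed_def zariski_closed_def proj_zeros_def)
  have "zariski_closed n {P}" "zariski_closed n (Z - {P})" using fin P sp by (auto intro!: zariski_closed_finite)
  moreover have "Z = {P} \<union> (Z - {P})" using P by auto
  ultimately have "Z = {P} \<or> Z = Z - {P}" using irr unfolding irreducible_closed_def by blast
  then show ?thesis using P by blast
qed

lemma irreducible_singleton:
  assumes "P \<in> proj_space n" shows "irreducible_closed n {P}"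
  using zariski_closed_singleton[OF assms] unfolding irreducible_closed_def by blast

text \<open>
  Forms that vanish on the two parts but not on \<open>V\<close> are nonzero at the generic point, while their
  product is zero there.
\<close>

lemma (in generic_point) irreducible:
  assumes "zariski_closed n V" "V \<noteq> {}"
  shows "irreducible_closed n V"
  unfolding irreducible_closed_def
proof (intro conjI assms allI impI)
  fix Z1 Z2 assume cl: "zariski_closed n Z1" "zariski_closed n Z2" and V: "V = Z1 \<union> Z2"
  have sep: "\<exists>d A. hom_poly n d A \<and> (\<forall>P\<in>Z. vanishes_at A P) \<and> mev \<iota> A \<eta> \<noteq> 0"
    if Z: "zariski_closed n Z" "Z \<subseteq> V" "V \<noteq> Z" for Z
  proof -
    obtain S where S: "\<forall>f\<in>S. form n f" "Z = proj_zeros n S" using Z(1) by (auto simp: zariski_closed_def)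
    obtain P where P: "P \<in> V" "P \<notin> Z" using Z by blast
    then obtain f where f: "f \<in> S" "\<not> vanishes_at f P" using S(2) sub by (auto simp: proj_zeros_def)
    then obtain d where d: "hom_poly n d f" using S(1) by (auto simp: form_def)
    have "\<forall>P\<in>Z. vanishes_at f P" using S(2) f(1) by (auto simp: proj_zeros_def)
    then show ?thesis using generic[OF d] f(2) P(1) d by blast
  qed
  show "V = Z1 \<or> V = Z2"
  proof (rule ccontr)
    assume no: "\<not> (V = Z1 \<or> V = Z2)"
    obtain d1 A1 where A1: "hom_poly n d1 A1" "\<forall>P\<in>Z1. vanishes_at A1 P" "mev \<iota> A1 \<eta> \<noteq> 0"
      using sep[OF cl(1)] no V by blast
    obtain d2 A2 where A2: "hom_poly n d2 A2" "\<forall>P\<in>Z2. vanishes_at A2 P" "mev \<iota> A2 \<eta> \<noteq> 0"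
      using sep[OF cl(2)] no V by blast
    have "\<forall>P\<in>V. vanishes_at (A1 * A2) P"
      using A1(2) A2(2) unfolding V vanishes_at_def by (auto simp: mpoly_eval_mev id_mev)
    then have "mev \<iota> (A1 * A2) \<eta> = 0" using generic[OF hom_poly_mult[OF A1(1) A2(1)]] by blast
    then show False using A1(3) A2(3) by (simp add: \<iota>.mev_mult)
  qed
qed

section \<open>Gradients\<close>

lemma gradient_scale:
  assumes f: "hom_poly n d f"
  shows "gradient n f (\<lambda>i. a * x i) = (\<lambda>i. a ^ (d - 1) * gradient n f x i)"
proof -
  have "dmon i (\<lambda>i. a * x i) m = a ^ (d - 1) * dmon i x m" if m: "m \<in> Poly_Mapping.keys f" for i m
  proof (cases "Poly_Mapping.lookup m i = 0")
    case False
    let ?m = "m - Poly_Mapping.single i 1"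
    have i: "i \<in> Poly_Mapping.keys m" using False by (simp add: in_keys_iff)
    have "(\<Sum>k\<in>Poly_Mapping.keys ?m. Poly_Mapping.lookup ?m k) = (\<Sum>k\<in>Poly_Mapping.keys m. Poly_Mapping.lookup ?m k)"
      by (rule sum.mono_neutral_left) (auto simp: in_keys_iff lookup_minus)
    also have "\<dots> = (\<Sum>k\<in>Poly_Mapping.keys m. Poly_Mapping.lookup m k - (if k = i then 1 else 0))"
      by (intro sum.cong refl) (simp add: lookup_minus lookup_single when_def)
    also have "\<dots> + 1 = (\<Sum>k\<in>Poly_Mapping.keys m. Poly_Mapping.lookup m k)"
      using i False by (simp add: sum.remove[of _ i])
    also have "\<dots> = d" by (rule hom_poly_degree_keys[OF f m])
    finally have "(\<Sum>k\<in>Poly_Mapping.keys ?m. Poly_Mapping.lookup ?m k) = d - 1" by simp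
    then show ?thesis unfolding dmon_def mon_scale by (simp add: mult_ac)
  qed (simp add: dmon_def)
  then have "mpoly_eval (mpoly_deriv i f) (\<lambda>i. a * x i) = a ^ (d - 1) * mpoly_eval (mpoly_deriv i f) x" for i
    unfolding mpoly_eval_deriv by (simp add: sum_distrib_left mult_ac)
  then show ?thesis by (auto simp: gradient_def)
qed

text \<open>
  Scaling the point multiplies each gradient by a power of the scalar, which leaves the span unchanged.
\<close>

lemma jacobian_rank_scale:
  assumes a: "(a::'a::field) \<noteq> 0"
  shows "jacobian_rank n V (\<lambda>i. a * x i) = jacobian_rank n V x"
proof -
  interpret vs: vector_space "\<lambda>(a::'a) v (i::nat). a * v i" by (rule function_vector_space)
  let ?G = "\<lambda>x. {gradient n f x | f. form n f \<and> (\<forall>P\<in>V. vanishes_at f P)}"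
  have sub: "?G (\<lambda>i. b * y i) \<subseteq> vs.span (?G y)" for b y
  proof
    fix v assume "v \<in> ?G (\<lambda>i. b * y i)"
    then obtain f d where f: "v = gradient n f (\<lambda>i. b * y i)" "hom_poly n d f" "form n f" "\<forall>P\<in>V. vanishes_at f P"
      by (auto simp: form_def)
    have "gradient n f y \<in> ?G y" using f(3,4) by blast
    then show "v \<in> vs.span (?G y)" unfolding f(1) gradient_scale[OF f(2)] by (intro vs.span_scale vs.span_base)
  qed
  have "?G x \<subseteq> vs.span (?G (\<lambda>i. a * x i))" using sub[of "inverse a" "\<lambda>i. a * x i"] a by simp
  with sub[of a x] have "vs.span (?G (\<lambda>i. a * x i)) = vs.span (?G x)"
    by (intro subset_antisym vs.span_minimal vs.subspace_span)
  then have "vs.dim (vs.span (?G (\<lambda>i. a * x i))) = vs.dim (vs.span (?G x))" by (rule arg_cong)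
  then show ?thesis unfolding jacobian_rank_def vs.dim_span .
qed

lemma (in generic_point) jacobian_rank_ge_2:
  assumes P: "P \<in> V" "q \<in> P" and j: "j \<le> n" "q j = 1"
    and f: "form n f" "\<forall>P\<in>V. vanishes_at f P" and g: "form n g" "\<forall>P\<in>V. vanishes_at g P"
    and ind: "\<And>a b. (\<And>i. a * gradient n f q i + b * gradient n g q i = 0) \<Longrightarrow> a = 0 \<and> b = 0"
  shows "jacobian_rank n V q \<ge> 2"
proof -
  interpret vs: vector_space "\<lambda>(a::'a) v (i::nat). a * v i" by (rule function_vector_space)
  let ?G = "{gradient n f q | f. form n f \<and> (\<forall>P\<in>V. vanishes_at f P)}"
  let ?u = "gradient n f q" and ?v = "gradient n g q"
  have uv: "?u \<in> ?G" "?v \<in> ?G" using f g by blast+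
  have ne: "?u \<noteq> ?v" using ind[of 1 "-1"] by auto
  have "?v \<noteq> 0" using ind[of 0 1] by auto
  moreover have "?u \<notin> vs.span {?v}"
  proof
    assume "?u \<in> vs.span {?v}"
    then obtain k where "?u = (\<lambda>i. k * ?v i)" by (auto simp: vs.span_singleton)
    then show False using ind[of 1 "-k"] by (auto simp: fun_eq_iff)
  qed
  ultimately have indep: "vs.independent {?u, ?v}" using ne by (simp add: vs.independent_insert)
  obtain B where B: "B \<subseteq> ?G" "vs.independent B" "?G \<subseteq> vs.span B" "card B = vs.dim ?G" by (rule vs.basis_exists)
  have "B \<subseteq> vs.span (cotangent q j ` ({..n} - {j}))" using B(1) gradients_subset[OF P j] by blast
  then have "finite B"
    using vs.independent_span_bound[of "cotangent q j ` ({..n} - {j})" B] B(2) by simp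
  then have "card {?u, ?v} \<le> card B" using vs.independent_span_bound[OF _ indep, of B] subsetD[OF B(3) uv(1)] subsetD[OF B(3) uv(2)] by simp
  then show ?thesis using ne B(4) by (simp add: jacobian_rank_def)
qed

section \<open>The intersection of two quadrics\<close>

text \<open>
  The quadratic monomial \<open>a X\<^sub>i X\<^sub>j\<close>.
\<close>

abbreviation mq :: "'a::comm_ring_1 \<Rightarrow> nat \<Rightarrow> nat \<Rightarrow> 'a mpoly" where
  "mq a i j \<equiv> Poly_Mapping.single (Poly_Mapping.single i 1 + Poly_Mapping.single j 1) a"

lemma (in comm_ring_hom) mev_mq: "mev hom (mq a i j) x = hom a * (x i * x j)"
  by (simp add: mon_add)

lemma mpoly_eval_mq: "mpoly_eval (mq a i j) x = a * (x i * x j)"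
  unfolding mpoly_eval_mev by (rule comm_ring_hom.mev_mq[OF id_comm_ring_hom])

lemma hom_poly_mq: "i \<le> n \<Longrightarrow> j \<le> n \<Longrightarrow> hom_poly n 2 (mq a i j)"
proof -
  assume "i \<le> n" "j \<le> n"
  then have "hom_poly n (0 + (1 + 1)) (Const a * (Var i * Var j))"
    by (intro hom_poly_mult hom_poly_Const hom_poly_Var)
  then show ?thesis by (simp add: mult_single numeral_2_eq_2)
qed

lemma base_field_to_ac: "to_ac a \<in> base_field" by (simp add: base_field_def)

lemma base_field_add: "a \<in> base_field \<Longrightarrow> b \<in> base_field \<Longrightarrow> a + b \<in> base_field"
  unfolding base_field_def by (auto simp: to_ac_add[symmetric] simp del: to_ac_add)

lemma base_field_diff: "a \<in> base_field \<Longrightarrow> b \<in> base_field \<Longrightarrow> a - b \<in> base_field"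
  unfolding base_field_def by (auto simp: to_ac_diff[symmetric] simp del: to_ac_diff)

lemma base_field_0: "0 \<in> base_field" and base_field_1: "1 \<in> base_field"
  using base_field_to_ac[of 0] base_field_to_ac[of 1] by simp_all

lemma over_base_single: "a \<in> base_field \<Longrightarrow> over_base (Poly_Mapping.single m a)"
  using base_field_0 by (auto simp: over_base_def lookup_single when_def)

lemma over_base_add: "over_base p \<Longrightarrow> over_base q \<Longrightarrow> over_base (p + q)"
  by (auto simp: over_base_def lookup_add intro!: base_field_add)

lemma over_base_diff: "over_base p \<Longrightarrow> over_base q \<Longrightarrow> over_base (p - q)"
  by (auto simp: over_base_def lookup_minus intro!: base_field_diff)

text \<open>
  The sum defining a derivative runs over the support of the polynomial; the value is additive in
  the polynomial, which makes derivatives of explicit polynomials computable term by term.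
\<close>

definition deriv_eval :: "nat \<Rightarrow> 'a::comm_ring_1 mpoly \<Rightarrow> (nat \<Rightarrow> 'a) \<Rightarrow> 'a" where
  "deriv_eval i p x = mpoly_eval (mpoly_deriv i p) x"

lemma deriv_eval_superset:
  assumes "finite A" "Poly_Mapping.keys p \<subseteq> A"
  shows "deriv_eval i p x = (\<Sum>m\<in>A. Poly_Mapping.lookup p m * dmon i x m)"
  unfolding deriv_eval_def mpoly_eval_deriv
  by (rule sum.mono_neutral_left) (use assms in \<open>auto simp: in_keys_iff\<close>)

lemma deriv_eval_add: "deriv_eval i (p + q) x = deriv_eval i p x + deriv_eval i q x"
proof -
  let ?A = "Poly_Mapping.keys p \<union> Poly_Mapping.keys q"
  have "deriv_eval i (p + q) x = (\<Sum>m\<in>?A. Poly_Mapping.lookup (p + q) m * dmon i x m)"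
    by (rule deriv_eval_superset) (use Poly_Mapping.keys_add[of p q] in auto)
  also have "\<dots> = deriv_eval i p x + deriv_eval i q x"
    using deriv_eval_superset[of ?A p i x] deriv_eval_superset[of ?A q i x]
    by (simp add: lookup_add distrib_right sum.distrib)
  finally show ?thesis .
qed

lemma deriv_eval_diff: "deriv_eval i (p - q) x = deriv_eval i p x - deriv_eval i q x"
  using deriv_eval_add[of i "p - q" q x] by simp

lemma deriv_eval_mq:
  "deriv_eval k (mq a i j) x = a * ((if k = i then x j else 0) + (if k = j then x i else 0))"
proof -
  have 1: "dmon k x (Poly_Mapping.single i 1) = (if k = i then 1 else 0)"
    using dmon_step[of k x 0 i] by simp
  have "deriv_eval k (mq a i j) x = a * dmon k x (Poly_Mapping.single i 1 + Poly_Mapping.single j 1)"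
    by (subst deriv_eval_superset[of "{Poly_Mapping.single i 1 + Poly_Mapping.single j 1}"]) auto
  then show ?thesis unfolding dmon_step 1 by simp
qed

lemma to_ac_eq_0: "to_ac a = 0 \<longleftrightarrow> a = 0"
proof
  assume a: "to_ac a = 0"
  show "a = 0"
  proof (rule ccontr)
    assume "a \<noteq> 0"
    then have "to_ac a * to_ac (inverse a) = 1" by (simp flip: to_ac_mult)
    then show False using a by simp
  qed
qed simp

lemma to_ac_inj: "to_ac a = to_ac b \<longleftrightarrow> a = b"
  using to_ac_eq_0[of "a - b"] by simp

text \<open>
  The big field is an algebraic closure of \<open>K(t)\<close>: it contains the transcendental \<open>t\<close> and, being
  algebraically closed, a square root of every polynomial in \<open>t\<close>.
\<close>

definition emb :: "'a::field \<Rightarrow> 'a poly fract alg_closure" where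
  "emb a = to_ac (to_fract [:a:])"

definition gen :: "'a::field poly fract alg_closure" where
  "gen = to_ac (to_fract [:0, 1:])"

lemma emb_hom: "comm_ring_hom (emb :: 'a::field \<Rightarrow> _)"
proof
  show "emb (a + b) = emb a + emb b" for a b :: 'a
    unfolding emb_def by (simp flip: to_ac_add to_fract_add)
  show "emb (a * b) = emb a * emb b" for a b :: 'a
    unfolding emb_def by (simp flip: to_ac_mult to_fract_mult)
qed (simp_all add: emb_def flip: one_pCons)

lemma poly_at_gen: "poly (map_poly emb p) gen = to_ac (to_fract p)"
proof (induction p)
  case (pCons a p)
  interpret comm_ring_hom "emb :: 'a \<Rightarrow> _" by (rule emb_hom)
  have "pCons a p = [:a:] + [:0, 1:] * p" by simp
  then have "to_ac (to_fract (pCons a p)) = emb a + gen * to_ac (to_fract p)"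
    unfolding emb_def gen_def by (metis to_ac_add to_ac_mult to_fract_add to_fract_mult)
  then show ?case using pCons.IH by (simp add: map_poly_pCons_hom)
qed simp

lemma gen_transcendental: "poly (map_poly emb p) gen = 0 \<Longrightarrow> p = 0"
  unfolding poly_at_gen by (simp add: to_ac_eq_0)

lemma emb_eq_0: "emb a = 0 \<longleftrightarrow> a = 0" by (simp add: emb_def to_ac_eq_0)

lemma gen_neq_0: "(gen :: 'a::field poly fract alg_closure) \<noteq> 0"
  by (simp add: gen_def to_ac_eq_0)

text \<open>
  A relation for \<open>1/t\<close> becomes one for \<open>t\<close> by reversing the coefficients.
\<close>

lemma inverse_gen_transcendental:
  fixes p :: "'a::field poly"
  assumes "poly (map_poly emb p) (inverse gen) = 0" shows "p = 0"
proof -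
  have d: "degree (map_poly emb p) = degree p" by (rule degree_map_poly) (simp add: emb_eq_0)
  have "reflect_poly (map_poly emb p) = map_poly emb (reflect_poly p)"
    by (rule poly_eqI) (simp add: coeff_reflect_poly coeff_map_poly d emb_eq_0)
  then have "poly (map_poly emb (reflect_poly p)) gen = 0"
    using poly_reflect_poly_nz[OF gen_neq_0, of "map_poly emb p"] assms by simp
  then have "reflect_poly p = 0" by (rule gen_transcendental)
  then show ?thesis by simp
qed

locale jacobi_quartic =
  fixes c :: "'k::field"
  assumes two: "(2::'k) \<noteq> 0" and c0: "c \<noteq> 0" and c1: "c \<noteq> 1"
begin

definition c' :: "'k alg_closure" where "c' = to_ac c"

lemma c': "(2 :: 'k alg_closure) \<noteq> 0" "c' \<noteq> 0" "c' \<noteq> 1"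
  using two c0 c1 to_ac_eq_0[of "2::'k"] to_ac_eq_0[of c] to_ac_inj[of c 1] by (auto simp: c'_def)

text \<open>
  The quartic and its reverse \<open>u\<^sup>4 g(1/u)\<close>, each with a simple root split off.  The reverse describes
  the curve near its two points at infinity.
\<close>

definition g where "g = [:-1, 1:] * ([:1, 1:] * [:-c', 0, 1:])"
definition g' where "g' = [:-1, 1:] * ([:-1, -1:] * [:1, 0, -c':])"

lemma poly_g: "poly g u = (u ^ 2 - 1) * (u ^ 2 - c')"
  unfolding g_def poly_mult by (simp add: algebra_simps power2_eq_square)

lemma poly_g': "poly g' u = (1 - u ^ 2) * (1 - c' * u ^ 2)"
  unfolding g'_def poly_mult by (simp add: algebra_simps power2_eq_square)

abbreviation "x \<equiv> gen :: 'k alg_closure poly fract alg_closure"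

lemma x_neq_0: "x \<noteq> 0" by (rule gen_neq_0)

definition y where "y = (SOME v. v ^ 2 = poly (map_poly emb g) x)"

lemma y2: "y ^ 2 = poly (map_poly emb g) x"
  unfolding y_def by (rule someI_ex) (rule square_root_exists)

interpretation emb: comm_ring_hom "emb :: 'k alg_closure \<Rightarrow> _" by (rule emb_hom)
interpretation embp: map_poly_comm_ring_hom "emb :: 'k alg_closure \<Rightarrow> _" ..

lemma at_emb_g: "poly (map_poly emb g) z = (z ^ 2 - 1) * (z ^ 2 - emb c')"
  unfolding g_def embp.hom_mult poly_mult
  by (simp add: emb.map_poly_pCons_hom emb.hom_uminus algebra_simps power2_eq_square)

lemma at_emb_g': "poly (map_poly emb g') z = (1 - z ^ 2) * (1 - emb c' * z ^ 2)"
  unfolding g'_def embp.hom_mult poly_mult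
  by (simp add: emb.map_poly_pCons_hom emb.hom_uminus algebra_simps power2_eq_square)

sublocale q: quadratic_point emb g x y
proof
  show "a ^ 2 = b ^ 2 * g \<Longrightarrow> b = 0" for a b
    by (rule nonsquare_if_simple_root[OF g_def]) (use c' in auto)
qed (use gen_transcendental y2 in auto)

sublocale q': quadratic_point emb g' "inverse x" "y / x ^ 2"
proof
  show "a ^ 2 = b ^ 2 * g' \<Longrightarrow> b = 0" for a b
    by (rule nonsquare_if_simple_root[OF g'_def]) (use c' in auto)
  have "(y / x ^ 2) ^ 2 = (x ^ 2 - 1) * (x ^ 2 - emb c') / (x ^ 2 * x ^ 2)"
    by (simp add: power_divide y2 at_emb_g power2_eq_square[of "x ^ 2"])
  also have "\<dots> = ((x ^ 2 - 1) / x ^ 2) * ((x ^ 2 - emb c') / x ^ 2)" by simp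
  also have "(x ^ 2 - 1) / x ^ 2 = 1 - inverse x ^ 2" using x_neq_0 by (simp add: diff_divide_distrib inverse_eq_divide power_divide)
  also have "(x ^ 2 - emb c') / x ^ 2 = 1 - emb c' * inverse x ^ 2" using x_neq_0 by (simp add: diff_divide_distrib inverse_eq_divide power_divide)
  finally show "(y / x ^ 2) ^ 2 = poly (map_poly emb g') (inverse x)" unfolding at_emb_g' .
qed (use inverse_gen_transcendental in auto)

definition apt :: "'a::comm_ring_1 \<Rightarrow> 'a \<Rightarrow> nat \<Rightarrow> 'a" where
  "apt u v = (\<lambda>i. if i = 0 then 1 else if i = 1 then u else if i = 2 then v else 0)"

abbreviation "C \<equiv> quartic_curve c"

lemma C_def: "C = {proj_pt (apt u v) | u v. q.on_curve u v}"
  unfolding quartic_curve_def affine_pt_def apt_def q.on_curve_def poly_g c'_def ..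

lemma apt_in_space: "proj_pt (apt u v) \<in> proj_space 2"
  by (rule proj_pt_in_proj_space[of _ _ 0]) (auto simp: apt_def)

lemma corresponds_apt: "q.corresponds (\<lambda>p. mpoly_eval A (apt (fst p) (snd p))) (mev emb A (apt x y))"
proof -
  have "q.corresponds (\<lambda>p. apt (fst p) (snd p) i) (apt x y i)" for i
    using q.corresponds_const[of 0] q.corresponds_const[of 1] q.corresponds_x q.corresponds_y
    by (auto simp: apt_def)
  then show ?thesis using q.corresponds_mev[of "\<lambda>i p. apt (fst p) (snd p) i" "apt x y" A] by simp
qed

lemma generic_C: "generic_point emb 2 C (apt x y)"
proof
  show "C \<subseteq> proj_space 2" using apt_in_space by (auto simp: C_def)
  show "mev emb A (apt x y) = 0 \<longleftrightarrow> (\<forall>P\<in>C. vanishes_at A P)" if A: "hom_poly 2 d A" for d A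
  proof -
    have "(\<forall>P\<in>C. vanishes_at A P) \<longleftrightarrow> (\<forall>u v. q.on_curve u v \<longrightarrow> vanishes_at A (proj_pt (apt u v)))"
      unfolding C_def by blast
    then show ?thesis using q.corresponds_eq_0_iff[OF corresponds_apt, of A]
      unfolding vanishes_at_proj_pt[OF A] by simp
  qed
qed

lemma C_dependent:
  assumes "a \<in> function_field emb 2 (apt x y)" "b \<in> function_field emb 2 (apt x y)"
  shows "\<exists>P :: 'k alg_closure poly poly. P \<noteq> 0 \<and> poly (map_poly (\<lambda>p. poly (map_poly emb p) b) P) a = 0"
proof -
  obtain A B where a: "a = mev emb A (apt x y) / mev emb B (apt x y)" "mev emb B (apt x y) \<noteq> 0"
    using assms(1) by (auto simp: function_field_def)
  obtain A' B' where b: "b = mev emb A' (apt x y) / mev emb B' (apt x y)" "mev emb B' (apt x y) \<noteq> 0"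
    using assms(2) by (auto simp: function_field_def)
  show ?thesis unfolding a(1) b(1)
    by (rule q.corresponds_dependent[OF corresponds_apt corresponds_apt a(2) corresponds_apt corresponds_apt b(2)])
qed

text \<open>
  The functions \<open>1, x, y, x\<^sup>2\<close> embed the curve into \<open>\<P>\<^sup>3\<close>.  They satisfy two quadratic relations, and in
  contrast to the plane quartic the two points at infinity are separated and smooth.
\<close>

definition Q1 :: "'k alg_closure mpoly" where "Q1 = mq 1 1 1 - mq 1 0 3"
definition Q2 :: "'k alg_closure mpoly" where "Q2 = mq 1 2 2 - mq 1 3 3 + mq (1 + c') 0 3 - mq c' 0 0"

definition E where "E = proj_zeros 3 {Q1, Q2}"

lemma hom_Q: "hom_poly 3 2 Q1" "hom_poly 3 2 Q2"
  unfolding Q1_def Q2_def by (intro hom_poly_add hom_poly_diff hom_poly_mq; simp)+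

lemma eval_Q:
  "mpoly_eval Q1 z = z 1 ^ 2 - z 0 * z 3"
  "mpoly_eval Q2 z = z 2 ^ 2 - (z 3 - z 0) * (z 3 - c' * z 0)"
  unfolding Q1_def Q2_def mpoly_eval_mev
    comm_ring_hom.mev_diff[OF id_comm_ring_hom] comm_ring_hom.mev_add[OF id_comm_ring_hom]
    comm_ring_hom.mev_mq[OF id_comm_ring_hom]
  by (simp_all add: algebra_simps power2_eq_square)

lemma E_equations: "P \<in> E \<Longrightarrow> z \<in> P \<Longrightarrow> z 1 ^ 2 = z 0 * z 3 \<and> z 2 ^ 2 = (z 3 - z 0) * (z 3 - c' * z 0)"
  using eval_Q[of z] by (auto simp: E_def proj_zeros_def vanishes_at_def)

lemma in_E:
  assumes "\<And>i. i > 3 \<Longrightarrow> z i = 0" "j \<le> 3" "z j \<noteq> 0"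
    and "z 1 ^ 2 = z 0 * z 3" "z 2 ^ 2 = (z 3 - z 0) * (z 3 - c' * z 0)"
  shows "proj_pt z \<in> E"
proof -
  have "proj_pt z \<in> proj_space 3" using assms(1-3) by (rule proj_pt_in_proj_space)
  then show ?thesis unfolding E_def proj_zeros_def
    using assms(4,5) vanishes_at_proj_pt[OF hom_Q(1)] vanishes_at_proj_pt[OF hom_Q(2)] eval_Q[of z] by simp
qed

text \<open>
  The point of the model over the affine point \<open>(u, v)\<close>.
\<close>

definition cpt :: "'a::comm_ring_1 \<Rightarrow> 'a \<Rightarrow> nat \<Rightarrow> 'a" where
  "cpt u v = (\<lambda>i. if i = 0 then 1 else if i = 1 then u else if i = 2 then v else if i = 3 then u ^ 2 else 0)"

text \<open>
  The points at infinity of the model, for \<open>s\<^sup>2 = 1\<close>.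
\<close>

definition ipt :: "'a::comm_ring_1 \<Rightarrow> nat \<Rightarrow> 'a" where
  "ipt s = (\<lambda>i. if i = 2 then s else if i = 3 then 1 else 0)"

lemma cpt_in_E: "q.on_curve u v \<Longrightarrow> proj_pt (cpt u v) \<in> E"
  by (rule in_E[of _ 0]) (auto simp: cpt_def q.on_curve_def poly_g)

lemma ipt_in_E: "s ^ 2 = 1 \<Longrightarrow> proj_pt (ipt s) \<in> E"
  by (rule in_E[of _ 3]) (auto simp: ipt_def)

lemma nat_le_3_cases: "(i::nat) = 0 \<or> i = 1 \<or> i = 2 \<or> i = 3 \<or> i > 3" by linarith

text \<open>
  For \<open>z 0 \<noteq> 0\<close> the two equations say that the point lies in the affine chart.  For \<open>z 0 = 0\<close> they
  reduce to \<open>z 1 = 0\<close> and \<open>z 2\<^sup>2 = z 3\<^sup>2\<close>.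
\<close>

lemma E_vector_cases:
  assumes P: "P \<in> E" and z: "z \<in> P"
  shows "(\<exists>u v. q.on_curve u v \<and> z 0 \<noteq> 0 \<and> z = (\<lambda>i. z 0 * cpt u v i)) \<or>
    (\<exists>s. s ^ 2 = 1 \<and> z 3 \<noteq> 0 \<and> z = (\<lambda>i. z 3 * ipt s i))"
proof -
  have sp: "P \<in> proj_space 3" using P by (simp add: E_def proj_zeros_def)
  note zE = proj_space_E[OF sp z]
  note eq = E_equations[OF P z]
  show ?thesis
  proof (cases "z 0 = 0")
    case False
    define u v where "u = z 1 / z 0" and "v = z 2 / z 0"
    have z3: "z 3 = z 0 * u ^ 2" using eq False by (simp add: u_def field_simps power2_eq_square)
    have "v ^ 2 * z 0 ^ 2 = z 2 ^ 2" using False by (simp add: v_def power_divide)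
    also have "\<dots> = (z 3 - z 0) * (z 3 - c' * z 0)" using eq by simp
    also have "\<dots> = ((u ^ 2 - 1) * (u ^ 2 - c')) * z 0 ^ 2" unfolding z3 by (simp add: algebra_simps power2_eq_square)
    finally have "q.on_curve u v" using False by (simp add: q.on_curve_def poly_g)
    moreover have "z i = z 0 * cpt u v i" for i
      using nat_le_3_cases[of i] zE(2)[of i] z3 False by (auto simp: cpt_def u_def v_def)
    ultimately show ?thesis using False by blast
  next
    case True
    then have z1: "z 1 = 0" and z2: "z 2 ^ 2 = z 3 ^ 2" using eq by (auto simp: power2_eq_square)
    have z3: "z 3 \<noteq> 0"
    proof
      assume "z 3 = 0"
      then have "z i = 0" for i using nat_le_3_cases[of i] zE(2)[of i] z1 z2 True by auto
      then show False using zE(3) by blast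
    qed
    define s where "s = z 2 / z 3"
    have "s ^ 2 = 1" using z2 z3 by (simp add: s_def power_divide)
    moreover have "z i = z 3 * ipt s i" for i
      using nat_le_3_cases[of i] zE(2)[of i] z1 True z3 by (auto simp: ipt_def s_def)
    ultimately show ?thesis using z3 by blast
  qed
qed

lemma E_cases:
  assumes "P \<in> E"
  shows "(\<exists>u v. q.on_curve u v \<and> P = proj_pt (cpt u v)) \<or> (\<exists>s. s ^ 2 = 1 \<and> P = proj_pt (ipt s))"
proof -
  have sp: "P \<in> proj_space 3" using assms by (simp add: E_def proj_zeros_def)
  obtain z where z: "P = proj_pt z" using proj_space_rep[OF sp] by blast
  have "z \<in> P" using z proj_pt_self by simp
  from E_vector_cases[OF assms this] show ?thesis
    using z proj_pt_scale[of "z 0"] proj_pt_scale[of "z 3"] by metis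
qed

lemma E_space: "E \<subseteq> proj_space 3" by (auto simp: E_def proj_zeros_def)

lemma E_closed: "zariski_closed 3 E"
  unfolding zariski_closed_def E_def form_def using hom_Q by (intro exI[of _ "{Q1, Q2}"]) auto

lemma corresponds_cpt: "q.corresponds (\<lambda>p. mpoly_eval A (cpt (fst p) (snd p))) (mev emb A (cpt x y))"
proof -
  have "q.corresponds (fst * fst) (x * x)" by (intro q.corresponds_mult q.corresponds_x)
  then have "q.corresponds (\<lambda>p. fst p ^ 2) (x ^ 2)" by (simp add: power2_eq_square times_fun_def)
  then have "q.corresponds (\<lambda>p. cpt (fst p) (snd p) i) (cpt x y i)" for i
    using q.corresponds_const[of 0] q.corresponds_const[of 1] q.corresponds_x q.corresponds_y
    by (auto simp: cpt_def)
  then show ?thesis using q.corresponds_mev[of "\<lambda>i p. cpt (fst p) (snd p) i" "cpt x y" A] by simp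
qed

text \<open>
  The chart around infinity, with coordinates \<open>1/x\<close> and \<open>y/x\<^sup>2\<close>, which satisfy the reversed
  equation; the points at infinity have first coordinate \<open>0\<close>.
\<close>

definition cpt' :: "'a::comm_ring_1 \<Rightarrow> 'a \<Rightarrow> nat \<Rightarrow> 'a" where
  "cpt' u v = (\<lambda>i. if i = 0 then u ^ 2 else if i = 1 then u else if i = 2 then v else if i = 3 then 1 else 0)"

lemma corresponds_cpt':
  "q'.corresponds (\<lambda>p. mpoly_eval A (cpt' (fst p) (snd p))) (mev emb A (cpt' (inverse x) (y / x ^ 2)))"
proof -
  have "q'.corresponds (fst * fst) (inverse x * inverse x)" by (intro q'.corresponds_mult q'.corresponds_x)
  then have "q'.corresponds (\<lambda>p. fst p ^ 2) (inverse x ^ 2)" by (simp add: power2_eq_square times_fun_def)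
  then have "q'.corresponds (\<lambda>p. cpt' (fst p) (snd p) i) (cpt' (inverse x) (y / x ^ 2) i)" for i
    using q'.corresponds_const[of 0] q'.corresponds_const[of 1] q'.corresponds_x q'.corresponds_y
    by (auto simp: cpt'_def)
  then show ?thesis using q'.corresponds_mev[of "\<lambda>i p. cpt' (fst p) (snd p) i" "cpt' (inverse x) (y / x ^ 2)" A] by simp
qed

lemma cpt'_scaled: "cpt' (inverse x) (y / x ^ 2) = (\<lambda>i. inverse x ^ 2 * cpt x y i)"
proof
  fix i
  have "inverse x ^ 2 * x = inverse x" "inverse x ^ 2 * x ^ 2 = 1" "inverse x ^ 2 * y = y / x ^ 2"
    using x_neq_0 by (simp_all add: power2_eq_square divide_inverse mult_ac)
  then show "cpt' (inverse x) (y / x ^ 2) i = inverse x ^ 2 * cpt x y i"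
    using nat_le_3_cases[of i] by (auto simp: cpt'_def cpt_def)
qed

text \<open>
  A form that vanishes at the generic point vanishes on each of the two charts, since the generic
  points of both charts are proportional.
\<close>

lemma generic_E: "generic_point emb 3 E (cpt x y)"
proof
  show "E \<subseteq> proj_space 3" by (rule E_space)
  show "mev emb A (cpt x y) = 0 \<longleftrightarrow> (\<forall>P\<in>E. vanishes_at A P)" if A: "hom_poly 3 d A" for d A
  proof
    assume z: "mev emb A (cpt x y) = 0"
    have aff: "mpoly_eval A (cpt u v) = 0" if "q.on_curve u v" for u v
      using q.corresponds_eq_0_iff[OF corresponds_cpt, of A] z that by simp
    have "mev emb A (cpt' (inverse x) (y / x ^ 2)) = 0"
      unfolding cpt'_scaled mev_scale[OF A] using z by simp
    then have inf: "mpoly_eval A (cpt' u v) = 0" if "q'.on_curve u v" for u v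
      using q'.corresponds_eq_0_iff[OF corresponds_cpt', of A] that by simp
    have ii: "ipt s = cpt' 0 s" for s :: "'k alg_closure" by (rule ext) (simp add: ipt_def cpt'_def)
    show "\<forall>P\<in>E. vanishes_at A P"
    proof
      fix P assume "P \<in> E"
      from E_cases[OF this] show "vanishes_at A P"
      proof (elim disjE exE conjE)
        fix u v assume "q.on_curve u v" "P = proj_pt (cpt u v)"
        then show ?thesis using aff vanishes_at_proj_pt[OF A] by simp
      next
        fix s assume s: "s ^ 2 = 1" "P = proj_pt (ipt s)"
        then have "q'.on_curve 0 s" by (simp add: q'.on_curve_def poly_g')
        then show ?thesis using inf s(2) ii vanishes_at_proj_pt[OF A] by simp
      qed
    qed
  next
    assume "\<forall>P\<in>E. vanishes_at A P"
    then have "mpoly_eval A (cpt u v) = 0" if "q.on_curve u v" for u v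
      using cpt_in_E[OF that] vanishes_at_proj_pt[OF A] by blast
    then show "mev emb A (cpt x y) = 0" using q.corresponds_eq_0_iff[OF corresponds_cpt, of A] by simp
  qed
qed

interpretation E: generic_point emb 3 E "cpt x y" by (rule generic_E)

lemma on_curve_1: "q.on_curve 1 0" by (simp add: q.on_curve_def poly_g)

lemma E_irreducible: "irreducible_closed 3 E"
  using E.irreducible[OF E_closed] cpt_in_E[OF on_curve_1] by blast

text \<open>
  A form that vanishes on \<open>Z\<close> but not on \<open>E\<close> has finitely many zeros in the affine chart, and
  there are two points outside it.
\<close>

lemma finite_if_proper:
  assumes Z: "zariski_closed 3 Z" "Z \<subset> E" shows "finite Z"
proof -
  obtain S where S: "\<forall>f\<in>S. form 3 f" "Z = proj_zeros 3 S" using Z(1) by (auto simp: zariski_closed_def)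
  obtain P where P: "P \<in> E" "P \<notin> Z" using Z(2) by blast
  then obtain f where f: "f \<in> S" "\<not> vanishes_at f P" using S(2) E_space by (auto simp: proj_zeros_def)
  then obtain d where d: "hom_poly 3 d f" using S(1) by (auto simp: form_def)
  have "mev emb f (cpt x y) \<noteq> 0" using E.generic[OF d] f(2) P(1) by blast
  then have fin: "finite {(u, v). q.on_curve u v \<and> mpoly_eval f (cpt u v) = 0}"
    using q.corresponds_finite_zeros[OF corresponds_cpt, of f] by simp
  have "Z \<subseteq> (\<lambda>(u, v). proj_pt (cpt u v)) ` {(u, v). q.on_curve u v \<and> mpoly_eval f (cpt u v) = 0} \<union>
      (\<lambda>s. proj_pt (ipt s)) ` {1, -1}"
  proof
    fix Q assume Q: "Q \<in> Z"
    then have "Q \<in> E" using Z(2) by blast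
    have van: "vanishes_at f Q" using Q S(2) f(1) by (auto simp: proj_zeros_def)
    from E_cases[OF \<open>Q \<in> E\<close>] show "Q \<in> (\<lambda>(u, v). proj_pt (cpt u v)) ` {(u, v). q.on_curve u v \<and> mpoly_eval f (cpt u v) = 0} \<union>
      (\<lambda>s. proj_pt (ipt s)) ` {1, -1}"
    proof (elim disjE exE conjE)
      fix u v assume "q.on_curve u v" "Q = proj_pt (cpt u v)"
      then show ?thesis using van vanishes_at_proj_pt[OF d] by auto
    next
      fix s assume s: "s ^ 2 = 1" "Q = proj_pt (ipt s)"
      then have "s = 1 \<or> s = -1" by (simp add: power2_eq_1_iff)
      then show ?thesis using s(2) by auto
    qed
  qed
  then show ?thesis using fin by (meson finite_UnI finite_imageI finite_insert finite.emptyI finite_subset)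
qed

lemma E_dim: "has_zariski_dim 3 E 1"
  unfolding has_zariski_dim_def
proof
  let ?P = "proj_pt (cpt (1::'k alg_closure) 0)" and ?Q = "proj_pt (ipt (1::'k alg_closure))"
  have P: "?P \<in> E" "?Q \<in> E" using cpt_in_E[OF on_curve_1] ipt_in_E[of 1] by auto
  have "?P \<noteq> ?Q"
  proof
    assume "?P = ?Q"
    from proj_pt_eq_imp_scale[OF this] obtain a where "cpt 1 0 = (\<lambda>i. a * ipt (1::'k alg_closure) i)" by blast
    from fun_cong[OF this, of 0] show False by (simp add: cpt_def ipt_def)
  qed
  then have "{?P} \<subset> E" using P by blast
  then show "closed_chain 3 E 1"
    unfolding closed_chain_def using E_irreducible irreducible_singleton[of ?P 3] P E_space
    by (intro exI[of _ "\<lambda>i. if i = 0 then {?P} else E"]) auto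
  show "\<not> closed_chain 3 E (Suc 1)"
  proof
    assume "closed_chain 3 E (Suc 1)"
    then obtain W where W: "\<And>i. i \<le> Suc 1 \<Longrightarrow> irreducible_closed 3 (W i) \<and> W i \<subseteq> E"
      "\<And>i. i < Suc 1 \<Longrightarrow> W i \<subset> W (Suc i)" unfolding closed_chain_def by blast
    have 1: "W 0 \<subset> W 1" "W 1 \<subset> W (Suc 1)" "W (Suc 1) \<subseteq> E" using W(2)[of 0] W(2)[of 1] W(1)[of "Suc 1"] by auto
    have irr: "irreducible_closed 3 (W 0)" "irreducible_closed 3 (W 1)" using W(1)[of 0] W(1)[of 1] by auto
    have "finite (W 1)" using finite_if_proper[of "W 1"] irr(2) 1 by (auto simp: irreducible_closed_def)
    moreover obtain P where P: "P \<in> W 0" using irr(1) by (auto simp: irreducible_closed_def)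
    moreover from this have "P \<in> W 1" using 1(1) by auto
    ultimately have "W 1 = {P}" by (intro finite_irreducible_singleton[OF irr(2)])
    then show False using 1(1) P by auto
  qed
qed

lemma E_projective_curve: "projective_curve 3 E"
proof -
  have "over_base Q1" "over_base Q2"
    unfolding Q1_def Q2_def c'_def
    by (intro over_base_add over_base_diff over_base_single base_field_add base_field_1 base_field_to_ac)+
  then have "\<exists>S. (\<forall>f\<in>S. form 3 f \<and> over_base f) \<and> E = proj_zeros 3 S"
    using hom_Q unfolding E_def form_def by (intro exI[of _ "{Q1, Q2}"]) auto
  then show ?thesis unfolding projective_curve_def using E_irreducible E_dim by blast
qed

lemma gradient_Q1: "gradient 3 Q1 z i =
    (if i = 0 then - z 3 else if i = 1 then 2 * z 1 else if i = 2 then 0 else if i = 3 then - z 0 else 0)"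
  using nat_le_3_cases[of i] unfolding gradient_def deriv_eval_def[symmetric] Q1_def deriv_eval_diff deriv_eval_mq
  by (elim disjE) simp_all

lemma gradient_Q2: "gradient 3 Q2 z i =
    (if i = 0 then (1 + c') * z 3 - 2 * c' * z 0 else if i = 1 then 0 else if i = 2 then 2 * z 2
     else if i = 3 then (1 + c') * z 0 - 2 * z 3 else 0)"
  using nat_le_3_cases[of i] unfolding gradient_def deriv_eval_def[symmetric] Q2_def deriv_eval_add deriv_eval_diff deriv_eval_mq
  by (elim disjE) (simp_all add: algebra_simps)

text \<open>
  A dependency with \<open>b \<noteq> 0\<close> forces \<open>z 2 = 0\<close>, hence \<open>z 3\<close> to be one of the two roots \<open>z 0\<close>, \<open>c' z 0\<close>,
  and contradicts that these are distinct.
\<close>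

lemma gradients_independent:
  assumes P: "P \<in> E" "z \<in> P" and eq: "\<And>i. a * gradient 3 Q1 z i + b * gradient 3 Q2 z i = 0"
  shows "a = 0 \<and> b = 0"
proof -
  have sp: "P \<in> proj_space 3" by (rule subsetD[OF E_space P(1)])
  note zE = proj_space_E[OF sp P(2)]
  note eqs = E_equations[OF P]
  have nz: "\<not> (z 0 = 0 \<and> z 1 = 0 \<and> z 2 = 0 \<and> z 3 = 0)"
  proof
    assume "z 0 = 0 \<and> z 1 = 0 \<and> z 2 = 0 \<and> z 3 = 0"
    then have "z i = 0" for i using nat_le_3_cases[of i] zE(2)[of i] by auto
    then show False using zE(3) by blast
  qed
  have 0: "b * ((1 + c') * z 3 - 2 * c' * z 0) = a * z 3" using eq[of 0] by (simp add: gradient_Q1 gradient_Q2 algebra_simps)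
  have 1: "a * z 1 = 0" using eq[of 1] c'(1) by (simp add: gradient_Q1 gradient_Q2)
  have 2: "b * z 2 = 0" using eq[of 2] c'(1) by (simp add: gradient_Q1 gradient_Q2)
  have 3: "b * ((1 + c') * z 0 - 2 * z 3) = a * z 0" using eq[of 3] by (simp add: gradient_Q1 gradient_Q2 algebra_simps)
  have b: "b = 0"
  proof (rule ccontr)
    assume b: "b \<noteq> 0"
    then have z2: "z 2 = 0" using 2 by simp
    then have z3: "z 3 = z 0 \<or> z 3 = c' * z 0" using eqs by simp
    have z0: "z 0 \<noteq> 0" using nz z2 z3 eqs by auto
    then have "z 1 \<noteq> 0" using z3 eqs c'(2) by (auto simp: power2_eq_square)
    then have a: "a = 0" using 1 by simp
    from z3 show False
    proof
      assume "z 3 = z 0"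
      then have "(c' - 1) * z 0 = 0" using 3 a b by (simp add: algebra_simps)
      then show False using z0 c' by simp
    next
      assume "z 3 = c' * z 0"
      then have "(1 - c') * z 0 = 0" using 3 a b by (simp add: algebra_simps)
      then show False using z0 c' by simp
    qed
  qed
  moreover have "a = 0"
  proof (rule ccontr)
    assume "a \<noteq> 0"
    then have "z 0 = 0" "z 1 = 0" "z 3 = 0" using 0 1 3 b by auto
    then show False using nz eqs by simp
  qed
  ultimately show ?thesis by blast
qed

text \<open>
  The two equations contribute rank two.  Rank three would make the generic point constant, but the
  quotient \<open>x\<close> of two of its coordinates is transcendental.
\<close>

lemma E_nonsingular: "nonsingular_curve 3 E"
  unfolding nonsingular_curve_def
proof (intro ballI)
  fix P z assume P: "P \<in> E" and z: "z \<in> P"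
  have sp: "P \<in> proj_space 3" by (rule subsetD[OF E_space P])
  obtain j where j: "j \<le> 3" "z j \<noteq> 0" using proj_space_E(3)[OF sp z] by blast
  define w where "w = (\<lambda>i. inverse (z j) * z i)"
  have w: "w \<in> P" "w j = 1" using scale_in_point[OF sp z, of "inverse (z j)"] j by (auto simp: w_def)
  have van: "form 3 Q1" "\<forall>P\<in>E. vanishes_at Q1 P" "form 3 Q2" "\<forall>P\<in>E. vanishes_at Q2 P"
    using hom_Q by (auto simp: form_def E_def proj_zeros_def)
  have "jacobian_rank 3 E w \<ge> 2"
    by (rule E.jacobian_rank_ge_2[OF P w(1) j(1) w(2) van]) (rule gradients_independent[OF P w(1)])
  moreover have "jacobian_rank 3 E w \<le> 3" by (rule E.jacobian_rank_le[OF P w(1) j(1) w(2)])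
  moreover have "jacobian_rank 3 E w \<noteq> 3"
  proof
    assume full: "jacobian_rank 3 E w = 3"
    note const = E.full_rank_imp_constant[OF P w(1) j(1) w(2) full]
    define k where "k = cpt x y j"
    have k: "1 = k * emb (w 0)" "x = k * emb (w 1)" using const[of 0] const[of 1] by (simp_all add: cpt_def k_def)
    have "emb (w 0) * x = emb (w 0) * (k * emb (w 1))" using k(2) by (rule arg_cong)
    also have "\<dots> = (k * emb (w 0)) * emb (w 1)" by (simp only: mult_ac)
    also have "\<dots> = emb (w 1)" unfolding k(1)[symmetric] by simp
    finally have "emb (w 0) * x = emb (w 1)" .
    then have "poly (map_poly emb [:- w 1, w 0:]) x = 0"
      by (simp add: emb.map_poly_pCons_hom emb.hom_uminus mult.commute)
    then have "[:- w 1, w 0:] = 0" by (rule gen_transcendental)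
    then have "w 0 = 0" by simp
    then show False using k(1) by simp
  qed
  ultimately have "jacobian_rank 3 E w = 2" by linarith
  moreover have "jacobian_rank 3 E w = jacobian_rank 3 E z" unfolding w_def using j by (intro jacobian_rank_scale) simp
  ultimately show "jacobian_rank 3 E z = 3 - 1" by simp
qed

text \<open>
  The embedding \<open>(1 : u : v) \<mapsto> (1 : u : v : u\<^sup>2)\<close>, in forms of degree two, and the projection back.
  The projection is multiplied by \<open>X\<^sub>0\<close>: this makes it undefined at infinity, so that all its values
  lie on the affine curve.
\<close>

definition F :: "nat \<Rightarrow> 'k alg_closure mpoly" where "F i = (if i = 3 then mq 1 1 1 else mq 1 0 i)"
definition G :: "nat \<Rightarrow> 'k alg_closure mpoly" where "G i = mq 1 0 i"

lemma F:
  assumes "i \<le> 3" shows "hom_poly 2 2 (F i) \<and> over_base (F i)"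
proof (cases "i = 3")
  case True
  show ?thesis unfolding F_def if_P[OF True]
    by (intro conjI hom_poly_mq over_base_single base_field_1; simp)
next
  case False
  show ?thesis unfolding F_def if_not_P[OF False]
    by (intro conjI hom_poly_mq over_base_single base_field_1; use assms False in simp)
qed

lemma G:
  assumes "i \<le> 2" shows "hom_poly 3 2 (G i) \<and> over_base (G i)"
  unfolding G_def by (intro conjI hom_poly_mq over_base_single base_field_1; use assms in simp)

lemma tuple_F: "tuple_eval 3 F (apt u v) = cpt u v"
proof
  fix i show "tuple_eval 3 F (apt u v) i = cpt u v i"
    using nat_le_3_cases[of i] by (auto simp: tuple_eval_def F_def mpoly_eval_mq[simplified] apt_def cpt_def power2_eq_square)
qed

lemma tuple_G: "tuple_eval 2 G (cpt u v) = apt u v"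
proof
  fix i show "tuple_eval 2 G (cpt u v) i = apt u v i"
    using nat_le_3_cases[of i] by (auto simp: tuple_eval_def G_def mpoly_eval_mq[simplified] apt_def cpt_def)
qed

lemma map_F: "map_pt 3 F (proj_pt (apt u v)) = proj_pt (cpt u v)"
proof -
  have "map_pt 3 F (proj_pt (apt u v)) = proj_pt (tuple_eval 3 F (apt u v))" by (rule map_pt_proj_pt) (use F in blast)
  then show ?thesis unfolding tuple_F .
qed

lemma map_G: "map_pt 2 G (proj_pt (cpt u v)) = proj_pt (apt u v)"
proof -
  have "map_pt 2 G (proj_pt (cpt u v)) = proj_pt (tuple_eval 2 G (cpt u v))" by (rule map_pt_proj_pt) (use G in blast)
  then show ?thesis unfolding tuple_G .
qed

lemma defined_F: "defined_at 3 F (proj_pt (apt u v))"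
proof -
  have "defined_at 3 F (proj_pt (apt u v)) \<longleftrightarrow> (\<exists>i\<le>3. mpoly_eval (F i) (apt u v) \<noteq> 0)"
    by (rule defined_at_proj_pt) (use F in blast)
  moreover have "mpoly_eval (F 0) (apt u v) \<noteq> 0" by (simp add: F_def mpoly_eval_mq[simplified] apt_def)
  ultimately show ?thesis by blast
qed

lemma defined_G: "defined_at 2 G (proj_pt z) \<longleftrightarrow> (\<exists>i\<le>2. z 0 * z i \<noteq> 0)"
proof -
  have "defined_at 2 G (proj_pt z) \<longleftrightarrow> (\<exists>i\<le>2. mpoly_eval (G i) z \<noteq> 0)"
    by (rule defined_at_proj_pt) (use G in blast)
  then show ?thesis by (simp add: G_def mpoly_eval_mq[simplified])
qed

lemma defined_G_cpt: "defined_at 2 G (proj_pt (cpt u v))"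
  unfolding defined_G by (intro exI[of _ 0]) (simp add: cpt_def)

lemma defined_G_E: "P \<in> E \<Longrightarrow> defined_at 2 G P \<Longrightarrow> \<exists>u v. q.on_curve u v \<and> P = proj_pt (cpt u v)"
proof -
  assume P: "P \<in> E" "defined_at 2 G P"
  have "\<not> defined_at 2 G (proj_pt (ipt s))" for s unfolding defined_G by (simp add: ipt_def)
  then show ?thesis using E_cases[OF P(1)] P(2) by blast
qed

lemma E_birational: "birational 2 3 C E"
  unfolding birational_def
proof (intro exI conjI)
  have P1: "proj_pt (apt 1 0) \<in> C" unfolding C_def using on_curve_1 by blast
  have P2: "proj_pt (cpt 1 0) \<in> E" by (rule cpt_in_E[OF on_curve_1])
  show "rational_map 2 3 C E F"
    unfolding rational_map_def
  proof (intro conjI ballI impI)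
    show "\<exists>d. \<forall>i\<le>3. hom_poly 2 d (F i) \<and> over_base (F i)" using F by blast
    show "\<exists>P\<in>C. defined_at 3 F P" using P1 defined_F by blast
    show "map_pt 3 F P \<in> E" if P: "P \<in> C" for P
    proof -
      obtain u v where uv: "q.on_curve u v" "P = proj_pt (apt u v)" using P unfolding C_def by blast
      show ?thesis unfolding uv(2) map_F by (rule cpt_in_E[OF uv(1)])
    qed
  qed
  show "rational_map 3 2 E C G"
    unfolding rational_map_def
  proof (intro conjI ballI impI)
    show "\<exists>d. \<forall>i\<le>2. hom_poly 3 d (G i) \<and> over_base (G i)" using G by blast
    show "\<exists>P\<in>E. defined_at 2 G P" using P2 defined_G_cpt by blast
    show "map_pt 2 G P \<in> C" if P: "P \<in> E" "defined_at 2 G P" for P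
    proof -
      obtain u v where uv: "q.on_curve u v" "P = proj_pt (cpt u v)" using defined_G_E[OF P] by blast
      show ?thesis unfolding uv(2) map_G C_def using uv(1) by blast
    qed
  qed
  show "left_inverse_on 2 3 C F G"
    unfolding left_inverse_on_def
  proof (intro conjI ballI impI)
    show "\<exists>P\<in>C. defined_at 3 F P \<and> defined_at 2 G (map_pt 3 F P)"
      by (rule bexI[OF _ P1]) (simp only: defined_F defined_G_cpt map_F)
    show "map_pt 2 G (map_pt 3 F P) = P" if P: "P \<in> C" for P
    proof -
      obtain u v where uv: "q.on_curve u v" "P = proj_pt (apt u v)" using P unfolding C_def by blast
      show ?thesis unfolding uv(2) map_F map_G ..
    qed
  qed
  show "left_inverse_on 3 2 E G F"
    unfolding left_inverse_on_def
  proof (intro conjI ballI impI)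
    show "\<exists>P\<in>E. defined_at 2 G P \<and> defined_at 3 F (map_pt 2 G P)"
      by (rule bexI[OF _ P2]) (simp only: defined_F defined_G_cpt map_G)
    show "map_pt 3 F (map_pt 2 G P) = P" if P: "P \<in> E" "defined_at 2 G P" for P
    proof -
      obtain u v where uv: "P = proj_pt (cpt u v)" using defined_G_E[OF P] by blast
      show ?thesis unfolding uv map_F map_G ..
    qed
  qed
qed

theorem E_smooth_model: "smooth_projective_model C 3 E"
  unfolding smooth_projective_model_def using E_projective_curve E_nonsingular E_birational by blast

end

section \<open>The point count\<close>

text \<open>
  The equation \<open>a\<^sup>l = a\<close> has at most \<open>l\<close> solutions, and the elements of the base field are \<open>l\<close> solutions.
\<close>

lemma base_field_mod_ring:
  "(base_field :: 'l::prime_card mod_ring alg_closure set) = {a. a ^ CARD('l) = a}"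
proof -
  let ?B = "base_field :: 'l mod_ring alg_closure set" and ?R = "{a :: 'l mod_ring alg_closure. a ^ CARD('l) = a}"
  define p where "p = monom 1 CARD('l) - [:0, 1 :: 'l mod_ring alg_closure:]"
  have l: "CARD('l) > 1" using prime_gt_1_nat[OF prime_card] .
  have "degree p = CARD('l)"
  proof -
    have "p = monom 1 CARD('l) + [:0, -1:]" by (simp add: p_def)
    then show ?thesis using degree_add_eq_left[of "[:0, -1:]" "monom (1::'l mod_ring alg_closure) CARD('l)"] l
      by (simp only: degree_monom_eq) (simp add: degree_monom_eq)
  qed
  moreover from this have "p \<noteq> 0" using l by auto
  moreover have R: "?R = {a. poly p a = 0}" by (simp add: p_def poly_monom)
  ultimately have "finite ?R" "card ?R \<le> CARD('l)"
    using poly_roots_finite[of p] card_poly_roots_bound[of p] by auto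
  moreover have "?B \<subseteq> ?R"
  proof
    fix a assume "a \<in> ?B"
    then obtain b :: "'l mod_ring" where b: "a = to_ac b" by (auto simp: base_field_def)
    have "b ^ CARD('l) = b" using finite_field_power_card_eq_same[of b] by simp
    then show "a \<in> ?R" unfolding b by (simp flip: to_ac_power)
  qed
  moreover have "card ?B = CARD('l)"
    unfolding base_field_def using card_image[of "to_ac :: 'l mod_ring \<Rightarrow> _" UNIV] by (simp add: inj_on_def to_ac_inj)
  ultimately show ?thesis by (intro card_seteq) auto
qed

lemma frobenius_mod_ring:
  "frobenius (\<lambda>a :: 'l::prime_card mod_ring alg_closure. a ^ CARD('l))"
proof
  have l: "CARD('l) > 0" by simp
  show "(a + b) ^ CARD('l) = a ^ CARD('l) + b ^ CARD('l)" for a b :: "'l mod_ring alg_closure"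
    by (rule freshmans_dream) (simp_all add: prime_card)
  have "\<exists>b. b ^ CARD('l) = a" for a :: "'l mod_ring alg_closure"
  proof -
    have "degree (monom 1 CARD('l) + [:-a:]) = CARD('l)"
      using l by (subst degree_add_eq_left) (simp_all add: degree_monom_eq)
    then obtain b where "poly (monom 1 CARD('l) + [:-a:]) b = 0"
      using alg_closed_imp_poly_has_root l by metis
    then show ?thesis by (intro exI[of _ b]) (simp add: poly_monom)
  qed
  then show "surj (\<lambda>a :: 'l mod_ring alg_closure. a ^ CARD('l))" unfolding surj_def by metis
  show "base_field = {a :: 'l mod_ring alg_closure. a ^ CARD('l) = a}" by (rule base_field_mod_ring)
qed (simp_all add: power_mult_distrib)

text \<open>
  Quotients of the entries of a vector over the base field lie in the base field; in particular
  the affine coordinates of a rational point do.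
\<close>

lemma (in jacobi_quartic) rational_points_E:
  "rational_points E = (\<lambda>(u, v). proj_pt (cpt (to_ac u) (to_ac v))) ` {(u, v). v ^ 2 = (u ^ 2 - 1) * (u ^ 2 - c)} \<union>
     (\<lambda>s. proj_pt (ipt (to_ac s))) ` {1, -1}" (is "?R = ?A \<union> ?B")
proof (intro Set.set_eqI iffI)
  fix P assume "P \<in> ?A \<union> ?B"
  then show "P \<in> ?R"
  proof
    assume "P \<in> ?A"
    then obtain u v where uv: "v ^ 2 = (u ^ 2 - 1) * (u ^ 2 - c)" "P = proj_pt (cpt (to_ac u) (to_ac v))" by auto
    have "to_ac (v ^ 2) = to_ac ((u ^ 2 - 1) * (u ^ 2 - c))" using uv(1) by (rule arg_cong)
    then have "q.on_curve (to_ac u) (to_ac v)" by (simp add: q.on_curve_def poly_g c'_def)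
    moreover have "cpt (to_ac u) (to_ac v) i \<in> base_field" for i
      using base_field_to_ac[of u] base_field_to_ac[of v] base_field_to_ac[of "u ^ 2"] base_field_0 base_field_1
      by (auto simp: cpt_def)
    ultimately show ?thesis using cpt_in_E proj_pt_self unfolding uv(2) rational_points_def by blast
  next
    assume "P \<in> ?B"
    then obtain s where s0: "P = proj_pt (ipt (to_ac s))" "s \<in> {1, -1}" by (rule imageE)
    then have s: "s = 1 \<or> s = -1" "P = proj_pt (ipt (to_ac s))" by simp_all
    then have "to_ac s ^ 2 = 1" by auto
    moreover have "ipt (to_ac s) i \<in> base_field" for i
      using base_field_to_ac[of s] base_field_0 base_field_1 by (auto simp: ipt_def)
    ultimately show ?thesis using ipt_in_E proj_pt_self unfolding s(2) rational_points_def by blast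
  qed
next
  fix P assume "P \<in> ?R"
  then obtain z where z: "P \<in> E" "z \<in> P" "range z \<subseteq> base_field" by (auto simp: rational_points_def)
  have sp: "P \<in> proj_space 3" by (rule subsetD[OF E_space z(1)])
  have Pz: "P = proj_pt z" by (rule proj_space_E(1)[OF sp z(2)])
  have quot: "\<exists>a. z i / z j = to_ac a" for i j
  proof -
    have "z i \<in> base_field" "z j \<in> base_field" using z(3) by blast+
    then obtain a b where "z i = to_ac a" "z j = to_ac b" unfolding base_field_def by blast
    then show ?thesis by (intro exI[of _ "a / b"]) simp
  qed
  from E_vector_cases[OF z(1,2)] show "P \<in> ?A \<union> ?B"
  proof (elim disjE exE conjE)
    fix u v assume uv: "q.on_curve u v" "z 0 \<noteq> 0" "z = (\<lambda>i. z 0 * cpt u v i)"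
    have "u = z 1 / z 0" "v = z 2 / z 0"
      using fun_cong[OF uv(3), of 1] fun_cong[OF uv(3), of 2] uv(2) by (simp_all add: cpt_def field_simps)
    then obtain a b where ab: "u = to_ac a" "v = to_ac b" using quot by metis
    have "to_ac (b ^ 2) = to_ac ((a ^ 2 - 1) * (a ^ 2 - c))"
      using uv(1) by (simp add: ab q.on_curve_def poly_g c'_def)
    then have "b ^ 2 = (a ^ 2 - 1) * (a ^ 2 - c)" unfolding to_ac_inj .
    moreover have "P = proj_pt (cpt (to_ac a) (to_ac b))"
      using Pz uv(3) proj_pt_scale[OF uv(2), of "cpt u v"] unfolding ab by simp
    ultimately show ?thesis by blast
  next
    fix s assume s: "s ^ 2 = 1" "z 3 \<noteq> 0" "z = (\<lambda>i. z 3 * ipt s i)"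
    have P: "P = proj_pt (ipt s)" using Pz s(3) proj_pt_scale[OF s(2), of "ipt s"] by simp
    have "s = to_ac 1 \<or> s = to_ac (-1)" using s(1) by (simp add: power2_eq_1_iff)
    then have "P \<in> ?B" unfolding P by auto
    then show ?thesis by blast
  qed
qed

text \<open>
  Over each \<open>u\<close> there are \<open>1 + \<chi>((u\<^sup>2 - 1) (u\<^sup>2 - c))\<close> affine points, and two points lie at infinity.
\<close>

lemma card_rational_points_E:
  fixes c :: "'l::prime_card mod_ring"
  assumes l: "CARD('l) > 2" and "jacobi_quartic c"
  shows "int (card (rational_points (jacobi_quartic.E c))) = int CARD('l) + K 1 c + 2"
proof -
  interpret jacobi_quartic c by fact
  let ?S = "{(u, v). v ^ 2 = (u ^ 2 - 1) * (u ^ 2 - c)}"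
  let ?f = "\<lambda>(u, v). proj_pt (cpt (to_ac u) (to_ac v))" and ?h = "\<lambda>s :: 'l mod_ring. proj_pt (ipt (to_ac s))"
  have inj_f: "inj_on ?f ?S"
  proof (rule inj_onI, clarify)
    fix u v u' v' :: "'l mod_ring"
    assume "proj_pt (cpt (to_ac u) (to_ac v)) = proj_pt (cpt (to_ac u') (to_ac v'))"
    from proj_pt_eq_imp_scale[OF this] obtain a
      where a: "cpt (to_ac u) (to_ac v) = (\<lambda>i. a * cpt (to_ac u') (to_ac v') i)" by blast
    have "a = 1" using fun_cong[OF a, of 0] by (simp add: cpt_def)
    then show "u = u' \<and> v = v'"
      using fun_cong[OF a, of 1] fun_cong[OF a, of 2] by (simp add: cpt_def to_ac_inj)
  qed
  have "?h 1 \<noteq> ?h (-1)"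
  proof
    assume "?h 1 = ?h (-1)"
    from proj_pt_eq_imp_scale[OF this] obtain a
      where a: "ipt (to_ac (1::'l mod_ring)) = (\<lambda>i. a * ipt (to_ac (-1::'l mod_ring)) i)" by blast
    have "a = 1" using fun_cong[OF a, of 3] by (simp add: ipt_def)
    then have "to_ac (1::'l mod_ring) = to_ac (-1)" using fun_cong[OF a, of 2] by (simp only: ipt_def) simp
    then have "(1::'l mod_ring) = -1" unfolding to_ac_inj .
    then show False using two by (simp add: eq_neg_iff_add_eq_0)
  qed
  then have card_h: "card (?h ` {1, -1}) = 2" by simp
  have disj: "?f ` ?S \<inter> ?h ` {1, -1} = {}"
  proof -
    have "proj_pt (cpt u v) \<noteq> proj_pt (ipt s)" for u v s :: "'l mod_ring alg_closure"
    proof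
      assume "proj_pt (cpt u v) = proj_pt (ipt s)"
      from proj_pt_eq_imp_scale[OF this] obtain a where a: "cpt u v = (\<lambda>i. a * ipt s i)" by blast
      show False using fun_cong[OF a, of 0] by (simp add: cpt_def ipt_def)
    qed
    then show ?thesis by auto
  qed
  have "?S = (SIGMA u:UNIV. {v. v ^ 2 = (u ^ 2 - 1) * (u ^ 2 - c)})" by auto
  then have "card ?S = (\<Sum>u\<in>UNIV. card {v. v ^ 2 = (u ^ 2 - 1) * (u ^ 2 - c)})" by (simp add: card_SigmaI)
  then have "int (card ?S) = (\<Sum>u\<in>UNIV. 1 + chi ((u ^ 2 - 1) * (u ^ 2 - c)))"
    by (simp add: card_square_roots[OF l])
  also have "\<dots> = int CARD('l) + K 1 c" by (simp add: sum.distrib K_def)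
  finally have S: "int (card ?S) = int CARD('l) + K 1 c" .
  have "card (rational_points E) = card (?f ` ?S) + card (?h ` {1, -1})"
    unfolding rational_points_E by (rule card_Un_disjoint) (use disj in auto)
  also have "card (?f ` ?S) = card ?S" by (rule card_image[OF inj_f])
  finally show ?thesis using S card_h by simp
qed

lemma jacobi_quartic_if_nonresidue:
  fixes c :: "'l::prime_card mod_ring"
  assumes l: "CARD('l) > 2" and c: "chi c = -1"
  shows "jacobi_quartic c"
proof
  show "(2 :: 'l mod_ring) \<noteq> 0" by (rule two_neq_0_mod_ring[OF l])
  show "c \<noteq> 0" using c chi_eq_0_iff[of c] by auto
  show "c \<noteq> 1" using c chi_one[where 'l = 'l] by auto
qed

text \<open>
  All smooth models have as many rational points as the intersection of quadrics, where they have
  been counted.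
\<close>

lemma frobenius_trace_quartic:
  fixes c :: "'l::prime_card mod_ring"
  assumes l: "CARD('l) > 2" and c: "chi c = -1" and E': "smooth_projective_model (quartic_curve c) n E'"
  shows "frobenius_trace E' = - (K 1 c + 1)"
proof -
  interpret jq: jacobi_quartic c by (rule jacobi_quartic_if_nonresidue[OF l c])
  interpret fr: frobenius "\<lambda>a :: 'l mod_ring alg_closure. a ^ CARD('l)" by (rule frobenius_mod_ring)
  interpret gp: generic_point emb 2 "quartic_curve c" "jacobi_quartic.apt gen jq.y" by (rule jq.generic_C)
  interpret cg: curve_with_generic_point "\<lambda>a :: 'l mod_ring alg_closure. a ^ CARD('l)" emb "quartic_curve c" "jacobi_quartic.apt gen jq.y"
    by unfold_locales (rule jq.C_dependent)
  have "card (rational_points E') = card (rational_points jq.E)"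
    by (rule cg.card_rational_points_eq[OF E' jq.E_smooth_model])
  then show ?thesis
    using card_rational_points_E[OF l jq.jacobi_quartic_axioms] by (simp add: frobenius_trace_def)
qed

theorem corollary7p2:
  fixes c :: "'l::prime_card mod_ring"
  assumes "CARD('l) > 2"
    and "quadratic_nonresidue c"
  shows
    "(\<exists>n E. smooth_projective_model (quartic_curve c) n E) \<and>
     (\<forall>n E. smooth_projective_model (quartic_curve c) n E \<longrightarrow>
        uniform_variance (\<lambda>A. real_of_int (K A (c * A))) = real_of_int (frobenius_trace E ^ 2) \<and>
        frobenius_trace E ^ 2 \<le> 4 * int CARD('l)) \<and>
     (\<forall>\<mu>::real. \<mu> > 0 \<longrightarrow>
        1 / (real CARD('l) - 1) *
          real (card {A :: 'l mod_ring. A \<noteq> 0 \<and>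
            \<bar>real_of_int (K A (c * A)) + 1\<bar> \<ge> \<mu> * sqrt (real CARD('l))})
        \<le> 4 / \<mu> ^ 2) \<and>
     (\<forall>\<gamma> :: 'l mod_ring. primitive_root \<gamma> \<longrightarrow>
       (\<forall>\<mu>::real. \<mu> > 0 \<longrightarrow>
          1 / (real CARD('l) - 1) *
            real (card {N :: 'l mod_ring. N \<noteq> 0 \<and>
              \<bar>real (card (U \<gamma> (\<gamma> ^ 2) N)) - 3 * real CARD('l) / 4\<bar>
                \<ge> (\<mu> * sqrt (real CARD('l)) + 3) / 4})
          \<le> 4 / \<mu> ^ 2))"
proof (intro conjI allI impI)
  note l = assms(1)
  have c: "chi c = -1" using assms(2) by (simp add: quadratic_nonresidue_iff_chi)
  show "\<exists>n E. smooth_projective_model (quartic_curve c) n E"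
    using jacobi_quartic.E_smooth_model[OF jacobi_quartic_if_nonresidue[OF l c]] by blast
  fix n and E :: "'l mod_ring alg_closure ppoint set"
  assume E: "smooth_projective_model (quartic_curve c) n E"
  have t: "frobenius_trace E ^ 2 = (K 1 c + 1) ^ 2"
    unfolding frobenius_trace_quartic[OF l c E] by (rule power2_minus)
  show "uniform_variance (\<lambda>A. real_of_int (K A (c * A))) = real_of_int (frobenius_trace E ^ 2)"
    unfolding t by (rule variance_K[OF l c])
  show "frobenius_trace E ^ 2 \<le> 4 * int CARD('l)"
    unfolding t by (rule K_hasse[OF l c])
next
  fix \<mu> :: real assume \<mu>: "\<mu> > 0"
  have c: "chi c = -1" using assms(2) by (simp add: quadratic_nonresidue_iff_chi)
  show "1 / (real CARD('l) - 1) * real (card {A :: 'l mod_ring. A \<noteq> 0 \<and>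
            \<bar>real_of_int (K A (c * A)) + 1\<bar> \<ge> \<mu> * sqrt (real CARD('l))}) \<le> 4 / \<mu> ^ 2"
    by (rule K_tail[OF assms(1) c \<mu>])
next
  fix \<gamma> :: "'l mod_ring" and \<mu> :: real assume \<gamma>: "primitive_root \<gamma>" and \<mu>: "\<mu> > 0"
  have c: "chi c = -1" using assms(2) by (simp add: quadratic_nonresidue_iff_chi)
  show "1 / (real CARD('l) - 1) * real (card {N :: 'l mod_ring. N \<noteq> 0 \<and>
              \<bar>real (card (U \<gamma> (\<gamma> ^ 2) N)) - 3 * real CARD('l) / 4\<bar>
                \<ge> (\<mu> * sqrt (real CARD('l)) + 3) / 4}) \<le> 4 / \<mu> ^ 2"
    by (rule U_tail[OF assms(1) c \<gamma> \<mu>])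
qed

end
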